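(* For every $r\ge 2$ and $d\in\mathbb N$ there exists $s\in\mathbb N$ such that the following holds. Let $P\colon G\to TG$ be a polynomial vector field in a Carnot group $G$ of rank $r$, and let $P=\sum_{i=1}^nP_i\tilde X_i$ be its expansion in a left-invariant frame $\tilde X_1,\dots,\tilde X_n$ of vector fields adapted to the stratification on $G$ (so that $\tilde X_1,\dots,\tilde X_r$ are the horizontal ones). Suppose that the polynomials $P_i\colon G\to\mathbb R$ for the horizontal components $i=1,\dots,r$ have bounded degree $\deg(P_i)\le d$. Then all the horizontal trajectories of the ODE $\dot x=P(x)$ lift to abnormal curves in the free Carnot group $F_{r,s}$ of rank $r$ and step $s$.
   Context: A Carnot group is a simply connected nilpotent Lie group $G$ whose Lie algebra has a stratification $\mathfrak g=\mathfrak g^{[1]}\oplus\dots\oplus\mathfrak g^{[\sigma]}$ with $[\mathfrak g^{[1]},\mathfrak g^{[i]}]=\mathfrak g^{[i+1]}$ for $i=1,\dots,\sigma$, where $\mathfrak g^{[\sigma+1]}=\{0\}$ and $\mathfrak g^{[\sigma]}\ne\{0\}$. The rank is $r=\dim\mathfrak g^{[1]}$ and the step is $\sigma$. The free Carnot group $F_{r,s}$ is the Carnot group whose Lie algebra is the free nilpotent Lie algebra of rank $r$ and step $s$ (first layer spanned by the generators). An absolutely continuous curve $\gamma$ in $G$ is horizontal if $\dot\gamma(t)=(L_{\gamma(t)})_*u(t)$ for a.e. $t$, with control $u(t)\in\mathfrak g^{[1]}$, where $L_g$ denotes left translation by $g$. Lift: a Lie group homomorphism $\pi\colon F\to G$ between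 Carnot groups with Lie algebras $\mathfrak f$ and $\mathfrak g$ is a Carnot group homomorphism if $\pi_*(\mathfrak f^{[1]})\subset\mathfrak g^{[1]}$. Given a Carnot group homomorphism $\pi\colon F\to G$ and a horizontal curve $\gamma\colon(a,b)\to G$, a curve $\tilde\gamma\colon(a,b)\to F$ is a (horizontal) lift of $\gamma$ if $\tilde\gamma$ is horizontal in $F$ and $\pi\circ\tilde\gamma=\gamma$. Abnormal curves: for $u\in L^2([0,1];\mathfrak g^{[1]})$ let $\gamma_u$ be the horizontal curve with $\gamma_u(0)=e$ (the identity element) and control $u$; $\gamma_u$ is abnormal if $u$ is a critical point of the endpoint map $u\mapsto\gamma_u(1)$. Equivalently, there is a nonzero covector $\lambda\in\mathfrak g^*$ such that $\lambda(\operatorname{Ad}_{\gamma(t)}X)=0$ for all $t$ and all $X\in\mathfrak g^{[1]}$, where $\operatorname{Ad}_g$ is the differential at the identity of the conjugation $h\mapsto ghg^{-1}$. Abnormality is preserved by left translation and reparametrization, and the covector characterization is used for horizontal curves on arbitrary intervals with arbitrary starting point. A polynomial on $G$ is a function that is polynomial in exponential coordinates with respect to a basis of $\mathfrak g$ adapted to the stratification (each basis vector lies in some layer). The degree $\deg$ is the weighted degree, where the coordinate of a basis vector in $\mathfrak g^{[k]}$ has weight $k$. A vector field on $G$ is polynomial if its coefficients in a left-invariant frame are polynomials.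
   Formalization: For G of step above s a lift through a homomorphism from F_{r,s} to G cannot exist in general; there an abnormal curve in F_{r,s} with the same control is given, and a true lift when the step of G is at most s. Carnot groups are taken in exponential coordinates, up to isomorphism. *)

theory Defs
  imports "HOL-Analysis.Analysis" "HOL-Algebra.Group"
begin

text \<open>
  The dimensions of the groups are not bounded in advance, so every group lives on a
  finite-dimensional linear subspace of one fixed infinite-dimensional normed space. Every
  finite-dimensional real vector space is isomorphic to such a subspace, and all norms on it are
  equivalent.
\<close>

type_synonym ambient = "nat \<Rightarrow>\<^sub>C real"

text \<open>
  A simply connected nilpotent Lie group is written in exponential coordinates: its carrier is the
  vector space underlying its Lie algebra and the exponential map is the identity. Hence
  the carrier is its own tangent space at every point. The differentials and the Lie bracket below
  are derived from the group law.
\<close>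

record 'v carnot = "'v monoid" +
  layer :: "nat \<Rightarrow> 'v set"
  step :: nat

text \<open>Class \<open>C\<^sup>k\<close> on a linear subspace: all iterated directional derivatives up to order \<open>k\<close>
  exist and are continuous.\<close>

primrec Ck_on :: "nat \<Rightarrow> 'a::real_normed_vector set \<Rightarrow> ('a \<Rightarrow> 'b::real_normed_vector) \<Rightarrow> bool" where
  "Ck_on 0 V f \<longleftrightarrow> continuous_on V f"
| "Ck_on (Suc k) V f \<longleftrightarrow> continuous_on V f \<and>
     (\<forall>v\<in>V. \<exists>f'. (\<forall>x\<in>V. ((\<lambda>t. f (x + t *\<^sub>R v)) has_vector_derivative f' x) (at 0)) \<and> Ck_on k V f')"

definition smooth_on :: "'a::real_normed_vector set \<Rightarrow> ('a \<Rightarrow> 'b::real_normed_vector) \<Rightarrow> bool" where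
  "smooth_on V f \<longleftrightarrow> (\<forall>k. Ck_on k V f)"

text \<open>\<open>dL G g X\<close> is the differential at the identity of the left translation by \<open>g\<close>, applied
  to \<open>X\<close>; thus \<open>\<lambda>g. dL G g X\<close> is the left-invariant vector field of \<open>X\<close>.\<close>

definition dL :: "('v::real_normed_vector, 'm) carnot_scheme \<Rightarrow> 'v \<Rightarrow> 'v \<Rightarrow> 'v" where
  "dL G g X = vector_derivative (\<lambda>t. g \<otimes>\<^bsub>G\<^esub> (t *\<^sub>R X)) (at 0)"

definition Ad :: "('v::real_normed_vector, 'm) carnot_scheme \<Rightarrow> 'v \<Rightarrow> 'v \<Rightarrow> 'v" where
  "Ad G g X = vector_derivative (\<lambda>t. g \<otimes>\<^bsub>G\<^esub> (t *\<^sub>R X) \<otimes>\<^bsub>G\<^esub> inv\<^bsub>G\<^esub> g) (at 0)"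

text \<open>The value at the identity (the origin) of the commutator of the left-invariant vector fields
  of \<open>X\<close> and \<open>Y\<close>.\<close>

definition bracket :: "('v::real_normed_vector, 'm) carnot_scheme \<Rightarrow> 'v \<Rightarrow> 'v \<Rightarrow> 'v" where
  "bracket G X Y = vector_derivative (\<lambda>t. dL G (t *\<^sub>R X) Y) (at 0)
                 - vector_derivative (\<lambda>t. dL G (t *\<^sub>R Y) X) (at 0)"

definition bracket_space :: "('v::real_vector \<Rightarrow> 'v \<Rightarrow> 'v) \<Rightarrow> 'v set \<Rightarrow> 'v set \<Rightarrow> 'v set" where
  "bracket_space br A B = span {br x y | x y. x \<in> A \<and> y \<in> B}"

definition stratified :: "('v::real_normed_vector, 'm) carnot_scheme \<Rightarrow> bool" where
  "stratified G \<longleftrightarrow>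
     1 \<le> step G \<and>
     (\<forall>k\<in>{1..step G}. subspace (layer G k) \<and> layer G k \<subseteq> carrier G) \<and>
     (\<forall>x\<in>carrier G. \<exists>!y. y \<in> (\<Pi>\<^sub>E k\<in>{1..step G}. layer G k) \<and> x = (\<Sum>k=1..step G. y k)) \<and>
     (\<forall>i\<in>{1..step G}. bracket_space (bracket G) (layer G 1) (layer G i) = layer G (Suc i)) \<and>
     layer G (Suc (step G)) = {0} \<and>
     layer G (step G) \<noteq> {0}"

text \<open>The clause on \<open>(s + t) *\<^sub>R X\<close> says that the coordinates are exponential: the lines
  through the origin are the one-parameter subgroups.\<close>

definition carnot_group :: "('v::real_normed_vector, 'm) carnot_scheme \<Rightarrow> bool" where
  "carnot_group G \<longleftrightarrow>
     group G \<and>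
     (\<exists>B. finite B \<and> carrier G = span B) \<and>
     smooth_on (carrier G \<times> carrier G) (\<lambda>(x, y). x \<otimes>\<^bsub>G\<^esub> y) \<and>
     (\<forall>X\<in>carrier G. \<forall>s t. (s *\<^sub>R X) \<otimes>\<^bsub>G\<^esub> (t *\<^sub>R X) = (s + t) *\<^sub>R X) \<and>
     stratified G"

definition carnot_rank :: "('v::real_normed_vector, 'm) carnot_scheme \<Rightarrow> nat" where
  "carnot_rank G = dim (layer G 1)"

definition differential_at_one ::
  "('v::real_normed_vector \<Rightarrow> 'w::real_normed_vector) \<Rightarrow> 'v \<Rightarrow> 'w" where
  "differential_at_one \<pi> X = vector_derivative (\<lambda>t. \<pi> (t *\<^sub>R X)) (at 0)"

definition carnot_hom ::
  "('v::real_normed_vector, 'm) carnot_scheme \<Rightarrow> ('w::real_normed_vector, 'n) carnot_scheme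
    \<Rightarrow> ('v \<Rightarrow> 'w) \<Rightarrow> bool" where
  "carnot_hom F G \<pi> \<longleftrightarrow>
     \<pi> \<in> hom F G \<and> smooth_on (carrier F) \<pi> \<and> differential_at_one \<pi> ` layer F 1 \<subseteq> layer G 1"

definition lie_algebra_on :: "'v::real_vector set \<Rightarrow> ('v \<Rightarrow> 'v \<Rightarrow> 'v) \<Rightarrow> bool" where
  "lie_algebra_on V br \<longleftrightarrow>
     subspace V \<and>
     (\<forall>x\<in>V. \<forall>y\<in>V. br x y \<in> V) \<and>
     (\<forall>x\<in>V. \<forall>y\<in>V. \<forall>z\<in>V. br (x + y) z = br x z + br y z \<and> br z (x + y) = br z x + br z y) \<and>
     (\<forall>c. \<forall>x\<in>V. \<forall>y\<in>V. br (c *\<^sub>R x) y = c *\<^sub>R br x y \<and> br x (c *\<^sub>R y) = c *\<^sub>R br x y) \<and>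
     (\<forall>x\<in>V. br x x = 0) \<and>
     (\<forall>x\<in>V. \<forall>y\<in>V. \<forall>z\<in>V. br x (br y z) + br y (br z x) + br z (br x y) = 0)"

primrec lower_central :: "'v::real_vector set \<Rightarrow> ('v \<Rightarrow> 'v \<Rightarrow> 'v) \<Rightarrow> nat \<Rightarrow> 'v set" where
  "lower_central V br 0 = V"
| "lower_central V br (Suc k) = bracket_space br V (lower_central V br k)"

definition nilpotent_of_step_le :: "nat \<Rightarrow> 'v::real_vector set \<Rightarrow> ('v \<Rightarrow> 'v \<Rightarrow> 'v) \<Rightarrow> bool" where
  "nilpotent_of_step_le s V br \<longleftrightarrow> lower_central V br s = {0}"

definition lie_hom_on ::
  "'v::real_vector set \<Rightarrow> ('v \<Rightarrow> 'v \<Rightarrow> 'v) \<Rightarrow> 'w::real_vector set \<Rightarrow> ('w \<Rightarrow> 'w \<Rightarrow> 'w) \<Rightarrow> ('v \<Rightarrow> 'w) \<Rightarrow> bool"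
  where
  "lie_hom_on V br W br' \<phi> \<longleftrightarrow>
     linear \<phi> \<and> \<phi> ` V \<subseteq> W \<and> (\<forall>x\<in>V. \<forall>y\<in>V. \<phi> (br x y) = br' (\<phi> x) (\<phi> y))"

text \<open>The universal property: \<open>V\<close> is free on \<open>B\<close> among the Lie algebras of step at most \<open>s\<close>. The
  test algebras \<open>W\<close> range over subspaces of the same space \<open>'v\<close>, which for \<open>'v = ambient\<close>
  includes an isomorphic copy of every finite-dimensional nilpotent Lie algebra of step at
  most \<open>s\<close>.\<close>

definition free_nilpotent_on ::
  "nat \<Rightarrow> 'v::real_vector set \<Rightarrow> 'v set \<Rightarrow> ('v \<Rightarrow> 'v \<Rightarrow> 'v) \<Rightarrow> bool" where
  "free_nilpotent_on s B V br \<longleftrightarrow>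
     lie_algebra_on V br \<and> nilpotent_of_step_le s V br \<and> B \<subseteq> V \<and>
     (\<forall>(W :: 'v set) br' f.
        lie_algebra_on W br' \<and> nilpotent_of_step_le s W br' \<and> f ` B \<subseteq> W \<longrightarrow>
        (\<exists>\<phi>. lie_hom_on V br W br' \<phi> \<and> (\<forall>b\<in>B. \<phi> b = f b) \<and>
             (\<forall>\<psi>. lie_hom_on V br W br' \<psi> \<and> (\<forall>b\<in>B. \<psi> b = f b) \<longrightarrow> (\<forall>x\<in>V. \<psi> x = \<phi> x))))"

definition free_carnot_group ::
  "nat \<Rightarrow> nat \<Rightarrow> ('v::real_normed_vector, 'm) carnot_scheme \<Rightarrow> bool" where
  "free_carnot_group r s F \<longleftrightarrow>
     carnot_group F \<and>
     (\<exists>B. independent B \<and> card B = r \<and> span B = layer F 1 \<and>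
          free_nilpotent_on s B (carrier F) (bracket F))"

definition absolutely_continuous_on_interval ::
  "real \<Rightarrow> real \<Rightarrow> (real \<Rightarrow> 'v::real_normed_vector) \<Rightarrow> bool" where
  "absolutely_continuous_on_interval a b \<gamma> \<longleftrightarrow>
     (\<forall>\<epsilon>>0. \<exists>\<delta>>0. \<forall>(n::nat) l u.
        (\<forall>i<n. a \<le> l i \<and> l i \<le> u i \<and> u i \<le> b) \<and>
        (\<forall>i<n. \<forall>j<n. i \<noteq> j \<longrightarrow> {l i<..<u i} \<inter> {l j<..<u j} = {}) \<and>
        (\<Sum>i<n. u i - l i) < \<delta> \<longrightarrow> (\<Sum>i<n. norm (\<gamma> (u i) - \<gamma> (l i))) < \<epsilon>)"

text \<open>Intended for open \<open>I\<close>. On an open interval, absolute continuity is understood on compact subintervals, since a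
  trajectory need not extend continuously to the end points.\<close>

definition has_control ::
  "('v::real_normed_vector, 'm) carnot_scheme \<Rightarrow> real set \<Rightarrow> (real \<Rightarrow> 'v) \<Rightarrow> (real \<Rightarrow> 'v) \<Rightarrow> bool" where
  "has_control G I \<gamma> u \<longleftrightarrow>
     \<gamma> ` I \<subseteq> carrier G \<and> u ` I \<subseteq> layer G 1 \<and>
     (\<forall>a b. {a..b} \<subseteq> I \<longrightarrow> absolutely_continuous_on_interval a b \<gamma>) \<and>
     (AE t in lebesgue. t \<in> I \<longrightarrow> (\<gamma> has_vector_derivative dL G (\<gamma> t) (u t)) (at t))"

definition horizontal_curve ::
  "('v::real_normed_vector, 'm) carnot_scheme \<Rightarrow> real set \<Rightarrow> (real \<Rightarrow> 'v) \<Rightarrow> bool" where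
  "horizontal_curve G I \<gamma> \<longleftrightarrow> (\<exists>u. has_control G I \<gamma> u)"

definition is_lift ::
  "('v::real_normed_vector, 'm) carnot_scheme \<Rightarrow> ('v \<Rightarrow> 'w) \<Rightarrow> real set
    \<Rightarrow> (real \<Rightarrow> 'w) \<Rightarrow> (real \<Rightarrow> 'v) \<Rightarrow> bool" where
  "is_lift F \<pi> I \<gamma> \<eta> \<longleftrightarrow> horizontal_curve F I \<eta> \<and> (\<forall>t\<in>I. \<pi> (\<eta> t) = \<gamma> t)"

text \<open>Abnormality is taken in its covector form, which makes sense for any interval and any starting
  point. A covector is a linear form on the carrier, given here by any linear extension to the
  whole space.\<close>

definition abnormal_curve ::
  "('v::real_normed_vector, 'm) carnot_scheme \<Rightarrow> real set \<Rightarrow> (real \<Rightarrow> 'v) \<Rightarrow> bool" where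
  "abnormal_curve G I \<gamma> \<longleftrightarrow>
     horizontal_curve G I \<gamma> \<and>
     (\<exists>l :: 'v \<Rightarrow> real. linear l \<and> (\<exists>X\<in>carrier G. l X \<noteq> 0) \<and>
        (\<forall>t\<in>I. \<forall>X\<in>layer G 1. l (Ad G (\<gamma> t) X) = 0))"

text \<open>Basis vectors are indexed from \<open>0\<close>, so the horizontal ones are \<open>X 0, \<dots>, X (carnot_rank G - 1)\<close>.\<close>

definition adapted_basis ::
  "('v::real_normed_vector, 'm) carnot_scheme \<Rightarrow> nat \<Rightarrow> (nat \<Rightarrow> 'v) \<Rightarrow> bool" where
  "adapted_basis G n X \<longleftrightarrow>
     inj_on X {..<n} \<and> independent (X ` {..<n}) \<and> span (X ` {..<n}) = carrier G \<and>
     (\<forall>i<n. \<exists>k\<in>{1..step G}. X i \<in> layer G k) \<and>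
     (\<forall>i<n. X i \<in> layer G 1 \<longleftrightarrow> i < carnot_rank G)"

definition weight :: "('v::real_normed_vector, 'm) carnot_scheme \<Rightarrow> 'v \<Rightarrow> nat" where
  "weight G v = (THE k. k \<in> {1..step G} \<and> v \<in> layer G k)"

definition polynomial_of_degree_le ::
  "('v::real_normed_vector, 'm) carnot_scheme \<Rightarrow> nat \<Rightarrow> (nat \<Rightarrow> 'v) \<Rightarrow> nat \<Rightarrow> ('v \<Rightarrow> real) \<Rightarrow> bool" where
  "polynomial_of_degree_le G n X d p \<longleftrightarrow>
     (\<exists>(A :: (nat \<Rightarrow> nat) set) c. finite A \<and>
        (\<forall>\<alpha>\<in>A. (\<Sum>i<n. \<alpha> i * weight G (X i)) \<le> d) \<and>
        (\<forall>x\<in>carrier G. p x = (\<Sum>\<alpha>\<in>A. c \<alpha> * (\<Prod>i<n. representation (X ` {..<n}) x (X i) ^ \<alpha> i))))"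

definition polynomial_on ::
  "('v::real_normed_vector, 'm) carnot_scheme \<Rightarrow> nat \<Rightarrow> (nat \<Rightarrow> 'v) \<Rightarrow> ('v \<Rightarrow> real) \<Rightarrow> bool" where
  "polynomial_on G n X p \<longleftrightarrow> (\<exists>d. polynomial_of_degree_le G n X d p)"

definition horizontal_trajectory ::
  "('v::real_normed_vector, 'm) carnot_scheme \<Rightarrow> ('v \<Rightarrow> 'v) \<Rightarrow> real set \<Rightarrow> (real \<Rightarrow> 'v) \<Rightarrow> bool" where
  "horizontal_trajectory G P I \<gamma> \<longleftrightarrow>
     horizontal_curve G I \<gamma> \<and> (\<forall>t\<in>I. (\<gamma> has_vector_derivative P (\<gamma> t)) (at t))"

end

theory Submission
  imports Defs "HOL-Library.Function_Algebras" "HOL-Library.Nat_Bijection" "HOL-Library.List_Lexorder"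
begin

text \<open>
Let \<open>\<gamma>\<close> be a horizontal trajectory and \<open>u\<^sub>i = P\<^sub>i \<circ> \<gamma>\<close> its horizontal components. Let \<open>\<eta>\<close> be a curve
in the free group with the same control \<open>u\<close>. A covector that annihilates \<open>Ad\<^bsub>\<eta>(t)\<^esub> Y\<close> for all times
\<open>t\<close> and all horizontal \<open>Y\<close> exists as soon as these vectors do not span the free nilpotent Lie
algebra, and this is shown by comparing two dimensions.

Let \<open>A\<^sub>0\<close> consist of the constant functions of \<open>t\<close>, and let \<open>A\<^bsub>N+1\<^esub>\<close> consist of the functions whose
derivative is a combination of the \<open>u\<^sub>i\<close> with coefficients in \<open>A\<^sub>N\<close>; these are the iterated integrals
of the controls of length at most \<open>N + 1\<close>. Differentiating \<open>Ad\<^bsub>\<eta>(t)\<^esub> Y\<close> brackets \<open>Y\<close> with horizontal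
vectors, so in step \<open>s\<close> all its coordinates lie in \<open>A\<^sub>s\<close> (lemma \<open>Ad_alg\<close>), and the vectors
\<open>Ad\<^bsub>\<eta>(t)\<^esub> Y\<close> span a space of dimension at most \<open>r * dim A\<^sub>s\<close>.

For an arbitrary control, \<open>dim A\<^sub>N\<close> may grow like \<open>r\<^sup>N\<close>. Here it grows with a rate below \<open>r\<close>
(\<open>dual_family_bound\<close>). The coordinates of weight \<open>k\<close> of a horizontal curve lie in \<open>A\<^sub>k\<close>
(\<open>curve_component_alg\<close>) and \<open>A\<^sub>i A\<^sub>j \<subseteq> A\<^bsub>i+j\<^esub>\<close>, so a polynomial of weighted degree \<open>d\<close> gives
\<open>u\<^sub>i \<in> A\<^sub>d\<close> (\<open>polynomial_alg\<close>), whatever the dimension of \<open>G\<close> is. Then every \<open>f \<in> A\<^bsub>N-d\<^esub>\<close> gives linear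
relations \<open>(f u\<^sub>i) u\<^sub>j = (f u\<^sub>j) u\<^sub>i\<close> between the products \<open>a u\<^sub>l\<close>, \<open>a \<in> A\<^sub>N\<close>, that span the derivatives of
\<open>A\<^bsub>N+1\<^esub>\<close>. If \<open>u\<close> has no zero, this saves at least \<open>dim A\<^bsub>N-d\<^esub> / r\<close> dimensions, so that
\<open>dim A\<^bsub>N+1\<^esub> + dim A\<^bsub>N-d\<^esub> / r \<le> 1 + r dim A\<^sub>N\<close>. If \<open>u\<close> has a zero, then \<open>u = 0\<close>, because the \<open>u\<^sub>i\<close> solve
a homogeneous linear system, and every \<open>A\<^sub>N\<close> is one-dimensional. The resulting rate depends on \<open>r\<close>
and \<open>d\<close> only.

The free nilpotent Lie algebra grows with a rate that is exactly \<open>r\<close>: nested brackets of generators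
with prescribed leading words give enough independent elements (\<open>free_nilpotent_large_dimension\<close>).
Hence \<open>r dim A\<^sub>s < dim \<ff>\<^bsub>r,s\<^esub>\<close> for a suitable \<open>s\<close> that depends only on \<open>r\<close> and \<open>d\<close>.

The Lie theory is derived from the group law. In exponential coordinates conjugations are linear
maps, and the inverse of the differential of a left translation is the power series \<open>\<Theta>_formula\<close> in
the adjoint action. This series yields everything else: Lie algebra homomorphisms are group
homomorphisms (which gives \<open>\<pi>\<close>), left-invariant equations are solvable on the whole interval (which
gives \<open>\<eta>\<close>), and the coordinates of a horizontal curve can be computed layer by layer.
\<close>

section \<open>Differentiability on finite-dimensional subspaces\<close>

text \<open>Point evaluations are bounded functionals that separate the elements of the ambient space. One more
evaluation separates a new vector from its image under the projection built so far, so a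
finite-dimensional subspace has coordinates that extend to bounded functionals on the whole space.
This makes the usual calculus available for functions defined on the subspace only.\<close>

lemma independent_coordinates_ambient:
  fixes B :: "ambient set"
  assumes "finite B"
  shows "\<exists>C (\<phi> :: ambient \<Rightarrow> ambient \<Rightarrow> real). finite C \<and> C \<subseteq> span B \<and>
    (\<forall>c\<in>C. bounded_linear (\<phi> c)) \<and> (\<forall>x\<in>span B. (\<Sum>c\<in>C. \<phi> c x *\<^sub>R c) = x)"
  using assms
proof (induction B rule: finite_induct)
  case empty
  then show ?case by (intro exI[of _ "{}"]) auto
next
  case (insert b B)
  then obtain C \<phi> where C: "finite C" "C \<subseteq> span B" "\<And>c. c \<in> C \<Longrightarrow> bounded_linear (\<phi> c :: ambient \<Rightarrow> real)"
    and rep: "\<And>x. x \<in> span B \<Longrightarrow> (\<Sum>c\<in>C. \<phi> c x *\<^sub>R c) = x" by blast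
  have sub: "span B \<subseteq> span (insert b B)" by (simp add: span_mono subset_insertI)
  show ?case
  proof (cases "b \<in> span B")
    case True
    then have "span (insert b B) = span B" by (simp add: span_redundant)
    then show ?thesis using C rep by (intro exI[of _ C] exI[of _ \<phi>]) auto
  next
    case False
    define p where "p x = (\<Sum>c\<in>C. \<phi> c x *\<^sub>R c)" for x
    have p_span: "p x \<in> span B" for x
      unfolding p_def using C by (intro span_sum span_scale) auto
    have bl_p: "bounded_linear p" unfolding p_def[abs_def]
      using C(3) by (intro bounded_linear_sum bounded_linear_scaleR_const) auto
    interpret p: bounded_linear p by (rule bl_p)
    define b' where "b' = b - p b"
    have b'_notin: "b' \<notin> span B"
      using False p_span[of b] by (metis b'_def diff_add_cancel span_add)
    then have "b' \<noteq> 0" using span_0 by blast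
    then obtain n where n: "apply_bcontfun b' n \<noteq> 0"
      by (metis apply_bcontfun_inject[of b' 0] zero_bcontfun.rep_eq ext)
    have ev_le: "\<bar>apply_bcontfun x n\<bar> \<le> norm x" for x :: ambient
      using norm_bounded[of x n] by simp
    have bl_ev: "bounded_linear (\<lambda>x :: ambient. apply_bcontfun x n)"
      by (rule bounded_linear_intro[where K = 1])
         (use ev_le in \<open>auto simp: plus_bcontfun.rep_eq scaleR_bcontfun.rep_eq\<close>)
    define \<theta> where "\<theta> x = apply_bcontfun (x - p x) n / apply_bcontfun b' n" for x
    have bl_\<theta>: "bounded_linear \<theta>"
      unfolding \<theta>_def[abs_def] divide_inverse
      by (intro bounded_linear_compose[OF bounded_linear_mult_left]
          bounded_linear_compose[OF bl_ev] bounded_linear_sub bl_p bounded_linear_ident)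
    interpret t: bounded_linear \<theta> by (rule bl_\<theta>)
    have b'C: "b' \<notin> C" using b'_notin C by auto
    define \<psi> where "\<psi> c = (if c = b' then \<theta> else \<phi> c)" for c
    have eq: "(\<Sum>c\<in>insert b' C. \<psi> c x *\<^sub>R c) = p x + \<theta> x *\<^sub>R b'" for x
    proof -
      have "(\<Sum>c\<in>C. \<psi> c x *\<^sub>R c) = p x" unfolding p_def
        using b'C by (intro sum.cong) (auto simp: \<psi>_def)
      then show ?thesis using C b'C by (simp add: \<psi>_def)
    qed
    have p_id: "p x = x" if "x \<in> span B" for x using rep[OF that] by (simp add: p_def)
    have \<theta>_0: "\<theta> x = 0" if "x \<in> span B" for x
      using p_id[OF that] by (simp add: \<theta>_def zero_bcontfun.rep_eq)
    have \<theta>_b: "\<theta> b = 1" using n by (simp add: \<theta>_def b'_def)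
    have main: "(\<Sum>c\<in>insert b' C. \<psi> c x *\<^sub>R c) = x" if x: "x \<in> span (insert b B)" for x
    proof -
      obtain k where k: "x - k *\<^sub>R b \<in> span B" using x by (auto simp: span_insert)
      have "p x + \<theta> x *\<^sub>R b' = (p (x - k *\<^sub>R b) + \<theta> (x - k *\<^sub>R b) *\<^sub>R b') + k *\<^sub>R (p b + \<theta> b *\<^sub>R b')"
        by (simp add: p.diff t.diff p.scale t.scale algebra_simps)
      also have "\<dots> = x" by (simp add: p_id[OF k] \<theta>_0[OF k] \<theta>_b b'_def)
      finally show ?thesis by (simp add: eq)
    qed
    have "b' \<in> span (insert b B)" unfolding b'_def
      using p_span[of b] sub by (intro span_diff) (auto intro: span_base)
    then show ?thesis
      using C sub bl_\<theta> main b'C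
      by (intro exI[of _ "insert b' C"] exI[of _ \<psi>]) (auto simp: \<psi>_def)
  qed
qed

text \<open>Continuous directional derivatives along a finite family give Frechet derivatives. The function
is precomposed with a projection, because a derivative relative to a subspace would still need a
bounded linear map on the whole space.\<close>

lemma has_derivative_from_directional:
  fixes f :: "'a::real_normed_vector \<Rightarrow> 'b::real_normed_vector" and \<phi> :: "'a \<Rightarrow> 'a \<Rightarrow> real"
  assumes "finite C" and W: "subspace W" and "C \<subseteq> W"
    and bl: "\<And>c. c \<in> C \<Longrightarrow> bounded_linear (\<phi> c)"
    and cont: "\<And>c. c \<in> C \<Longrightarrow> continuous_on W (f' c)"
    and dir: "\<And>c x. c \<in> C \<Longrightarrow> x \<in> W \<Longrightarrow> ((\<lambda>t. f (x + t *\<^sub>R c)) has_vector_derivative f' c x) (at 0)"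
    and "z \<in> W"
  shows "((\<lambda>x. f (z + (\<Sum>c\<in>C. \<phi> c x *\<^sub>R c))) has_derivative
      (\<lambda>h. \<Sum>c\<in>C. \<phi> c h *\<^sub>R f' c (z + (\<Sum>c\<in>C. \<phi> c x *\<^sub>R c)))) (at x)"
  using assms(1,3-7)
proof (induction C arbitrary: z rule: finite_induct)
  case empty
  then show ?case by simp
next
  case (insert b C)
  define q where "q x = (\<Sum>c\<in>C. \<phi> c x *\<^sub>R c)" for x
  have bW: "b \<in> W" using insert.prems by auto
  have CW: "C \<subseteq> W" using insert.prems by auto
  have qW: "q x \<in> W" for x
    unfolding q_def by (intro subspace_sum[OF W] subspace_scale[OF W]) (use CW in auto)
  have bl_q: "bounded_linear q" unfolding q_def[abs_def]
    using insert.prems(2) by (intro bounded_linear_sum bounded_linear_scaleR_const) auto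
  interpret b: bounded_linear "\<phi> b" using insert.prems by auto
  have W_in: "z + q x + y *\<^sub>R b \<in> W" for x y
    using W bW qW insert.prems(5) by (intro subspace_add subspace_scale) auto
  define F where "F x y = f (z + q x + y *\<^sub>R b)" for x y
  define fy where "fy x y = blinfun_scaleR_left (f' b (z + q x + y *\<^sub>R b))" for x :: 'a and y :: real
  define fx where "fx x y h = (\<Sum>c\<in>C. \<phi> c h *\<^sub>R f' c (z + q x + y *\<^sub>R b))" for x y h
  have "((\<lambda>(x, y). F x y) has_derivative (\<lambda>(tx, ty). fx x (\<phi> b x) tx + fy x (\<phi> b x) ty))
     (at (x, \<phi> b x) within UNIV \<times> UNIV)"
  proof (rule has_derivative_partialsI)
    show "((\<lambda>xa. F xa (\<phi> b x)) has_derivative fx x (\<phi> b x)) (at x within UNIV)"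
    proof -
      have zb: "z + \<phi> b x *\<^sub>R b \<in> W" using W bW insert.prems(5) by (intro subspace_add subspace_scale) auto
      have "((\<lambda>y. f ((z + \<phi> b x *\<^sub>R b) + (\<Sum>c\<in>C. \<phi> c y *\<^sub>R c))) has_derivative
        (\<lambda>h. \<Sum>c\<in>C. \<phi> c h *\<^sub>R f' c ((z + \<phi> b x *\<^sub>R b) + (\<Sum>c\<in>C. \<phi> c x *\<^sub>R c)))) (at x)"
        using CW zb insert.prems by (intro insert.IH) auto
      then show ?thesis by (simp add: F_def fx_def[abs_def] q_def ac_simps)
    qed
    show "((\<lambda>y. F x y) has_derivative blinfun_apply (fy x y)) (at y within UNIV)" for x y
    proof -
      have d: "((\<lambda>t. f ((z + q x + y *\<^sub>R b) + t *\<^sub>R b)) has_vector_derivative f' b (z + q x + y *\<^sub>R b)) (at 0)"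
        using insert.prems W_in by auto
      have "((\<lambda>y'. f ((z + q x + y *\<^sub>R b) + (y' - y) *\<^sub>R b)) has_vector_derivative 1 *\<^sub>R f' b (z + q x + y *\<^sub>R b)) (at y)"
        by (rule vector_diff_chain_at[where f = "\<lambda>y'. y' - y" and g = "\<lambda>t. f ((z + q x + y *\<^sub>R b) + t *\<^sub>R b)", unfolded o_def])
           (auto intro!: derivative_eq_intros d simp: has_real_derivative_iff_has_vector_derivative[symmetric])
      then show ?thesis
        by (simp add: F_def fy_def has_vector_derivative_def algebra_simps)
    qed
    have "continuous_on UNIV (\<lambda>w. f' b (z + q (fst w) + snd w *\<^sub>R b))"
      by (rule continuous_on_compose2[OF insert.prems(3)])
         (auto intro!: continuous_intros bounded_linear.continuous_on[OF bl_q] W_in)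
    then have "continuous_on UNIV (\<lambda>w. fy (fst w) (snd w))"
      unfolding fy_def by (intro bounded_linear.continuous_on[OF bounded_linear_blinfun_scaleR_left])
    then show "continuous (at (x, \<phi> b x) within UNIV \<times> UNIV) (\<lambda>(x, y). fy x y)"
      by (simp add: continuous_on_eq_continuous_within split_beta')
  qed auto
  then have "((\<lambda>(x, y). F x y) has_derivative (\<lambda>(tx, ty). fx x (\<phi> b x) tx + fy x (\<phi> b x) ty)) (at (x, \<phi> b x))"
    by simp
  moreover have "((\<lambda>x. (x, \<phi> b x)) has_derivative (\<lambda>h. (h, \<phi> b h))) (at x)"
    by (intro has_derivative_Pair has_derivative_ident b.has_derivative)
  ultimately have "((\<lambda>x. F x (\<phi> b x)) has_derivative (\<lambda>h. fx x (\<phi> b x) h + fy x (\<phi> b x) (\<phi> b h))) (at x)"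
    using has_derivative_compose[of "\<lambda>x. (x, \<phi> b x)" "\<lambda>h. (h, \<phi> b h)" x UNIV "\<lambda>(x, y). F x y"
        "\<lambda>(tx, ty). fx x (\<phi> b x) tx + fy x (\<phi> b x) ty"] by auto
  then show ?case
    using insert.hyps by (simp add: F_def fx_def fy_def q_def algebra_simps)
qed

section \<open>Conjugation and the Lie bracket in exponential coordinates\<close>

lemma has_vector_derivative_shift_0:
  "((\<lambda>h. f (t + h)) has_vector_derivative d) (at 0) \<longleftrightarrow> (f has_vector_derivative d) (at (t::real))"
proof
  assume "((\<lambda>h. f (t + h)) has_vector_derivative d) (at 0)"
  then have *: "((\<lambda>h. f (t + h)) has_vector_derivative d) (at (t - t))" by simp
  have "((\<lambda>s. f (t + (s - t))) has_vector_derivative 1 *\<^sub>R d) (at t)"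
    by (rule vector_diff_chain_at[where f = "\<lambda>s. s - t", unfolded o_def, OF _ *])
       (auto intro!: derivative_eq_intros)
  then show "(f has_vector_derivative d) (at t)" by simp
next
  assume "(f has_vector_derivative d) (at t)"
  then have *: "(f has_vector_derivative d) (at (t + 0))" by simp
  have "((\<lambda>s. f (t + s)) has_vector_derivative 1 *\<^sub>R d) (at 0)"
    by (rule vector_diff_chain_at[where f = "\<lambda>s. t + s", unfolded o_def, OF _ *])
       (auto intro!: derivative_eq_intros)
  then show "((\<lambda>h. f (t + h)) has_vector_derivative d) (at 0)" by simp
qed

lemma has_vector_derivative_scaleR_continuous:
  fixes g :: "real \<Rightarrow> 'a::real_normed_vector"
  assumes "isCont g 0"
  shows "((\<lambda>h. h *\<^sub>R g h) has_vector_derivative g 0) (at 0)"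
  unfolding has_vector_derivative_def has_derivative_at
proof safe
  show "bounded_linear (\<lambda>x::real. x *\<^sub>R g 0)" by (rule bounded_linear_scaleR_left)
  have "(\<lambda>h. norm (g h - g 0)) \<midarrow>0\<rightarrow> 0"
    using assms by (intro tendsto_norm_zero) (auto simp: isCont_def LIM_zero_iff)
  then show "(\<lambda>h. norm ((0 + h) *\<^sub>R g (0 + h) - 0 *\<^sub>R g 0 - h *\<^sub>R g 0) / norm h) \<midarrow>0\<rightarrow> 0"
    by (rule Lim_transform_eventually)
       (auto simp: eventually_at_filter scaleR_diff_right[symmetric])
qed

text \<open>In exponential coordinates the identity is \<open>0\<close>, the inverse of \<open>x\<close> is \<open>- x\<close>, and the carrier \<open>V\<close>
is both the group and its Lie algebra.\<close>

locale carnot =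
  fixes G :: "ambient carnot" (structure)
  assumes carnot_G: "carnot_group G"
begin

abbreviation V where "V \<equiv> carrier G"

lemma group_G: "group G" and V_fin: "\<exists>B. finite B \<and> V = span B"
  and V_smooth: "smooth_on (V \<times> V) (\<lambda>(x, y). x \<otimes> y)"
  and V_exp: "X \<in> V \<Longrightarrow> (s *\<^sub>R X) \<otimes> (t *\<^sub>R X) = (s + t) *\<^sub>R X"
  and stratified_G: "stratified G"
  using carnot_G unfolding carnot_group_def by auto

sublocale group G by (rule group_G)

lemma subspace_V: "subspace V" using V_fin by auto

lemma zero_V [simp]: "0 \<in> V" using subspace_V by (rule subspace_0)
lemma uminus_V [simp]: "x \<in> V \<Longrightarrow> - x \<in> V" using subspace_V by (rule subspace_neg)
lemma scaleR_V [simp]: "x \<in> V \<Longrightarrow> c *\<^sub>R x \<in> V" using subspace_V by (rule subspace_scale)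
lemma add_V [simp]: "x \<in> V \<Longrightarrow> y \<in> V \<Longrightarrow> x + y \<in> V" using subspace_V by (rule subspace_add)
lemma diff_V [simp]: "x \<in> V \<Longrightarrow> y \<in> V \<Longrightarrow> x - y \<in> V" using subspace_V by (rule subspace_diff)

lemma one_eq_0: "\<one> = 0"
  using V_exp[of 0 1 1] l_cancel_one[of 0 0] by simp

lemma inv_eq_uminus: "x \<in> V \<Longrightarrow> inv x = - x"
  using V_exp[of x "-1" 1] by (intro inv_equality) (auto simp: one_eq_0)

lemma coords_ex: "\<exists>C (\<phi> :: ambient \<Rightarrow> ambient \<Rightarrow> real). finite C \<and> C \<subseteq> V \<and>
    (\<forall>c\<in>C. bounded_linear (\<phi> c)) \<and> (\<forall>x\<in>V. (\<Sum>c\<in>C. \<phi> c x *\<^sub>R c) = x)"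
proof -
  obtain B where B: "finite B" "V = span B" using V_fin by blast
  show ?thesis using independent_coordinates_ambient[OF B(1)] unfolding B(2) .
qed

definition frame :: "ambient set" where
  "frame = (SOME C. \<exists>\<phi> :: ambient \<Rightarrow> ambient \<Rightarrow> real. finite C \<and> C \<subseteq> V \<and>
    (\<forall>c\<in>C. bounded_linear (\<phi> c)) \<and> (\<forall>x\<in>V. (\<Sum>c\<in>C. \<phi> c x *\<^sub>R c) = x))"

definition coord :: "ambient \<Rightarrow> ambient \<Rightarrow> real" where
  "coord = (SOME \<phi>. finite frame \<and> frame \<subseteq> V \<and>
    (\<forall>c\<in>frame. bounded_linear (\<phi> c)) \<and> (\<forall>x\<in>V. (\<Sum>c\<in>frame. \<phi> c x *\<^sub>R c) = x))"

lemma coord_props: "finite frame \<and> frame \<subseteq> V \<and>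
    (\<forall>c\<in>frame. bounded_linear (coord c)) \<and> (\<forall>x\<in>V. (\<Sum>c\<in>frame. coord c x *\<^sub>R c) = x)"
proof -
  have "\<exists>\<phi> :: ambient \<Rightarrow> ambient \<Rightarrow> real. finite frame \<and> frame \<subseteq> V \<and>
    (\<forall>c\<in>frame. bounded_linear (\<phi> c)) \<and> (\<forall>x\<in>V. (\<Sum>c\<in>frame. \<phi> c x *\<^sub>R c) = x)"
    unfolding frame_def by (rule someI_ex[OF coords_ex])
  from someI_ex[OF this, folded coord_def] show ?thesis .
qed

lemma finite_frame: "finite frame" and frame_V: "frame \<subseteq> V"
  and bounded_linear_coord: "c \<in> frame \<Longrightarrow> bounded_linear (coord c)"
  and coord_sum: "x \<in> V \<Longrightarrow> (\<Sum>c\<in>frame. coord c x *\<^sub>R c) = x"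
  using coord_props by auto

text \<open>A bounded projection of the ambient space onto \<open>V\<close>.\<close>

definition pr :: "ambient \<Rightarrow> ambient" where "pr x = (\<Sum>c\<in>frame. coord c x *\<^sub>R c)"

lemma pr_id [simp]: "x \<in> V \<Longrightarrow> pr x = x" by (simp add: pr_def coord_sum)
lemma pr_V [simp]: "pr x \<in> V"
  unfolding pr_def using frame_V by (intro subspace_sum[OF subspace_V] scaleR_V) auto
lemma bounded_linear_pr: "bounded_linear pr"
  unfolding pr_def[abs_def]
  by (intro bounded_linear_sum bounded_linear_scaleR_const bounded_linear_coord)
sublocale pr: bounded_linear pr by (rule bounded_linear_pr)

lemma bounded_linear_on_V:
  fixes l :: "ambient \<Rightarrow> 'b::real_normed_vector"
  assumes add: "\<And>x y. x \<in> V \<Longrightarrow> y \<in> V \<Longrightarrow> l (x + y) = l x + l y"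
    and scale: "\<And>c x. x \<in> V \<Longrightarrow> l (c *\<^sub>R x) = c *\<^sub>R l x"
  shows "bounded_linear (\<lambda>x. l (pr x))"
proof -
  have l0: "l 0 = 0" using scale[of 0 0] by simp
  have "l (\<Sum>c\<in>C. g c *\<^sub>R c) = (\<Sum>c\<in>C. g c *\<^sub>R l c)" if "C \<subseteq> frame" "finite C" for C g
    using that(2,1)
  proof (induction C rule: finite_induct)
    case (insert b C)
    have "(\<Sum>c\<in>C. g c *\<^sub>R c) \<in> V" using frame_V insert.prems
      by (intro subspace_sum[OF subspace_V] scaleR_V) auto
    then show ?case using insert frame_V by (simp add: add scale subset_iff)
  qed (simp add: l0)
  then have "(\<lambda>x. l (pr x)) = (\<lambda>x. \<Sum>c\<in>frame. coord c x *\<^sub>R l c)"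
    unfolding pr_def using finite_frame by auto
  then show ?thesis
    by (auto intro!: bounded_linear_sum bounded_linear_scaleR_const bounded_linear_coord)
qed

text \<open>The product extended to the whole ambient space by projecting the factors. It is differentiable
everywhere, and the group laws hold for it up to applications of \<open>pr\<close>.\<close>

definition mu :: "ambient \<Rightarrow> ambient \<Rightarrow> ambient" where "mu x y = pr x \<otimes> pr y"

lemma mu_eq: "x \<in> V \<Longrightarrow> y \<in> V \<Longrightarrow> mu x y = x \<otimes> y" by (simp add: mu_def)
lemma mu_V [simp]: "mu x y \<in> V" by (simp add: mu_def)
lemma mu_assoc: "mu (mu x y) z = mu x (mu y z)" by (simp add: mu_def m_assoc)
lemma mu_pr [simp]: "mu (pr x) y = mu x y" "mu x (pr y) = mu x y" by (simp_all add: mu_def)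
lemma mu_0 [simp]: "mu 0 x = pr x" "mu x 0 = pr x"
  using r_one[of "pr x"] l_one[of "pr x"] by (simp_all add: mu_def one_eq_0 del: r_one l_one)
lemma mu_inv [simp]: "mu x (- x) = 0" "mu (- x) x = 0"
  using l_inv[of "pr x"] r_inv[of "pr x"]
  by (simp_all add: mu_def pr.neg inv_eq_uminus one_eq_0 del: l_inv r_inv)
lemma mu_inv_cancel [simp]: "mu (- x) (mu x y) = pr y" "mu x (mu (- x) y) = pr y"
  by (simp_all add: mu_assoc[symmetric])
lemma mu_uminus: "- mu x y = mu (- y) (- x)"
  using inv_mult_group[of "pr x" "pr y"] by (simp add: mu_def pr.neg inv_eq_uminus)
lemma mu_scale: "mu (s *\<^sub>R x) (t *\<^sub>R x) = (s + t) *\<^sub>R pr x"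
  by (simp add: mu_def pr.scale V_exp)

lemma mu_C1: "\<exists>dM. (\<forall>z. ((\<lambda>(x, y). mu x y) has_derivative dM z) (at z)) \<and>
   (\<forall>h. continuous_on UNIV (\<lambda>z. dM z h))"
proof -
  \<comment> \<open>The zero vector is left out on the right so that the two images are disjoint.\<close>
  define C where "C = (\<lambda>c. (c, 0 :: ambient)) ` frame \<union> (\<lambda>c. (0 :: ambient, c)) ` (frame - {0})"
  define \<phi> where "\<phi> b x = (if snd b = 0 then coord (fst b) (fst x) else coord (snd b) (snd x))"
    for b x :: "ambient \<times> ambient"
  have C: "finite C" "C \<subseteq> V \<times> V" using finite_frame frame_V by (auto simp: C_def)
  have W: "subspace (V \<times> V)" using subspace_V by (rule subspace_Times[OF subspace_V])
  have "Ck_on (Suc 0) (V \<times> V) (\<lambda>(x, y). x \<otimes> y)" using V_smooth by (auto simp: smooth_on_def)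
  then have "\<forall>v\<in>V \<times> V. \<exists>f'. (\<forall>x\<in>V \<times> V.
       ((\<lambda>t. (\<lambda>(x, y). x \<otimes> y) (x + t *\<^sub>R v)) has_vector_derivative f' x) (at 0)) \<and>
       continuous_on (V \<times> V) f'"
    unfolding Ck_on.simps by (rule conjunct2)
  from bchoice[OF this] obtain f' where F: "\<forall>v\<in>V \<times> V. (\<forall>x\<in>V \<times> V.
       ((\<lambda>t. (\<lambda>(x, y). x \<otimes> y) (x + t *\<^sub>R v)) has_vector_derivative f' v x) (at 0)) \<and>
       continuous_on (V \<times> V) (f' v)" ..
  have f': "((\<lambda>t. (\<lambda>(x, y). x \<otimes> y) (x + t *\<^sub>R v)) has_vector_derivative f' v x) (at 0)"
    if "v \<in> V \<times> V" "x \<in> V \<times> V" for v x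
    using bspec[OF F that(1)] that(2) by blast
  have cont: "continuous_on (V \<times> V) (f' v)" if "v \<in> V \<times> V" for v
    using bspec[OF F that(1)] by blast
  have bl: "bounded_linear (\<phi> c)" if "c \<in> C" for c
  proof (cases "snd c = 0")
    case True
    then have "fst c \<in> frame" using that by (auto simp: C_def)
    then show ?thesis using True unfolding \<phi>_def
      by (auto intro!: bounded_linear_compose[OF bounded_linear_coord bounded_linear_fst])
  next
    case False
    then have "snd c \<in> frame" using that by (auto simp: C_def)
    then show ?thesis using False unfolding \<phi>_def
      by (auto intro!: bounded_linear_compose[OF bounded_linear_coord bounded_linear_snd])
  qed
  have sum_C: "(\<Sum>c\<in>C. \<phi> c x *\<^sub>R c) = (pr (fst x), pr (snd x))" for x
  proof -
    have "(\<Sum>c\<in>C. \<phi> c x *\<^sub>R c) = (\<Sum>c\<in>(\<lambda>c. (c, 0)) ` frame. \<phi> c x *\<^sub>R c)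
        + (\<Sum>c\<in>(\<lambda>c. (0, c)) ` (frame - {0}). \<phi> c x *\<^sub>R c)"
      unfolding C_def using finite_frame by (intro sum.union_disjoint) auto
    also have "(\<Sum>c\<in>(\<lambda>c. (c, 0)) ` frame. \<phi> c x *\<^sub>R c) = (\<Sum>c\<in>frame. (coord c (fst x) *\<^sub>R c, 0))"
      by (subst sum.reindex) (auto simp: inj_on_def \<phi>_def)
    also have "(\<Sum>c\<in>(\<lambda>c. (0, c)) ` (frame - {0}). \<phi> c x *\<^sub>R c)
       = (\<Sum>c\<in>frame - {0}. (0, coord c (snd x) *\<^sub>R c))"
      by (subst sum.reindex) (auto simp: inj_on_def \<phi>_def)
    also have "\<dots> = (\<Sum>c\<in>frame. (0, coord c (snd x) *\<^sub>R c))"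
      using finite_frame by (intro sum.mono_neutral_left) (auto simp: zero_prod_def)
    finally show ?thesis by (simp add: pr_def sum_prod)
  qed
  define dM where "dM x h = (\<Sum>c\<in>C. \<phi> c h *\<^sub>R f' c (pr (fst x), pr (snd x)))" for x h
  have "((\<lambda>(x, y). mu x y) has_derivative dM z) (at z)" for z
  proof -
    have "((\<lambda>x. (\<lambda>(x, y). x \<otimes> y) (0 + (\<Sum>c\<in>C. \<phi> c x *\<^sub>R c))) has_derivative
      (\<lambda>h. \<Sum>c\<in>C. \<phi> c h *\<^sub>R f' c (0 + (\<Sum>c\<in>C. \<phi> c z *\<^sub>R c)))) (at z)"
      by (rule has_derivative_from_directional[OF C(1) W C(2) bl])
         (use C f' cont in \<open>auto simp: zero_prod_def\<close>)
    then show ?thesis unfolding sum_C dM_def[abs_def] by (simp add: mu_def split_beta')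
  qed
  moreover have "continuous_on UNIV (\<lambda>z. dM z h)" for h
    unfolding dM_def
  proof (intro continuous_intros)
    fix c assume "c \<in> C"
    then have "continuous_on (V \<times> V) (f' c)" using C cont by auto
    then show "continuous_on UNIV (\<lambda>z. f' c (pr (fst z), pr (snd z)))"
      by (rule continuous_on_compose2)
         (auto intro!: continuous_intros bounded_linear.continuous_on[OF bounded_linear_pr])
  qed
  ultimately show ?thesis by blast
qed

text \<open>The Frechet derivative of \<open>mu\<close>.\<close>

definition dM :: "ambient \<times> ambient \<Rightarrow> ambient \<times> ambient \<Rightarrow> ambient" where
  "dM = (SOME dM. (\<forall>z. ((\<lambda>(x, y). mu x y) has_derivative dM z) (at z)) \<and>
   (\<forall>h. continuous_on UNIV (\<lambda>z. dM z h)))"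

lemma mu_has_derivative: "((\<lambda>(x, y). mu x y) has_derivative dM z) (at z)"
  and continuous_dM: "continuous_on UNIV (\<lambda>z. dM z h)"
  using someI_ex[OF mu_C1, folded dM_def] by blast+

lemma dM_linear: "bounded_linear (dM z)" using mu_has_derivative by (rule has_derivative_bounded_linear)

lemma dM_add: "dM z (a, b) = dM z (a, 0) + dM z (0, b)"
  using bounded_linear.linear[OF dM_linear, THEN linear_add, of z "(a, 0)" "(0, b)"] by simp

lemma mu_vector_derivative:
  assumes "(a has_vector_derivative a') (at t)" "(b has_vector_derivative b') (at t)"
  shows "((\<lambda>s. mu (a s) (b s)) has_vector_derivative dM (a t, b t) (a', b')) (at t)"
proof -
  have "((\<lambda>s. (a s, b s)) has_derivative (\<lambda>x. x *\<^sub>R (a', b'))) (at t)"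
    using has_derivative_Pair[OF assms[unfolded has_vector_derivative_def]] by simp
  moreover have "dM (a t, b t) (x *\<^sub>R a', x *\<^sub>R b') = x *\<^sub>R dM (a t, b t) (a', b')" for x
    using linear_scale[OF bounded_linear.linear[OF dM_linear], of "(a t, b t)" x "(a', b')"] by simp
  ultimately show ?thesis
    using has_derivative_compose[OF _ mu_has_derivative] unfolding has_vector_derivative_def
    by fastforce
qed

text \<open>\<open>L x\<close> is the differential at \<open>0\<close> of the left translation by \<open>x\<close>, and \<open>\<Theta> x\<close> is the differential at
\<open>x\<close> of the left translation by \<open>- x\<close>; they are inverse to each other on \<open>V\<close>.\<close>

definition L where "L x v = dM (x, 0) (0, v)"
definition \<Theta> where "\<Theta> x v = dM (- x, x) (0, v)"

lemma L_vector_derivative: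
  assumes "(k has_vector_derivative u) (at 0)" "k 0 = 0"
  shows "((\<lambda>h. mu x (k h)) has_vector_derivative L x u) (at 0)"
  using mu_vector_derivative[OF has_vector_derivative_const assms(1), of x] assms(2)
  by (simp add: L_def)

lemma scale_vector_derivative: "((\<lambda>s. s *\<^sub>R v) has_vector_derivative v) (at s)"
  by (auto intro!: derivative_eq_intros)

lemma dM_0: "dM (0, 0) (a, b) = pr a + pr b"
proof -
  have "((\<lambda>s. mu (s *\<^sub>R a) 0) has_vector_derivative dM (0, 0) (a, 0)) (at 0)"
    using mu_vector_derivative[of "\<lambda>s. s *\<^sub>R a" a 0 "\<lambda>_. 0" 0] scale_vector_derivative[of a 0] by simp
  then have "((\<lambda>s. s *\<^sub>R pr a) has_vector_derivative dM (0, 0) (a, 0)) (at 0)" by (simp add: pr.scale)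
  from vector_derivative_unique_at[OF this scale_vector_derivative]
  have 1: "dM (0, 0) (a, 0) = pr a" .
  have "((\<lambda>s. mu 0 (s *\<^sub>R b)) has_vector_derivative dM (0, 0) (0, b)) (at 0)"
    using mu_vector_derivative[of "\<lambda>_. 0" 0 0 "\<lambda>s. s *\<^sub>R b" b] scale_vector_derivative[of b 0] by simp
  then have "((\<lambda>s. s *\<^sub>R pr b) has_vector_derivative dM (0, 0) (0, b)) (at 0)" by (simp add: pr.scale)
  from vector_derivative_unique_at[OF this scale_vector_derivative]
  have 2: "dM (0, 0) (0, b) = pr b" .
  show ?thesis using dM_add[of _ a b] 1 2 by simp
qed

lemma L_0 [simp]: "L 0 v = pr v" and \<Theta>_0 [simp]: "\<Theta> 0 v = pr v"
  by (simp_all add: L_def \<Theta>_def dM_0)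

lemma mu_dx: "((\<lambda>s. mu x (y + s *\<^sub>R v)) has_vector_derivative dM (x, y) (0, v)) (at 0)"
proof -
  have "((\<lambda>s. y + s *\<^sub>R v) has_vector_derivative v) (at 0)" by (auto intro!: derivative_eq_intros)
  from mu_vector_derivative[OF has_vector_derivative_const this, of x] show ?thesis by simp
qed

lemma \<Theta>_vector_derivative: "((\<lambda>s. mu (- x) (x + s *\<^sub>R v)) has_vector_derivative \<Theta> x v) (at 0)"
  using mu_dx[of "- x" x v] by (simp add: \<Theta>_def)

lemma vector_derivative_in_V:
  assumes "(c has_vector_derivative d) (at t)" "\<And>s. c s \<in> V"
  shows "d \<in> V"
proof -
  have "((\<lambda>s. pr (c s)) has_vector_derivative pr d) (at t)"
    using pr.has_vector_derivative[OF assms(1)] .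
  moreover have "(\<lambda>s. pr (c s)) = c" using assms(2) by auto
  ultimately have "pr d = d" using assms(1) vector_derivative_unique_at by fastforce
  then show ?thesis by (metis pr_V)
qed

lemma L_V [simp]: "L x v \<in> V"
  by (rule vector_derivative_in_V[OF L_vector_derivative[OF scale_vector_derivative]]) auto
lemma \<Theta>_V [simp]: "\<Theta> x v \<in> V" by (rule vector_derivative_in_V[OF \<Theta>_vector_derivative]) auto

lemma bounded_linear_L: "bounded_linear (L x)" and bounded_linear_\<Theta>: "bounded_linear (\<Theta> x)"
  unfolding L_def[abs_def] \<Theta>_def[abs_def]
  by (auto intro!: bounded_linear_compose[OF dM_linear] bounded_linear_Pair
      bounded_linear_zero bounded_linear_ident)
sublocale L: bounded_linear "L x" for x by (rule bounded_linear_L)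
sublocale \<Theta>: bounded_linear "\<Theta> x" for x by (rule bounded_linear_\<Theta>)

lemma L_pr [simp]: "L x (pr v) = L x v"
proof -
  have "((\<lambda>s. mu x (s *\<^sub>R pr v)) has_vector_derivative L x (pr v)) (at 0)"
    by (rule L_vector_derivative[OF scale_vector_derivative]) auto
  moreover have "((\<lambda>s. mu x (s *\<^sub>R v)) has_vector_derivative L x v) (at 0)"
    by (rule L_vector_derivative[OF scale_vector_derivative]) auto
  moreover have "(\<lambda>s. mu x (s *\<^sub>R pr v)) = (\<lambda>s. mu x (s *\<^sub>R v))"
    by (metis mu_pr(2) pr.scale)
  ultimately show ?thesis using vector_derivative_unique_at by fastforce
qed

lemma \<Theta>_L [simp]: "\<Theta> x (L x v) = pr v" if "x \<in> V"
proof -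
  have "((\<lambda>s. mu (- x) (mu x (s *\<^sub>R v))) has_vector_derivative dM (- x, mu x (0 *\<^sub>R v)) (0, L x v)) (at 0)"
    by (intro mu_vector_derivative has_vector_derivative_const L_vector_derivative scale_vector_derivative) auto
  then have "((\<lambda>s. s *\<^sub>R pr v) has_vector_derivative \<Theta> x (L x v)) (at 0)"
    using that by (simp add: \<Theta>_def pr.scale)
  from vector_derivative_unique_at[OF this scale_vector_derivative] show ?thesis .
qed

lemma L_\<Theta> [simp]: "L x (\<Theta> x v) = pr v"
proof -
  have "((\<lambda>s. mu x (mu (- x) (x + s *\<^sub>R v))) has_vector_derivative L x (\<Theta> x v)) (at 0)"
    by (rule L_vector_derivative[OF \<Theta>_vector_derivative]) auto
  then have *: "((\<lambda>s. pr x + s *\<^sub>R pr v) has_vector_derivative L x (\<Theta> x v)) (at 0)"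
    by (simp add: pr.scale pr.add)
  have "((\<lambda>s. pr x + s *\<^sub>R pr v) has_vector_derivative pr v) (at 0)"
    by (auto intro!: derivative_eq_intros)
  from vector_derivative_unique_at[OF * this] show ?thesis .
qed

text \<open>Left translation by \<open>- c t\<close> moves the velocity of a curve at time \<open>t\<close> to the identity. This turns
statements about an arbitrary point of a curve into statements at \<open>0\<close>.\<close>

lemma left_translate_derivative:
  assumes "(c has_vector_derivative L (c t) u) (at t)" "c t \<in> V"
  shows "((\<lambda>h. mu (- c t) (c (t + h))) has_vector_derivative pr u) (at 0)"
proof -
  have "((\<lambda>s. mu (- c t) (c s)) has_vector_derivative dM (- c t, c t) (0, L (c t) u)) (at t)"
    using mu_vector_derivative[OF has_vector_derivative_const assms(1), of "- c t"] by simp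
  then show ?thesis
    using assms(2) \<Theta>_L[of "c t" u] has_vector_derivative_shift_0[of "\<lambda>s. mu (- c t) (c s)" t]
    by (simp add: \<Theta>_def)
qed

text \<open>The quotient \<open>c1 * c2\<inverse>\<close> has derivative zero: near a time \<open>t\<close> it is the two-sided translate of
\<open>k1 * k2\<inverse>\<close>, where \<open>k1\<close> and \<open>k2\<close> start at the identity with the same velocity.\<close>

lemma left_invariant_ode_unique:
  assumes I: "open I" "is_interval I" "t0 \<in> I" "t \<in> I"
    and 1: "\<And>t. t \<in> I \<Longrightarrow> (c1 has_vector_derivative L (c1 t) (u t)) (at t)" "\<And>t. t \<in> I \<Longrightarrow> c1 t \<in> V"
    and 2: "\<And>t. t \<in> I \<Longrightarrow> (c2 has_vector_derivative L (c2 t) (u t)) (at t)" "\<And>t. t \<in> I \<Longrightarrow> c2 t \<in> V"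
    and 0: "c1 t0 = c2 t0"
  shows "c1 t = c2 t"
proof -
  define z where "z t = mu (c1 t) (- c2 t)" for t
  have z': "(z has_vector_derivative 0) (at t)" if t: "t \<in> I" for t
  proof -
    define k1 where "k1 h = mu (- c1 t) (c1 (t + h))" for h
    define k2 where "k2 h = mu (- c2 t) (c2 (t + h))" for h
    have k: "(k1 has_vector_derivative pr (u t)) (at 0)" "(k2 has_vector_derivative pr (u t)) (at 0)"
      unfolding k1_def[abs_def] k2_def[abs_def]
      using left_translate_derivative 1 2 t by auto
    have "((\<lambda>h. mu (k1 h) (- k2 h)) has_vector_derivative dM (k1 0, - k2 0) (pr (u t), - pr (u t))) (at 0)"
      by (intro mu_vector_derivative k has_vector_derivative_minus)
    then have "((\<lambda>h. mu (k1 h) (- k2 h)) has_vector_derivative 0) (at 0)"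
      by (simp add: k1_def k2_def dM_0 pr.neg)
    then have "((\<lambda>h. mu (c1 t) (mu (k1 h) (- k2 h))) has_vector_derivative L (c1 t) 0) (at 0)"
      by (rule L_vector_derivative) (simp add: k1_def k2_def)
    then have "((\<lambda>h. mu (mu (c1 t) (mu (k1 h) (- k2 h))) (- c2 t)) has_vector_derivative
        dM (mu (c1 t) (mu (k1 0) (- k2 0)), - c2 t) (L (c1 t) 0, 0)) (at 0)"
      by (intro mu_vector_derivative has_vector_derivative_const)
    moreover have "mu (mu (c1 t) (mu (k1 h) (- k2 h))) (- c2 t) = z (t + h)" for h
    proof -
      have "mu (mu (c1 t) (mu (k1 h) (- k2 h))) (- c2 t) = mu (mu (c1 t) (k1 h)) (mu (- k2 h) (- c2 t))"
        by (simp add: mu_assoc)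
      also have "mu (- k2 h) (- c2 t) = - mu (c2 t) (k2 h)" by (simp add: mu_uminus)
      finally show ?thesis by (simp add: k1_def k2_def z_def) (metis mu_pr(2) pr.neg)
    qed
    ultimately have "((\<lambda>h. z (t + h)) has_vector_derivative 0) (at 0)"
      using linear_0[OF bounded_linear.linear[OF dM_linear]] by (simp add: zero_prod_def L.zero)
    then show ?thesis by (simp add: has_vector_derivative_shift_0)
  qed
  have "z t = z t0"
  proof -
    have "convex I" using I by (simp add: is_interval_convex)
    then obtain c where "\<And>t. t \<in> I \<Longrightarrow> z t = c"
      using has_vector_derivative_zero_constant[of I z] z' has_vector_derivative_at_within by metis
    then show ?thesis using I by auto
  qed
  then have "mu (mu (c1 t) (- c2 t)) (c2 t) = c2 t" using 0 1 2 I by (simp add: z_def)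
  then show ?thesis using 1 2 I by (simp add: mu_assoc)
qed

text \<open>The conjugation of \<open>y\<close> by \<open>x\<close>.\<close>

definition Cj where "Cj x y = mu (mu x y) (- x)"

lemma Cj_V [simp]: "Cj x y \<in> V" by (simp add: Cj_def)
lemma Cj_0 [simp]: "Cj 0 y = pr y" "Cj x 0 = 0" by (simp_all add: Cj_def mu_assoc)
lemma Cj_pr [simp]: "Cj (pr x) y = Cj x y" "Cj x (pr y) = Cj x y"
  by (simp_all add: Cj_def pr.neg[symmetric])
lemma Cj_Cj: "Cj x (Cj y z) = Cj (mu x y) z" by (simp add: Cj_def mu_uminus mu_assoc)
lemma Cj_mu: "Cj x (mu y z) = mu (Cj x y) (Cj x z)"
  by (simp add: Cj_def mu_assoc)
lemma Cj_conj: "Cj z (Cj x y) = Cj (Cj z x) (Cj z y)"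
  by (simp add: Cj_def mu_uminus mu_assoc)

text \<open>Both sides solve the same left-invariant equation.\<close>

lemma one_parameter:
  assumes hom: "\<And>s t. c (s + t) = mu (c s) (c t)" and w: "(c has_vector_derivative w) (at 0)"
  shows "c t = t *\<^sub>R w"
proof -
  have cV: "c s \<in> V" for s by (metis add.right_neutral hom mu_V)
  have wV: "w \<in> V" using vector_derivative_in_V[OF w cV] .
  have c0: "c 0 = 0"
  proof -
    have "mu (- c 0) (c (0 + 0)) = mu (- c 0) (mu (c 0) (c 0))" by (simp only: hom)
    then show ?thesis using cV by simp
  qed
  show ?thesis
  proof (rule left_invariant_ode_unique[of UNIV 0 t c "\<lambda>_. w" "\<lambda>t. t *\<^sub>R w"])
    fix t
    show "(c has_vector_derivative L (c t) w) (at t)"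
      using L_vector_derivative[OF w c0, of "c t"]
      by (simp add: has_vector_derivative_shift_0[symmetric, of c] hom)
    have "((\<lambda>h. mu (t *\<^sub>R w) (h *\<^sub>R w)) has_vector_derivative L (t *\<^sub>R w) w) (at 0)"
      by (rule L_vector_derivative[OF scale_vector_derivative]) auto
    then show "((\<lambda>t. t *\<^sub>R w) has_vector_derivative L (t *\<^sub>R w) w) (at t)"
      using wV by (simp add: has_vector_derivative_shift_0[symmetric, of "\<lambda>t. t *\<^sub>R w"] mu_scale)
  qed (use cV wV c0 in auto)
qed

lemma Cj_has_derivative: "\<exists>\<Phi>. ((\<lambda>z. Cj (fst z) (snd z)) has_derivative \<Phi>) (at z)"
proof -
  have "((\<lambda>z. mu (fst z) (snd z)) has_derivative dM z) (at z)"
    using mu_has_derivative by (simp add: split_beta')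
  then have 1: "((\<lambda>z. (mu (fst z) (snd z), - fst z)) has_derivative (\<lambda>h. (dM z h, - fst h))) (at z)"
    by (auto intro!: derivative_intros)
  show ?thesis
    using has_derivative_compose[OF 1 mu_has_derivative] by (auto simp: Cj_def)
qed

text \<open>Conjugation maps one-parameter subgroups to one-parameter subgroups, hence lines through the origin
to such lines. So it is homogeneous, and a homogeneous map that is differentiable at \<open>0\<close> equals its
derivative there.\<close>

lemma bounded_linear_Cj: "bounded_linear (Cj x)"
proof -
  obtain \<Phi> where \<Phi>: "((\<lambda>z. Cj (fst z) (snd z)) has_derivative \<Phi>) (at (x, 0))"
    using Cj_has_derivative by blast
  have "((\<lambda>y. (x, y)) has_derivative (\<lambda>h. (0, h))) (at 0)"
    by (auto intro!: derivative_eq_intros)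
  from has_derivative_compose[OF this \<Phi>]
  have d: "(Cj x has_derivative (\<lambda>h. \<Phi> (0, h))) (at 0)" by simp
  have "Cj x y = \<Phi> (0, y)" for y
  proof -
    have "((\<lambda>s::real. s *\<^sub>R y) has_derivative (\<lambda>h. h *\<^sub>R y)) (at 0)"
      by (auto intro!: derivative_eq_intros)
    then have "((\<lambda>s. Cj x (s *\<^sub>R y)) has_derivative (\<lambda>h. \<Phi> (0, h *\<^sub>R y))) (at 0)"
      using has_derivative_compose[of "\<lambda>s::real. s *\<^sub>R y" "\<lambda>h. h *\<^sub>R y" 0 UNIV "Cj x"] d by simp
    then have "((\<lambda>s. Cj x (s *\<^sub>R y)) has_vector_derivative \<Phi> (0, y)) (at 0)"
      using linear_scale[OF bounded_linear.linear[OF has_derivative_bounded_linear[OF d]]]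
      by (simp add: has_vector_derivative_def)
    from one_parameter[OF _ this, of 1] show ?thesis
      by (simp add: Cj_mu[symmetric] mu_scale pr.scale[symmetric])
  qed
  then have "Cj x = (\<lambda>h. \<Phi> (0, h))" by auto
  then show ?thesis using has_derivative_bounded_linear[OF d] by simp
qed
sublocale Cj: bounded_linear "Cj x" for x by (rule bounded_linear_Cj)

text \<open>The derivative of the adjoint action. It agrees with \<open>bracket G\<close>, see \<open>bracket_eq_D\<close>, but its
algebraic properties follow directly from those of conjugation.\<close>

definition D where "D x y = vector_derivative (\<lambda>s. Cj (s *\<^sub>R x) y) (at 0)"

lemma Cj_vector_derivative:
  assumes "(k has_vector_derivative u) (at 0)" "k 0 = 0" "(w has_vector_derivative w') (at 0)"
  shows "((\<lambda>h. Cj (k h) (w h)) has_vector_derivative D u (w 0) + pr w') (at 0)"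
proof -
  obtain \<Phi> where \<Phi>: "((\<lambda>z. Cj (fst z) (snd z)) has_derivative \<Phi>) (at (0, w 0))"
    using Cj_has_derivative by blast
  interpret \<Phi>: bounded_linear \<Phi> using has_derivative_bounded_linear[OF \<Phi>] .
  have gen: "((\<lambda>h. Cj (k h) (w1 h)) has_vector_derivative \<Phi> (u, w')) (at 0)"
    if "(k has_vector_derivative u) (at 0)" "k 0 = 0" "(w1 has_vector_derivative w') (at 0)" "w1 0 = w 0" for k u w1 w'
  proof -
    have "((\<lambda>s. (k s, w1 s)) has_derivative (\<lambda>x. x *\<^sub>R (u, w'))) (at 0)"
      using has_derivative_Pair[OF that(1,3)[unfolded has_vector_derivative_def]] by simp
    from has_derivative_compose[OF this, of "\<lambda>z. Cj (fst z) (snd z)" \<Phi>]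
    show ?thesis using that \<Phi> by (simp add: has_vector_derivative_def \<Phi>.scale del: scaleR_Pair)
  qed
  have "((\<lambda>s. Cj (s *\<^sub>R u) (w 0)) has_vector_derivative \<Phi> (u, 0)) (at 0)"
    by (rule gen) (auto intro: scale_vector_derivative)
  then have 1: "\<Phi> (u, 0) = D u (w 0)" unfolding D_def by (simp add: vector_derivative_at)
  have "((\<lambda>s. Cj 0 (w 0 + s *\<^sub>R w')) has_vector_derivative \<Phi> (0, w')) (at 0)"
    by (rule gen) (auto intro!: derivative_eq_intros)
  then have "((\<lambda>s. pr (w 0) + s *\<^sub>R pr w') has_vector_derivative \<Phi> (0, w')) (at 0)"
    by (simp add: pr.add pr.scale)
  moreover have "((\<lambda>s. pr (w 0) + s *\<^sub>R pr w') has_vector_derivative pr w') (at 0)"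
    by (auto intro!: derivative_eq_intros)
  ultimately have 2: "\<Phi> (0, w') = pr w'" by (rule vector_derivative_unique_at)
  have "\<Phi> (u, w') = D u (w 0) + pr w'" using \<Phi>.add[of "(u, 0)" "(0, w')"] 1 2 by simp
  then show ?thesis using gen[OF assms(1,2,3) refl] by simp
qed

lemma Cj_vector_derivative':
  assumes "(k has_vector_derivative u) (at 0)" "k 0 = 0"
  shows "((\<lambda>h. Cj (k h) y) has_vector_derivative D u y) (at 0)"
  using Cj_vector_derivative[OF assms has_vector_derivative_const, of y] by simp

lemma D_vector_derivative: "((\<lambda>s. Cj (s *\<^sub>R x) y) has_vector_derivative D x y) (at 0)"
  by (rule Cj_vector_derivative'[OF scale_vector_derivative]) simp

lemma D_V [simp]: "D x y \<in> V" by (rule vector_derivative_in_V[OF D_vector_derivative]) simp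

lemma D_pr [simp]: "D (pr x) y = D x y" "D x (pr y) = D x y"
proof -
  have "(\<lambda>s. Cj (s *\<^sub>R pr x) y) = (\<lambda>s. Cj (s *\<^sub>R x) y)"
    by (metis Cj_pr(1) pr.scale)
  then show "D (pr x) y = D x y" by (simp add: D_def)
qed (simp add: D_def)

lemma D_add_right: "D x (y + z) = D x y + D x z"
proof -
  have "((\<lambda>s. Cj (s *\<^sub>R x) (y + z)) has_vector_derivative D x y + D x z) (at 0)"
    unfolding Cj.add by (intro has_vector_derivative_add D_vector_derivative)
  then show ?thesis using D_vector_derivative vector_derivative_unique_at by blast
qed

lemma D_scale_right: "D x (c *\<^sub>R y) = c *\<^sub>R D x y"
proof -
  have "((\<lambda>s. Cj (s *\<^sub>R x) (c *\<^sub>R y)) has_vector_derivative c *\<^sub>R D x y) (at 0)"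
    unfolding Cj.scale
    by (rule bounded_linear.has_vector_derivative[OF bounded_linear_scaleR_right D_vector_derivative])
  then show ?thesis using D_vector_derivative vector_derivative_unique_at by blast
qed

lemma D_linear_left: "linear (\<lambda>x. D x y)"
proof -
  obtain \<Phi> where \<Phi>: "((\<lambda>z. Cj (fst z) (snd z)) has_derivative \<Phi>) (at (0, y))"
    using Cj_has_derivative by blast
  interpret \<Phi>: bounded_linear \<Phi> using has_derivative_bounded_linear[OF \<Phi>] .
  have "D x y = \<Phi> (x, 0)" for x
  proof -
    have "((\<lambda>s. (s *\<^sub>R x, y)) has_derivative (\<lambda>h. h *\<^sub>R (x, 0))) (at 0)"
      by (auto intro!: derivative_eq_intros)
    from has_derivative_compose[OF this, of "\<lambda>z. Cj (fst z) (snd z)" \<Phi>]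
    have "((\<lambda>s. Cj (s *\<^sub>R x) y) has_vector_derivative \<Phi> (x, 0)) (at 0)"
      using \<Phi> by (simp add: has_vector_derivative_def \<Phi>.scale del: scaleR_Pair)
    then show ?thesis using D_vector_derivative vector_derivative_unique_at by blast
  qed
  moreover have "linear (\<lambda>x. \<Phi> (x, 0))"
  proof
    show "\<Phi> (b1 + b2, 0) = \<Phi> (b1, 0) + \<Phi> (b2, 0)" for b1 b2 using \<Phi>.add[of "(b1,0)" "(b2,0)"] by simp
    show "\<Phi> (c *\<^sub>R b, 0) = c *\<^sub>R \<Phi> (b, 0)" for c b using \<Phi>.scale[of c "(b,0)"] by simp
  qed
  ultimately show ?thesis by simp
qed

lemma D_add_left: "D (x + y) z = D x z + D y z" using linear_add[OF D_linear_left] .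
lemma D_scale_left: "D (c *\<^sub>R x) y = c *\<^sub>R D x y" using linear_scale[OF D_linear_left] .

lemma D_self [simp]: "D x x = 0"
proof -
  have "Cj (s *\<^sub>R x) x = pr x" for s
  proof -
    have "mu ((s + 1) *\<^sub>R pr x) (- (s *\<^sub>R x)) = mu ((s + 1) *\<^sub>R pr x) (- s *\<^sub>R pr x)"
      by (metis mu_pr(2) pr.neg pr.scale scaleR_minus_left)
    then show ?thesis
      using mu_scale[of s x 1] mu_scale[of "s + 1" "pr x" "- s"] by (simp add: Cj_def)
  qed
  then have "((\<lambda>s. pr x) has_vector_derivative D x x) (at 0)" using D_vector_derivative[of x x] by simp
  then show ?thesis using has_vector_derivative_const vector_derivative_unique_at by blast
qed

lemma D_antisym: "D x y = - D y x"
proof -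
  have "D (x + y) (x + y) = D x y + D y x" unfolding D_add_left D_add_right by simp
  then show ?thesis by (simp add: eq_neg_iff_add_eq_0)
qed

lemma bounded_bilinear_D: "bounded_bilinear D"
proof -
  have eq: "D x y = (\<Sum>c\<in>frame. \<Sum>c'\<in>frame. (coord c x * coord c' y) *\<^sub>R D c c')" for x y
  proof -
    have "D x y = D (\<Sum>c\<in>frame. coord c x *\<^sub>R c) (\<Sum>c\<in>frame. coord c y *\<^sub>R c)"
      unfolding pr_def[symmetric] by simp
    also have "\<dots> = (\<Sum>c\<in>frame. coord c x *\<^sub>R D c (\<Sum>c\<in>frame. coord c y *\<^sub>R c))"
      by (simp add: linear_sum[OF D_linear_left] D_scale_left)
    also have "\<dots> = (\<Sum>c\<in>frame. coord c x *\<^sub>R (\<Sum>c'\<in>frame. coord c' y *\<^sub>R D c c'))"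
    proof -
      have "linear (D c)" for c by (intro linearI D_add_right D_scale_right)
      then show ?thesis by (simp add: linear_sum D_scale_right)
    qed
    finally show ?thesis by (simp add: scaleR_sum_right)
  qed
  show ?thesis
  proof
    define K where "K = (\<Sum>c\<in>frame. \<Sum>c'\<in>frame. onorm (coord c) * onorm (coord c') * norm (D c c'))"
    have "norm (D x y) \<le> norm x * norm y * K" for x y
    proof -
      have "norm (D x y) \<le> (\<Sum>c\<in>frame. \<Sum>c'\<in>frame. norm ((coord c x * coord c' y) *\<^sub>R D c c'))"
        unfolding eq[of x y] by (intro order.trans[OF norm_sum] sum_mono) auto
      also have "\<dots> \<le> (\<Sum>c\<in>frame. \<Sum>c'\<in>frame. norm x * norm y * (onorm (coord c) * onorm (coord c') * norm (D c c')))"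
      proof (intro sum_mono)
        fix c c' assume c: "c \<in> frame" "c' \<in> frame"
        have "\<bar>coord c x\<bar> * \<bar>coord c' y\<bar> \<le> (onorm (coord c) * norm x) * (onorm (coord c') * norm y)"
          using onorm[OF bounded_linear_coord[OF c(1)], of x] onorm[OF bounded_linear_coord[OF c(2)], of y]
          by (intro mult_mono) (auto intro!: mult_nonneg_nonneg onorm_pos_le bounded_linear_coord c)
        from mult_right_mono[OF this norm_ge_zero[of "D c c'"]]
        show "norm ((coord c x * coord c' y) *\<^sub>R D c c')
           \<le> norm x * norm y * (onorm (coord c) * onorm (coord c') * norm (D c c'))"
          by (simp add: abs_mult mult_ac)
      qed
      finally show ?thesis by (simp add: K_def sum_distrib_left)
    qed
    then show "\<exists>K. \<forall>a b. norm (D a b) \<le> norm a * norm b * K" by blast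
  qed (simp_all add: D_add_left D_add_right D_scale_left D_scale_right)
qed
sublocale D: bounded_bilinear D by (rule bounded_bilinear_D)

lemma Cj_D: "Cj z (D x y) = D (Cj z x) (Cj z y)"
proof -
  have "((\<lambda>s. Cj z (Cj (s *\<^sub>R x) y)) has_vector_derivative Cj z (D x y)) (at 0)"
    by (rule Cj.has_vector_derivative[OF D_vector_derivative])
  moreover have "((\<lambda>s. Cj (s *\<^sub>R Cj z x) (Cj z y)) has_vector_derivative D (Cj z x) (Cj z y)) (at 0)"
    by (rule D_vector_derivative)
  ultimately show ?thesis
    using vector_derivative_unique_at by (fastforce simp: Cj_conj[of z] Cj.scale)
qed

lemma D_leibniz: "D z (D x y) = D (D z x) y + D x (D z y)"
proof -
  have "((\<lambda>s. D (Cj (s *\<^sub>R z) x) (Cj (s *\<^sub>R z) y)) has_vector_derivative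
      D (Cj (0 *\<^sub>R z) x) (D z y) + D (D z x) (Cj (0 *\<^sub>R z) y)) (at 0)"
    by (intro D.has_vector_derivative D_vector_derivative)
  then have "((\<lambda>s. Cj (s *\<^sub>R z) (D x y)) has_vector_derivative D x (D z y) + D (D z x) y) (at 0)"
    by (simp add: Cj_D)
  from vector_derivative_unique_at[OF D_vector_derivative this]
  show ?thesis by (simp add: add.commute)
qed

text \<open>The adjoint action along a curve with control \<open>u\<close> satisfies \<open>(Ad\<^bsub>c\<^esub>)' = Ad\<^bsub>c\<^esub> \<circ> ad\<^bsub>u\<^esub>\<close>.\<close>

lemma Cj_curve_derivative:
  assumes "(c has_vector_derivative L (c t) u) (at t)" "c t \<in> V"
  shows "((\<lambda>t. Cj (c t) y) has_vector_derivative Cj (c t) (D u y)) (at t)"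
proof -
  have k: "((\<lambda>h. mu (- c t) (c (t + h))) has_vector_derivative pr u) (at 0)"
    by (rule left_translate_derivative[OF assms])
  have "((\<lambda>h. Cj (c t) (Cj (mu (- c t) (c (t + h))) y)) has_vector_derivative Cj (c t) (D (pr u) y)) (at 0)"
    by (rule Cj.has_vector_derivative[OF Cj_vector_derivative'[OF k]]) simp
  then show ?thesis
    by (simp add: Cj_Cj has_vector_derivative_shift_0[of "\<lambda>s. Cj (c s) y" t])
qed

end

section \<open>The differential of left translation\<close>

lemma difference_quotient_isCont:
  fixes f :: "real \<Rightarrow> 'a::real_normed_vector"
  assumes "(f has_vector_derivative d) (at 0)"
  shows "isCont (\<lambda>s. if s = 0 then d else (f s - f 0) /\<^sub>R s) 0"
proof -
  have "(\<lambda>h. norm (f (0 + h) - f 0 - h *\<^sub>R d) / norm h) \<midarrow>0\<rightarrow> 0"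
    using assms unfolding has_vector_derivative_def has_derivative_at by simp
  then have "(\<lambda>s. norm ((if s = 0 then d else (f s - f 0) /\<^sub>R s) - d)) \<midarrow>0\<rightarrow> 0"
  proof (rule Lim_transform_eventually)
    have "norm (f h - f 0 - h *\<^sub>R d) / \<bar>h\<bar> = norm ((f h - f 0) /\<^sub>R h - d)" if "h \<noteq> 0" for h
    proof -
      have "f h - f 0 - h *\<^sub>R d = h *\<^sub>R ((f h - f 0) /\<^sub>R h - d)"
        using that by (simp add: scaleR_diff_right)
      then show ?thesis using that by simp
    qed
    then show "\<forall>\<^sub>F h in at 0. norm (f (0 + h) - f 0 - h *\<^sub>R d) / norm h
        = norm ((if h = 0 then d else (f h - f 0) /\<^sub>R h) - d)"
      by (auto simp: eventually_at_filter)
  qed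
  then show ?thesis
    unfolding isCont_def by (simp add: tendsto_norm_zero_iff LIM_zero_iff)
qed

lemma antiderivative_open_interval:
  fixes f :: "real \<Rightarrow> 'a::banach"
  assumes I: "open I" "is_interval I" "t0 \<in> I" and f: "continuous_on I f"
  shows "\<exists>F. F t0 = 0 \<and> (\<forall>t\<in>I. (F has_vector_derivative f t) (at t))"
proof -
  define F where "F t = integral {t0..t} f - integral {t..t0} f" for t
  have "(F has_vector_derivative f t) (at t)" if t: "t \<in> I" for t
  proof -
    obtain e where e: "e > 0" "cball t e \<subseteq> I"
      using I(1) t open_contains_cball by blast
    define a where "a = min (t - e) t0"
    define b where "b = max (t + e) t0"
    have ab: "a \<in> I" "b \<in> I"
      using e I(3) by (auto simp: a_def b_def min_def max_def subset_iff dist_real_def)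
    then have sub: "{a..b} \<subseteq> I"
      using mem_is_interval_1_I[OF I(2) ab] by (auto)
    have cont: "continuous_on {a..b} f" using f sub continuous_on_subset by blast
    have tab: "a < t" "t < b" using e by (auto simp: a_def b_def)
    have int: "f integrable_on {c..d}" if "a \<le> c" "d \<le> b" for c d
      using that cont by (intro integrable_continuous_real) (auto intro: continuous_on_subset)
    have "((\<lambda>s. integral {a..s} f) has_vector_derivative f t) (at t within {a..b})"
      using cont tab by (intro integral_has_vector_derivative) auto
    then have *: "((\<lambda>s. integral {a..s} f - integral {a..t0} f) has_vector_derivative f t) (at t)"
      using tab at_within_interior[of t "{a..b}"] by (auto intro!: derivative_eq_intros)
    have eq: "integral {a..s} f - integral {a..t0} f = F s" if "s \<in> {a<..<b}" for s
    proof (cases "t0 \<le> s")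
      case True
      have "integral {a..t0} f + integral {t0..s} f = integral {a..s} f"
        using True that by (intro Henstock_Kurzweil_Integration.integral_combine int) (auto simp: a_def)
      moreover have "integral {s..t0} f = 0" using True by (cases "s = t0") auto
      ultimately show ?thesis by (simp add: F_def flip: \<open>integral {a..t0} f + integral {t0..s} f = integral {a..s} f\<close>)
    next
      case False
      have "integral {a..s} f + integral {s..t0} f = integral {a..t0} f"
        using False that by (intro Henstock_Kurzweil_Integration.integral_combine int) (auto simp: b_def)
      then show ?thesis using False by (simp add: F_def flip: \<open>integral {a..s} f + integral {s..t0} f = integral {a..t0} f\<close>)
    qed
    show ?thesis
      by (rule has_vector_derivative_transform_within_open[OF *, of "{a<..<b}"]) (use tab eq in auto)
  qed
  moreover have "F t0 = 0" by (simp add: F_def)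
  ultimately show ?thesis by blast
qed

context carnot
begin

lemma scaled_ray_derivative:
  assumes "x \<in> V" "v \<in> V"
  shows "((\<lambda>\<epsilon>. mu (- (s *\<^sub>R x)) (s *\<^sub>R (x + \<epsilon> *\<^sub>R v))) has_vector_derivative s *\<^sub>R \<Theta> (s *\<^sub>R x) v) (at 0)"
proof -
  have "((\<lambda>\<epsilon>. mu (- (s *\<^sub>R x)) (s *\<^sub>R x + \<epsilon> *\<^sub>R (s *\<^sub>R v))) has_vector_derivative \<Theta> (s *\<^sub>R x) (s *\<^sub>R v)) (at 0)"
    by (rule \<Theta>_vector_derivative)
  then show ?thesis by (simp add: \<Theta>.scale scaleR_add_right mult.commute)
qed

text \<open>The one-parameter subgroup through \<open>x + \<epsilon> v\<close> is split at time \<open>s\<close>, and the identity is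
differentiated in \<open>\<epsilon>\<close>. As a function of \<open>s\<close>, \<open>s \<Theta>(s x) v\<close> is thus a cocycle for the adjoint action of
the subgroup through \<open>x\<close>, which makes it the solution of a linear differential equation.\<close>

lemma \<Theta>_cocycle:
  assumes "x \<in> V" "v \<in> V"
  shows "(s + h) *\<^sub>R \<Theta> ((s + h) *\<^sub>R x) v
    = Cj (- (h *\<^sub>R x)) (s *\<^sub>R \<Theta> (s *\<^sub>R x) v) + h *\<^sub>R \<Theta> (h *\<^sub>R x) v"
proof -
  define a where "a s \<epsilon> = mu (- (s *\<^sub>R x)) (s *\<^sub>R (x + \<epsilon> *\<^sub>R v))" for s \<epsilon>
  have a': "(a s has_vector_derivative s *\<^sub>R \<Theta> (s *\<^sub>R x) v) (at 0)" for s
    using scaled_ray_derivative[OF assms] by (simp add: a_def[abs_def])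
  have eq: "a (s + h) \<epsilon> = mu (Cj (- (h *\<^sub>R x)) (a s \<epsilon>)) (a h \<epsilon>)" for \<epsilon>
  proof -
    define y where "y = x + \<epsilon> *\<^sub>R v"
    have y: "y \<in> V" using assms by (simp add: y_def)
    have 1: "(s + h) *\<^sub>R y = mu (s *\<^sub>R y) (h *\<^sub>R y)" using y by (simp add: mu_scale)
    have 2: "- ((s + h) *\<^sub>R x) = mu (- (h *\<^sub>R x)) (- (s *\<^sub>R x))"
      using mu_scale[of s x h] assms by (simp add: mu_uminus[symmetric])
    show ?thesis
      unfolding a_def y_def[symmetric] 1 2 by (simp add: Cj_def mu_assoc)
  qed
  have "((\<lambda>\<epsilon>. mu (Cj (- (h *\<^sub>R x)) (a s \<epsilon>)) (a h \<epsilon>)) has_vector_derivative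
     dM (Cj (- (h *\<^sub>R x)) (a s 0), a h 0) (Cj (- (h *\<^sub>R x)) (s *\<^sub>R \<Theta> (s *\<^sub>R x) v), h *\<^sub>R \<Theta> (h *\<^sub>R x) v)) (at 0)"
    by (intro mu_vector_derivative Cj.has_vector_derivative a')
  then have "(a (s + h) has_vector_derivative Cj (- (h *\<^sub>R x)) (s *\<^sub>R \<Theta> (s *\<^sub>R x) v) + h *\<^sub>R \<Theta> (h *\<^sub>R x) v) (at 0)"
    using assms by (simp add: eq[symmetric] a_def[of _ 0] dM_0)
  from vector_derivative_unique_at[OF a' this] show ?thesis .
qed

lemma continuous_\<Theta>:
  assumes "continuous_on S f" shows "continuous_on S (\<lambda>s. \<Theta> (f s) v)"
  unfolding \<Theta>_def
  by (rule continuous_on_compose2[OF continuous_dM]) (auto intro!: continuous_intros assms)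

lemma isCont_\<Theta>_ray: "isCont (\<lambda>s. \<Theta> (s *\<^sub>R x) v) t"
proof -
  have "continuous_on UNIV (\<lambda>s. \<Theta> (s *\<^sub>R x) v)" by (intro continuous_\<Theta> continuous_intros)
  then show ?thesis by (simp add: continuous_on_eq_continuous_at)
qed

lemma scaled_\<Theta>_ode:
  assumes "x \<in> V" "v \<in> V"
  shows "((\<lambda>s. s *\<^sub>R \<Theta> (s *\<^sub>R x) v) has_vector_derivative v - D x (s *\<^sub>R \<Theta> (s *\<^sub>R x) v)) (at s)"
proof -
  have "((\<lambda>h. - (h *\<^sub>R x)) has_vector_derivative - x) (at 0)" by (auto intro!: derivative_eq_intros)
  then have "((\<lambda>h. Cj (- (h *\<^sub>R x)) (s *\<^sub>R \<Theta> (s *\<^sub>R x) v)) has_vector_derivative D (- x) (s *\<^sub>R \<Theta> (s *\<^sub>R x) v)) (at 0)"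
    by (rule Cj_vector_derivative') simp
  moreover have "((\<lambda>h. h *\<^sub>R \<Theta> (h *\<^sub>R x) v) has_vector_derivative \<Theta> (0 *\<^sub>R x) v) (at 0)"
    by (rule has_vector_derivative_scaleR_continuous[OF isCont_\<Theta>_ray])
  ultimately have "((\<lambda>h. Cj (- (h *\<^sub>R x)) (s *\<^sub>R \<Theta> (s *\<^sub>R x) v) + h *\<^sub>R \<Theta> (h *\<^sub>R x) v) has_vector_derivative
      D (- x) (s *\<^sub>R \<Theta> (s *\<^sub>R x) v) + \<Theta> (0 *\<^sub>R x) v) (at 0)"
    by (rule has_vector_derivative_add)
  then have "((\<lambda>h. (s + h) *\<^sub>R \<Theta> ((s + h) *\<^sub>R x) v) has_vector_derivative
      v - D x (s *\<^sub>R \<Theta> (s *\<^sub>R x) v)) (at 0)"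
    using assms by (simp add: \<Theta>_cocycle D.minus_left del: Cj.scale)
  then show ?thesis
    using has_vector_derivative_shift_0[of "\<lambda>s. s *\<^sub>R \<Theta> (s *\<^sub>R x) v" s] by blast
qed

text \<open>Integrating \<open>(s \<Theta>(s x) v)' = v - D x (s \<Theta>(s x) v)\<close> to second order gives
\<open>s \<Theta>(s x) v = s v - s\<^sup>2/2 D x v + o(s\<^sup>2)\<close>.\<close>

lemma \<Theta>_ray_derivative:
  assumes "x \<in> V" "v \<in> V"
  shows "((\<lambda>s. \<Theta> (s *\<^sub>R x) v) has_vector_derivative - ((1/2) *\<^sub>R D x v)) (at 0)"
  unfolding has_vector_derivative_def has_derivative_at_alt
proof safe
  show "bounded_linear (\<lambda>xa. xa *\<^sub>R - ((1 / 2) *\<^sub>R D x v))" by (rule bounded_linear_scaleR_left)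
  fix \<epsilon> :: real assume \<epsilon>: "\<epsilon> > 0"
  define g where "g s = \<Theta> (s *\<^sub>R x) v" for s
  have g0: "g 0 = v" using assms by (simp add: g_def)
  have "isCont (\<lambda>s. D x v - D x (g s)) 0"
    unfolding g_def by (intro continuous_intros isCont_\<Theta>_ray D.isCont)
  then obtain d where d: "d > 0" and small: "\<And>s. \<bar>s\<bar> < d \<Longrightarrow> norm (D x v - D x (g s)) < \<epsilon>"
    using \<epsilon> g0 unfolding continuous_at_eps_delta by (fastforce simp: dist_norm)
  \<comment> \<open>The remainder of the second-order expansion.\<close>
  define e where "e s = s *\<^sub>R g s - s *\<^sub>R v + (s^2/2) *\<^sub>R D x v" for s
  have e': "(e has_vector_derivative s *\<^sub>R (D x v - D x (g s))) (at s)" for s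
  proof -
    have "(e has_vector_derivative (v - D x (s *\<^sub>R g s)) - v + s *\<^sub>R D x v) (at s)"
      unfolding e_def[abs_def] g_def
      by (intro has_vector_derivative_add has_vector_derivative_diff scaled_\<Theta>_ode assms)
         (auto intro!: derivative_eq_intros simp: has_real_derivative_iff_has_vector_derivative[symmetric])
    then show ?thesis by (simp add: D_scale_right scaleR_diff_right)
  qed
  have "norm (g y - v + (y/2) *\<^sub>R D x v) \<le> \<epsilon> * \<bar>y\<bar>" if y: "\<bar>y\<bar> < d" for y
  proof -
    have "norm (e y - e 0) \<le> (\<epsilon> * \<bar>y\<bar>) * norm (y - 0)"
    proof (rule differentiable_bound[where S = "closed_segment 0 y"])
      fix s assume "s \<in> closed_segment 0 y"
      then have s: "\<bar>s\<bar> \<le> \<bar>y\<bar>" by (auto simp: closed_segment_eq_real_ivl split: if_splits)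
      show "(e has_derivative (\<lambda>h. h *\<^sub>R s *\<^sub>R (D x v - D x (g s)))) (at s within closed_segment 0 y)"
        using e'[of s] unfolding has_vector_derivative_def by (rule has_derivative_at_withinI)
      show "onorm (\<lambda>h. h *\<^sub>R s *\<^sub>R (D x v - D x (g s))) \<le> \<epsilon> * \<bar>y\<bar>"
      proof (rule onorm_le)
        fix h :: real
        have "\<bar>s\<bar> * norm (D x v - D x (g s)) \<le> \<bar>y\<bar> * \<epsilon>"
          using s small[of s] y \<epsilon> by (intro mult_mono) auto
        then have "\<bar>h\<bar> * (\<bar>s\<bar> * norm (D x v - D x (g s))) \<le> \<bar>h\<bar> * (\<bar>y\<bar> * \<epsilon>)"
          by (rule mult_left_mono) simp
        then show "norm (h *\<^sub>R s *\<^sub>R (D x v - D x (g s))) \<le> \<epsilon> * \<bar>y\<bar> * norm h"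
          by (simp add: mult_ac abs_mult)
      qed
    qed auto
    moreover have "e y - e 0 = y *\<^sub>R (g y - v + (y/2) *\<^sub>R D x v)"
      by (simp add: e_def algebra_simps power2_eq_square)
    ultimately have "\<bar>y\<bar> * norm (g y - v + (y/2) *\<^sub>R D x v) \<le> \<bar>y\<bar> * (\<epsilon> * \<bar>y\<bar>)" by (simp add: mult_ac)
    then show ?thesis using g0 by (cases "y = 0") auto
  qed
  then show "\<exists>d>0. \<forall>y. norm (y - 0) < d \<longrightarrow>
     norm (\<Theta> (y *\<^sub>R x) v - \<Theta> (0 *\<^sub>R x) v - (y - 0) *\<^sub>R - ((1 / 2) *\<^sub>R D x v)) \<le> \<epsilon> * norm (y - 0)"
    using d assms unfolding g_def by (intro exI[of _ d]) auto
qed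

lemma L_expand: "L z w = (\<Sum>c\<in>frame. coord c w *\<^sub>R L z c)"
proof -
  have "L z w = L z (\<Sum>c\<in>frame. coord c w *\<^sub>R c)" unfolding pr_def[symmetric] by simp
  then show ?thesis by (simp add: L.sum L.scale)
qed

lemma continuous_L:
  assumes "continuous_on S f" "continuous_on S w"
  shows "continuous_on S (\<lambda>s. L (f s) (w s))"
proof -
  have "continuous_on S (\<lambda>s. \<Sum>c\<in>frame. coord c (w s) *\<^sub>R dM (f s, 0) (0, c))"
    by (intro continuous_on_sum continuous_on_scaleR
      bounded_linear.continuous_on[OF bounded_linear_coord]
      continuous_on_compose2[OF continuous_dM] assms continuous_on_Pair continuous_on_const) auto
  then show ?thesis unfolding L_def[symmetric] L_expand[symmetric] .
qed

lemma isCont_L_ray: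
  assumes "isCont w 0" shows "isCont (\<lambda>s. L (s *\<^sub>R x) (w s)) 0"
proof -
  have "continuous_on UNIV (\<lambda>s. L (s *\<^sub>R x) c)" for c by (intro continuous_L continuous_intros)
  then have "isCont (\<lambda>s. L (s *\<^sub>R x) c) 0" for c by (simp add: continuous_on_eq_continuous_at)
  then show ?thesis
    unfolding L_expand[of _ "w _"]
    by (intro continuous_intros bounded_linear.isCont[OF bounded_linear_coord] assms)
qed

lemma L_ray_derivative:
  assumes "x \<in> V" "v \<in> V"
  shows "((\<lambda>s. L (s *\<^sub>R x) v) has_vector_derivative (1/2) *\<^sub>R D x v) (at 0)"
proof -
  define w where "w s = - (if s = 0 then - ((1/2) *\<^sub>R D x v) else (\<Theta> (s *\<^sub>R x) v - \<Theta> (0 *\<^sub>R x) v) /\<^sub>R s)" for s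
  have "isCont w 0" unfolding w_def
    by (intro continuous_intros difference_quotient_isCont[OF \<Theta>_ray_derivative] assms)
  then have "((\<lambda>s. s *\<^sub>R L (s *\<^sub>R x) (w s)) has_vector_derivative L (0 *\<^sub>R x) (w 0)) (at 0)"
    by (rule has_vector_derivative_scaleR_continuous[OF isCont_L_ray])
  then have "((\<lambda>s. v + s *\<^sub>R L (s *\<^sub>R x) (w s)) has_vector_derivative 0 + (1/2) *\<^sub>R D x v) (at 0)"
    by (intro has_vector_derivative_add has_vector_derivative_const) (simp add: w_def)
  moreover have "v + s *\<^sub>R L (s *\<^sub>R x) (w s) = L (s *\<^sub>R x) v" for s
  proof (cases "s = 0")
    case False
    then have "s *\<^sub>R w s = v - \<Theta> (s *\<^sub>R x) v" using assms by (simp add: w_def)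
    then have "s *\<^sub>R L (s *\<^sub>R x) (w s) = L (s *\<^sub>R x) (v - \<Theta> (s *\<^sub>R x) v)"
      by (simp add: L.scale[symmetric] del: L.diff)
    then show ?thesis using assms by (simp add: L.diff)
  qed (use assms in simp)
  ultimately show ?thesis by simp
qed

lemma dL_eq_L: "x \<in> V \<Longrightarrow> v \<in> V \<Longrightarrow> dL G x v = L x v"
  unfolding dL_def
  using L_vector_derivative[OF scale_vector_derivative, of v x] by (auto intro!: vector_derivative_at simp: mu_eq)

lemma Ad_eq_Cj: "x \<in> V \<Longrightarrow> v \<in> V \<Longrightarrow> Ad G x v = Cj x v"
proof -
  assume xv: "x \<in> V" "v \<in> V"
  have "x \<otimes> t *\<^sub>R v \<otimes> inv x = t *\<^sub>R Cj x v" for t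
    using Cj.scale[of x t v] xv by (simp add: Cj_def mu_eq inv_eq_uminus)
  then show ?thesis
    unfolding Ad_def using scale_vector_derivative[of "Cj x v" 0] by (simp add: vector_derivative_at)
qed

text \<open>Both vector derivatives in the definition of the bracket are halves of \<open>D\<close>, with opposite signs.\<close>

lemma bracket_eq_D:
  assumes "x \<in> V" "y \<in> V" shows "bracket G x y = D x y"
proof -
  have "vector_derivative (\<lambda>t. dL G (t *\<^sub>R x) y) (at 0) = (1/2) *\<^sub>R D x y" if "x \<in> V" "y \<in> V" for x y
    using L_ray_derivative[OF that] that by (simp add: dL_eq_L vector_derivative_at)
  then have "bracket G x y = (1/2) *\<^sub>R D x y - (1/2) *\<^sub>R D y x"
    using assms by (simp add: bracket_def)
  then show ?thesis using D_antisym[of y x] by (simp add: scaleR_add_left[symmetric])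
qed

lemma lie_algebra_V: "lie_algebra_on V (bracket G)"
proof -
  have "D x (D y z) + D y (D z x) + D z (D x y) = 0" for x y z
    using D_leibniz[of x y z] D_antisym[of z "D x y"] D_antisym[of z x] D.minus_right[of y "D x z"]
    by (simp add: algebra_simps)
  then show ?thesis
    unfolding lie_algebra_on_def
    by (simp add: bracket_eq_D subspace_V D_add_left D_add_right D_scale_left D_scale_right)
qed

lemma Dpow_V: "v \<in> V \<Longrightarrow> (D x ^^ k) v \<in> V" by (induction k) auto

text \<open>The truncated series \<open>\<psi>\<close> satisfies the same linear equation as \<open>s \<Theta>(s x) v\<close>, and the adjoint
action of \<open>s x\<close> is an integrating factor for the difference \<open>\<delta>\<close>.\<close>

lemma \<Theta>_formula:
  assumes x: "x \<in> V" and v: "v \<in> V" and nil: "(D x ^^ K) v = 0"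
  shows "\<Theta> x v = (\<Sum>k<K. ((-1)^k / fact (Suc k)) *\<^sub>R (D x ^^ k) v)"
proof -
  define a where "a k = ((-1)^k / fact (Suc k) :: real)" for k
  define \<psi> where "\<psi> s = (\<Sum>k<K. (s ^ Suc k * a k) *\<^sub>R (D x ^^ k) v)" for s
  define b where "b s k = ((1 + real k) * s ^ k * a k) *\<^sub>R (D x ^^ k) v" for s k
  have \<psi>': "(\<psi> has_vector_derivative (\<Sum>k<K. b s k)) (at s)" for s
    unfolding \<psi>_def[abs_def] b_def
  proof (intro has_vector_derivative_sum)
    fix k
    have "((\<lambda>s. s ^ Suc k * a k) has_real_derivative (1 + real k) * s ^ k * a k) (at s)"
      using DERIV_cmult_right[OF DERIV_pow[of "Suc k" s], of "a k"] by simp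
    from has_vector_derivative_scaleR[OF this has_vector_derivative_const, of "(D x ^^ k) v"]
    show "((\<lambda>s. (s ^ Suc k * a k) *\<^sub>R (D x ^^ k) v) has_vector_derivative
        ((1 + real k) * s ^ k * a k) *\<^sub>R (D x ^^ k) v) (at s)" by simp
  qed
  have D\<psi>: "D x (\<psi> s) = (\<Sum>k<K. - b s (Suc k))" for s
  proof -
    have ak: "a k = - ((2 + real k) * a (Suc k))" for k
    proof -
      have f: "(fact (Suc (Suc k)) :: real) = (2 + real k) * fact (Suc k)" by (subst fact_Suc) simp
      have "2 + real k \<noteq> 0" by linarith
      then show ?thesis unfolding a_def f by (simp del: fact_Suc)
    qed
    have "s ^ Suc k * a k = - ((1 + real (Suc k)) * s ^ Suc k * a (Suc k))" for k
      by (subst ak[of k]) (simp add: algebra_simps)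
    then have "(s ^ Suc k * a k) *\<^sub>R D x ((D x ^^ k) v) = - b s (Suc k)" for k
      unfolding b_def by (metis funpow.simps(2) o_apply scaleR_minus_left)
    then show ?thesis by (simp add: \<psi>_def D.sum_right D_scale_right)
  qed
  have ode: "(\<Sum>k<K. b s k) = v - D x (\<psi> s)" for s
  proof -
    have "(\<Sum>k<K. b s k) + D x (\<psi> s) = (\<Sum>k<K. b s k - b s (Suc k))"
      unfolding D\<psi> by (simp add: sum.distrib[symmetric])
    also have "\<dots> = b s 0 - b s K" by (rule sum_lessThan_telescope')
    also have "\<dots> = v" using nil by (simp add: b_def a_def)
    finally show ?thesis by (simp add: algebra_simps)
  qed
  define \<delta> where "\<delta> s = s *\<^sub>R \<Theta> (s *\<^sub>R x) v - \<psi> s" for s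
  have \<delta>': "(\<delta> has_vector_derivative - D x (\<delta> s)) (at s)" for s
  proof -
    have "(\<delta> has_vector_derivative (v - D x (s *\<^sub>R \<Theta> (s *\<^sub>R x) v)) - (v - D x (\<psi> s))) (at s)"
      unfolding \<delta>_def[abs_def]
      using \<psi>'[of s] unfolding ode by (intro has_vector_derivative_diff scaled_\<Theta>_ode x v)
    then show ?thesis by (simp add: \<delta>_def D.diff_right)
  qed
  define z where "z s = Cj (s *\<^sub>R x) (\<delta> s)" for s
  have "(z has_vector_derivative 0) (at s)" for s
  proof -
    have "((\<lambda>h. Cj (h *\<^sub>R x) (\<delta> (s + h))) has_vector_derivative D x (\<delta> (s + 0)) + pr (- D x (\<delta> s))) (at 0)"
      using \<delta>'[of s] by (intro Cj_vector_derivative scale_vector_derivative)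
        (auto simp: has_vector_derivative_shift_0)
    then have "((\<lambda>h. Cj (s *\<^sub>R x) (Cj (h *\<^sub>R x) (\<delta> (s + h)))) has_vector_derivative Cj (s *\<^sub>R x) (D x (\<delta> (s + 0)) + pr (- D x (\<delta> s)))) (at 0)"
      by (rule Cj.has_vector_derivative)
    then have "((\<lambda>h. z (s + h)) has_vector_derivative 0) (at 0)"
      using x by (simp add: z_def Cj_Cj mu_scale pr.neg)
    then show ?thesis by (simp add: has_vector_derivative_shift_0)
  qed
  then obtain c where c: "\<And>s. z s = c"
    using has_vector_derivative_zero_constant[of UNIV z] by auto
  have "\<psi> 0 = 0" by (simp add: \<psi>_def)
  then have "z 1 = 0" using c[of 1] c[of 0] by (simp add: z_def \<delta>_def)
  then have "Cj (- x) (Cj x (\<delta> 1)) = 0" by (simp add: z_def)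
  moreover have "\<delta> 1 \<in> V" unfolding \<delta>_def \<psi>_def
    by (intro diff_V scaleR_V \<Theta>_V subspace_sum[OF subspace_V] Dpow_V v)
  ultimately have "\<delta> 1 = 0" by (simp add: Cj_Cj)
  then show ?thesis by (simp add: \<delta>_def \<psi>_def a_def)
qed

end

section \<open>Lower central series, left-invariant equations and the grading\<close>

text \<open>A bounded projection onto \<open>S\<close> exists, and the part of \<open>w\<close> that it removes has derivative zero.\<close>

lemma derivative_in_subspace:
  fixes w :: "real \<Rightarrow> ambient"
  assumes S: "subspace S" "S \<subseteq> span B" "finite B"
    and I: "open I" "is_interval I" "t0 \<in> I" "t \<in> I"
    and w': "\<And>t. t \<in> I \<Longrightarrow> \<exists>d\<in>S. (w has_vector_derivative d) (at t)" and w0: "w t0 \<in> S"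
  shows "w t \<in> S"
proof -
  obtain E where E: "E \<subseteq> S" "independent E" "S \<subseteq> span E"
    by (rule basis_exists[of S])
  have "finite E" using independent_span_bound[OF S(3) E(2)] E S by auto
  have SE: "S = span E" using E S span_minimal by blast
  obtain C \<phi> where C: "finite C" "C \<subseteq> span E" "\<And>c. c \<in> C \<Longrightarrow> bounded_linear (\<phi> c :: ambient \<Rightarrow> real)"
    and rep: "\<And>x. x \<in> span E \<Longrightarrow> (\<Sum>c\<in>C. \<phi> c x *\<^sub>R c) = x"
    using independent_coordinates_ambient[OF \<open>finite E\<close>] by blast
  define q where "q x = x - (\<Sum>c\<in>C. \<phi> c x *\<^sub>R c)" for x
  have bl: "bounded_linear q" unfolding q_def[abs_def]
    using C by (intro bounded_linear_sub bounded_linear_ident bounded_linear_sum bounded_linear_scaleR_const) auto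
  have q0: "q x = 0" if "x \<in> S" for x using rep that SE by (simp add: q_def)
  have "((\<lambda>t. q (w t)) has_vector_derivative 0) (at t within I)" if t: "t \<in> I" for t
  proof -
    obtain d where "d \<in> S" "(w has_vector_derivative d) (at t)" using w' t by blast
    then show ?thesis
      using bounded_linear.has_vector_derivative[OF bl, of w d "at t"] q0
      by (simp add: has_vector_derivative_at_within)
  qed
  moreover have "convex I" using I by (simp add: is_interval_convex)
  ultimately obtain c where "\<And>t. t \<in> I \<Longrightarrow> q (w t) = c"
    using has_vector_derivative_zero_constant[of I "\<lambda>t. q (w t)"] by blast
  then have "q (w t) = 0" using I q0[OF w0] by metis
  then have "w t = (\<Sum>c\<in>C. \<phi> c (w t) *\<^sub>R c)" by (simp add: q_def)
  also have "\<dots> \<in> S" unfolding SE using C by (intro span_sum span_scale) auto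
  finally show ?thesis .
qed

context carnot
begin

abbreviation lc where "lc k \<equiv> lower_central V (bracket G) k"

lemma lc_subspace: "subspace (lc k)"
  by (cases k) (auto simp: subspace_V bracket_space_def subspace_span)

lemma lc_V: "lc k \<subseteq> V"
proof (induction k)
  case (Suc k)
  have "bracket G x y \<in> V" if "x \<in> V" "y \<in> lc k" for x y
    using that Suc bracket_eq_D[of x y] by auto
  then have "{bracket G x y | x y. x \<in> V \<and> y \<in> lc k} \<subseteq> V" by blast
  then show ?case
    unfolding lower_central.simps bracket_space_def by (rule span_minimal[OF _ subspace_V])
qed simp

lemma lc_D: "x \<in> V \<Longrightarrow> y \<in> lc k \<Longrightarrow> D x y \<in> lc (Suc k)"
proof -
  assume xy: "x \<in> V" "y \<in> lc k"
  have "bracket G x y \<in> lc (Suc k)"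
    unfolding lower_central.simps bracket_space_def using xy by (intro span_base) blast
  then show ?thesis using bracket_eq_D[of x y] xy lc_V[of k] by auto
qed

lemma lc_decreasing: "lc (Suc k) \<subseteq> lc k"
proof (induction k)
  case 0
  show ?case using lc_V[of 1] by simp
next
  case (Suc k)
  then show ?case by (simp add: bracket_space_def) (intro span_mono, blast)
qed

lemma lc_antimono: "j \<le> k \<Longrightarrow> lc k \<subseteq> lc j"
  by (rule lift_Suc_antimono_le[of lc]) (use lc_decreasing in auto)

lemma lc_D_left: "x \<in> lc k \<Longrightarrow> y \<in> V \<Longrightarrow> D x y \<in> lc (Suc k)"
  using lc_D[of y x k] D_antisym[of x y] subspace_neg[OF lc_subspace] by metis

lemma lc_Dpow: "x \<in> V \<Longrightarrow> y \<in> lc j \<Longrightarrow> (D x ^^ k) y \<in> lc (j + k)"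
  by (induction k) (use lc_D in auto)

lemma Dpow_eq_0:
  assumes "lc N = {0}" "x \<in> V" "v \<in> V" "N \<le> K" shows "(D x ^^ K) v = 0"
  using lc_Dpow[of x v 0 K] lc_antimono[of N K] assms by auto

text \<open>Together with the lemma that follows, this serves to prove \<open>L_diff\<close>: modulo the term \<open>Suc k\<close> of the
lower central series, \<open>L x v\<close> depends on \<open>x\<close> only modulo the term \<open>k\<close>.\<close>

lemma \<Theta>_diff:
  assumes nil: "lc N = {0}" and x: "x \<in> V" "x' \<in> V" "x - x' \<in> lc k" and v: "v \<in> V"
  shows "\<Theta> x v - \<Theta> x' v \<in> lc (Suc k)"
proof -
  have "(D x ^^ m) v - (D x' ^^ m) v \<in> lc (Suc k)" for m
  proof (induction m)
    case 0
    then show ?case using subspace_0[OF lc_subspace, of "Suc k"] by simp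
  next
    case (Suc m)
    have "D x ((D x ^^ m) v - (D x' ^^ m) v) \<in> lc (Suc k)"
      using lc_D[OF x(1) Suc] lc_decreasing by blast
    moreover have "D (x - x') ((D x' ^^ m) v) \<in> lc (Suc k)"
      by (rule lc_D_left[OF x(3) Dpow_V[OF v]])
    ultimately have "D x ((D x ^^ m) v - (D x' ^^ m) v) + D (x - x') ((D x' ^^ m) v) \<in> lc (Suc k)"
      by (rule subspace_add[OF lc_subspace])
    then show ?case by (simp add: D.diff_left D.diff_right)
  qed
  then have "(\<Sum>m<N. ((-1)^m / fact (Suc m)) *\<^sub>R ((D x ^^ m) v - (D x' ^^ m) v)) \<in> lc (Suc k)"
    by (intro subspace_sum[OF lc_subspace] subspace_scale[OF lc_subspace])
  then show ?thesis
    using \<Theta>_formula[OF x(1) v Dpow_eq_0[OF nil x(1) v order_refl]]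
      \<Theta>_formula[OF x(2) v Dpow_eq_0[OF nil x(2) v order_refl]]
    by (simp only: sum_subtractf scaleR_diff_right)
qed

lemma \<Theta>_unipotent:
  assumes nil: "lc N = {0}" and x: "x \<in> V" and w: "w \<in> lc j"
  shows "\<Theta> x w - w \<in> lc (Suc j)"
proof -
  have wV: "w \<in> V" using w lc_V by auto
  have "\<Theta> x w = (\<Sum>k<Suc N. ((-1)^k / fact (Suc k)) *\<^sub>R (D x ^^ k) w)"
    by (intro \<Theta>_formula x wV Dpow_eq_0[OF nil]) auto
  also have "\<dots> = w + (\<Sum>k<N. ((-1)^Suc k / fact (Suc (Suc k))) *\<^sub>R (D x ^^ Suc k) w)"
    by (subst sum.lessThan_Suc_shift) simp
  finally have "\<Theta> x w - w = (\<Sum>k<N. ((-1)^Suc k / fact (Suc (Suc k))) *\<^sub>R (D x ^^ Suc k) w)" by simp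
  moreover have "(D x ^^ Suc k) w \<in> lc (Suc j)" for k
    using lc_Dpow[OF x w, of "Suc k"] lc_antimono[of "Suc j" "j + Suc k"] by auto
  ultimately show ?thesis
    by (simp only:) (intro subspace_sum[OF lc_subspace] subspace_scale[OF lc_subspace])
qed

lemma L_diff:
  assumes nil: "lc N = {0}" and x: "x \<in> V" "x' \<in> V" "x - x' \<in> lc k" and v: "v \<in> V"
  shows "L x v - L x' v \<in> lc (Suc k)"
proof -
  define w where "w = L x v - L x' v"
  have "\<Theta> x w = \<Theta> x' (L x' v) - \<Theta> x (L x' v)" using x v by (simp add: w_def \<Theta>.diff)
  also have "\<dots> = - (\<Theta> x (L x' v) - \<Theta> x' (L x' v))" by simp
  also have "\<dots> \<in> lc (Suc k)"
    by (intro subspace_neg[OF lc_subspace] \<Theta>_diff[OF nil x] L_V)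
  finally have *: "\<Theta> x w \<in> lc (Suc k)" .
  have step: "w \<in> lc j" if "j \<le> Suc k" for j
    using that
  proof (induction j)
    case 0
    then show ?case by (simp add: w_def)
  next
    case (Suc j)
    have "\<Theta> x w \<in> lc (Suc j)" using * Suc.prems lc_antimono by blast
    moreover have "\<Theta> x w - w \<in> lc (Suc j)" using Suc by (intro \<Theta>_unipotent[OF nil x(1)]) auto
    ultimately have "\<Theta> x w - (\<Theta> x w - w) \<in> lc (Suc j)" by (rule subspace_diff[OF lc_subspace])
    then show ?case by simp
  qed
  have "w \<in> lc (Suc k)" by (rule step[OF order_refl])
  then show ?thesis unfolding w_def .
qed

lemma antiderivative_V:
  assumes I: "open I" "is_interval I" "t0 \<in> I" and f: "continuous_on I f" "\<And>t. t \<in> I \<Longrightarrow> f t \<in> V"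
  shows "\<exists>F. F t0 = 0 \<and> (\<forall>t\<in>I. (F has_vector_derivative f t) (at t))"
proof -
  have "\<forall>c\<in>frame. \<exists>F. F t0 = 0 \<and> (\<forall>t\<in>I. (F has_vector_derivative coord c (f t)) (at t))"
    by (intro ballI antiderivative_open_interval I bounded_linear.continuous_on[OF bounded_linear_coord] f)
  from bchoice[OF this] obtain F where
    F: "\<And>c. c \<in> frame \<Longrightarrow> F c t0 = 0"
      "\<And>c t. c \<in> frame \<Longrightarrow> t \<in> I \<Longrightarrow> (F c has_vector_derivative coord c (f t)) (at t)"
    by blast
  have "((\<lambda>t. \<Sum>c\<in>frame. F c t *\<^sub>R c) has_vector_derivative f t) (at t)" if t: "t \<in> I" for t
  proof -
    have "((\<lambda>t. \<Sum>c\<in>frame. F c t *\<^sub>R c) has_vector_derivative (\<Sum>c\<in>frame. coord c (f t) *\<^sub>R c)) (at t)"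
      using bounded_linear.has_vector_derivative[OF bounded_linear_scaleR_left F(2)[OF _ t]]
      by (intro has_vector_derivative_sum) auto
    then show ?thesis using coord_sum[OF f(2)[OF t]] by simp
  qed
  then show ?thesis using F(1) by (intro exI[of _ "\<lambda>t. \<Sum>c\<in>frame. F c t *\<^sub>R c"]) auto
qed

text \<open>Picard iteration stops: by \<open>L_diff\<close>, the \<open>m\<close>-th and the next iterate differ by elements of the \<open>m\<close>-th
term of the lower central series, so the iterates become stationary after \<open>N\<close> steps. This gives a
solution on the whole interval.\<close>

lemma left_invariant_ode_exists:
  assumes nil: "lc N = {0}" and I: "open I" "is_interval I" "t0 \<in> I"
    and u: "continuous_on I u" "\<And>t. t \<in> I \<Longrightarrow> u t \<in> V" and x0: "x0 \<in> V"
  shows "\<exists>\<eta>. \<eta> t0 = x0 \<and> (\<forall>t\<in>I. \<eta> t \<in> V \<and> (\<eta> has_vector_derivative L (\<eta> t) (u t)) (at t))"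
proof -
  \<comment> \<open>One Picard step, without the initial value.\<close>
  define T where "T \<eta> = (SOME F. F t0 = 0 \<and> (\<forall>t\<in>I. (F has_vector_derivative L (\<eta> t) (u t)) (at t)))" for \<eta>
  have T: "T \<eta> t0 = 0" "\<And>t. t \<in> I \<Longrightarrow> (T \<eta> has_vector_derivative L (\<eta> t) (u t)) (at t)"
    if "continuous_on I \<eta>" for \<eta>
    using someI_ex[OF antiderivative_V[OF I continuous_L[OF that u(1)] L_V], folded T_def] by auto
  define e where "e = rec_nat (\<lambda>_. x0) (\<lambda>_ \<eta> t. x0 + T \<eta> t)"
  have e0: "e 0 = (\<lambda>_. x0)" and eS: "e (Suc m) = (\<lambda>t. x0 + T (e m) t)" for m
    by (simp_all add: e_def)
  have cont: "continuous_on I (e m)" for m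
  proof (induction m)
    case (Suc m)
    then have "continuous_on I (T (e m))"
      using T(2)[OF Suc] by (meson continuous_at_imp_continuous_on has_vector_derivative_continuous)
    then show ?case by (auto simp: eS intro!: continuous_intros)
  qed (simp add: e0)
  have e': "(e (Suc m) has_vector_derivative L (e m t) (u t)) (at t)" if "t \<in> I" for m t
    using has_vector_derivative_add[OF has_vector_derivative_const T(2)[OF cont that], of x0 m] by (simp add: eS)
  have et0: "e m t0 = x0" for m
    by (cases m) (simp_all add: e0 eS T(1)[OF cont])
  obtain B where B: "finite B" "V = span B" using V_fin by blast
  have eV: "e m t \<in> V" if t: "t \<in> I" for m t
  proof (cases m)
    case (Suc j)
    show ?thesis unfolding Suc
    proof (rule derivative_in_subspace[OF subspace_V _ B(1) I t])
      show "e (Suc j) t0 \<in> V" using x0 by (simp add: et0)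
      show "\<exists>d\<in>V. (e (Suc j) has_vector_derivative d) (at t)" if "t \<in> I" for t
        using e'[OF that] L_V by blast
    qed (use B in simp)
  qed (use x0 in \<open>simp add: e0\<close>)
  have diff: "e (Suc m) t - e m t \<in> lc m" if t: "t \<in> I" for m t
    using t
  proof (induction m arbitrary: t)
    case 0
    then show ?case using eV by simp
  next
    case (Suc m)
    show ?case
    proof (rule derivative_in_subspace[OF lc_subspace _ B(1) I Suc.prems])
      show "lc (Suc m) \<subseteq> span B" using lc_V B by blast
      show "e (Suc (Suc m)) t0 - e (Suc m) t0 \<in> lc (Suc m)"
        using subspace_0[OF lc_subspace, of "Suc m"] by (simp add: et0)
      fix s assume s: "s \<in> I"
      have "((\<lambda>t. e (Suc (Suc m)) t - e (Suc m) t) has_vector_derivative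
          L (e (Suc m) s) (u s) - L (e m s) (u s)) (at s)"
        by (intro has_vector_derivative_diff e' s)
      moreover have "L (e (Suc m) s) (u s) - L (e m s) (u s) \<in> lc (Suc m)"
        by (intro L_diff[OF nil] eV s u(2) Suc.IH)
      ultimately show "\<exists>d\<in>lc (Suc m). ((\<lambda>t. e (Suc (Suc m)) t - e (Suc m) t) has_vector_derivative d) (at s)"
        by blast
    qed
  qed
  have "e (Suc N) t = e N t" if "t \<in> I" for t using diff[OF that, of N] nil by simp
  then show ?thesis
    using e'[of _ N] eV et0 by (intro exI[of _ "e (Suc N)"]) auto
qed

lemma bilinear_span:
  assumes S: "subspace S" and AB: "\<And>a b. a \<in> A \<Longrightarrow> b \<in> B \<Longrightarrow> D a b \<in> S"
    and "x \<in> span A" "y \<in> span B"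
  shows "D x y \<in> S"
proof -
  have 1: "D a y \<in> S" if "a \<in> A" for a
    using \<open>y \<in> span B\<close>
    by (induction rule: span_induct_alt)
       (use AB that S in \<open>auto simp: D.zero_right D_add_right D_scale_right intro!: subspace_add subspace_scale subspace_0\<close>)
  show ?thesis
    using \<open>x \<in> span A\<close>
    by (induction rule: span_induct_alt)
       (use 1 S in \<open>auto simp: D.zero_left D_add_left D_scale_left intro!: subspace_add subspace_scale subspace_0\<close>)
qed

text \<open>The layers beyond the step are taken to be trivial, as the record does not constrain them there.\<close>

definition lay where "lay k = (if 1 \<le> k \<and> k \<le> step G then layer G k else {0})"

lemma step_ge_1: "1 \<le> step G"
  and layer_subspace: "k \<in> {1..step G} \<Longrightarrow> subspace (layer G k)"
  and layer_V: "k \<in> {1..step G} \<Longrightarrow> layer G k \<subseteq> V"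
  and layer_generated: "i \<in> {1..step G} \<Longrightarrow> bracket_space (bracket G) (layer G 1) (layer G i) = layer G (Suc i)"
  and layer_last: "layer G (Suc (step G)) = {0}"
  and decomposition: "x \<in> V \<Longrightarrow> \<exists>!y. y \<in> (\<Pi>\<^sub>E k\<in>{1..step G}. layer G k) \<and> x = (\<Sum>k=1..step G. y k)"
  using stratified_G unfolding stratified_def by auto

lemma lay_subspace: "subspace (lay k)" by (simp add: lay_def layer_subspace )
lemma lay_V: "lay k \<subseteq> V" using layer_V by (auto simp: lay_def)
lemma lay_1: "lay 1 = layer G 1" using step_ge_1 by (simp add: lay_def)

lemma lay_D_1: assumes "x \<in> lay 1" "y \<in> lay k" shows "D x y \<in> lay (Suc k)"
proof (cases "k \<in> {1..step G}")
  case True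
  have "x \<in> V" "y \<in> V" using assms lay_V by auto
  have "bracket G x y \<in> bracket_space (bracket G) (layer G 1) (layer G k)"
    unfolding bracket_space_def using assms True lay_1 by (intro span_base) (auto simp: lay_def)
  then have "D x y \<in> bracket_space (bracket G) (layer G 1) (layer G k)"
    using \<open>x \<in> V\<close> \<open>y \<in> V\<close> by (simp add: bracket_eq_D)
  then have "D x y \<in> layer G (Suc k)" using layer_generated[OF True] by simp
  then show ?thesis
    using True layer_last by (cases "k = step G") (simp_all add: lay_def)
next
  case False
  then have "y = 0" using assms by (auto simp: lay_def split: if_splits)
  then show ?thesis using subspace_0[OF lay_subspace] by (simp add: D.zero_right)
qed

text \<open>The stratification only controls brackets with the first layer; the general case follows from the
Jacobi identity by induction on \<open>i\<close>.\<close>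

lemma lay_D: "x \<in> lay i \<Longrightarrow> y \<in> lay j \<Longrightarrow> D x y \<in> lay (i + j)"
proof (induction i arbitrary: x j y)
  case 0
  then show ?case using subspace_0[OF lay_subspace] by (simp add: lay_def D.zero_left)
next
  case (Suc i)
  show ?case
  proof (cases "1 \<le> i \<and> Suc i \<le> step G")
    case True
    define A where "A = {bracket G a b | a b. a \<in> layer G 1 \<and> b \<in> layer G i}"
    have xA: "x \<in> span A"
      using True Suc.prems layer_generated[of i] by (simp add: lay_def bracket_space_def A_def)
    have li: "lay i = layer G i" using True by (simp add: lay_def)
    have zA: "D z y \<in> lay (Suc i + j)" if zin: "z \<in> A" for z
    proof -
      obtain a b where ab: "z = bracket G a b" "a \<in> lay 1" "b \<in> lay i"
        using zin unfolding A_def li lay_1 by blast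
      then have z: "z = D a b" using bracket_eq_D[of a b] lay_V by blast
      have "D a (D b y) \<in> lay (Suc (i + j))" by (intro lay_D_1 ab Suc.IH Suc.prems)
      moreover have "D b (D a y) \<in> lay (i + Suc j)" by (intro lay_D_1 ab Suc.IH Suc.prems)
      ultimately have "D a (D b y) - D b (D a y) \<in> lay (Suc i + j)"
        using subspace_diff[OF lay_subspace] by simp
      then show ?thesis using D_leibniz[of a b y] z by simp
    qed
    show ?thesis
      by (rule bilinear_span[OF lay_subspace _ xA, of "{y}"]) (use zA in \<open>auto intro: span_base\<close>)
  next
    case False
    show ?thesis
    proof (cases "i = 0")
      case True
      then show ?thesis using Suc.prems lay_D_1 by simp
    next
      case False
      then have "x = 0" using \<open>\<not> (1 \<le> i \<and> Suc i \<le> step G)\<close> Suc.prems by (auto simp: lay_def)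
      then show ?thesis using subspace_0[OF lay_subspace] by (simp add: D.zero_left)
    qed
  qed
qed

text \<open>The projection to the \<open>k\<close>-th layer along the other layers.\<close>

definition component :: "ambient \<Rightarrow> nat \<Rightarrow> ambient" where
  "component x k = (if k \<in> {1..step G}
     then (THE y. y \<in> (\<Pi>\<^sub>E k\<in>{1..step G}. layer G k) \<and> x = (\<Sum>k=1..step G. y k)) k else 0)"

lemma component_lay: "x \<in> V \<Longrightarrow> component x k \<in> lay k"
  and component_sum: "x \<in> V \<Longrightarrow> x = (\<Sum>k=1..step G. component x k)"
proof -
  assume x: "x \<in> V"
  define y where "y = (THE y. y \<in> (\<Pi>\<^sub>E k\<in>{1..step G}. layer G k) \<and> x = (\<Sum>k=1..step G. y k))"
  have y: "y \<in> (\<Pi>\<^sub>E k\<in>{1..step G}. layer G k) \<and> x = (\<Sum>k=1..step G. y k)"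
    unfolding y_def by (rule theI'[OF decomposition[OF x]])
  then show "component x k \<in> lay k" unfolding component_def lay_def y_def[symmetric] by auto
  have "(\<Sum>k=1..step G. component x k) = (\<Sum>k=1..step G. y k)"
    unfolding component_def y_def[symmetric] by (intro sum.cong) auto
  then show "x = (\<Sum>k=1..step G. component x k)" using y by simp
qed

lemma component_unique:
  assumes y: "\<And>k. k \<in> {1..step G} \<Longrightarrow> y k \<in> layer G k" and x: "x = (\<Sum>k=1..step G. y k)"
    and k: "k \<in> {1..step G}"
  shows "component x k = y k"
proof -
  have xV: "x \<in> V" unfolding x using y layer_V by (intro subspace_sum[OF subspace_V]) auto
  have 1: "restrict y {1..step G} \<in> (\<Pi>\<^sub>E k\<in>{1..step G}. layer G k) \<and> x = (\<Sum>k=1..step G. restrict y {1..step G} k)"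
    using y x by (auto intro!: sum.cong)
  have 2: "restrict (component x) {1..step G} \<in> (\<Pi>\<^sub>E k\<in>{1..step G}. layer G k)
      \<and> x = (\<Sum>k=1..step G. restrict (component x) {1..step G} k)"
  proof
    show "restrict (component x) {1..step G} \<in> (\<Pi>\<^sub>E k\<in>{1..step G}. layer G k)"
    proof (intro PiE_I)
      fix k assume "k \<in> {1..step G}"
      then show "restrict (component x) {1..step G} k \<in> layer G k" using component_lay[OF xV, of k] by (simp add: lay_def)
    qed (simp only: restrict_apply if_False)
    have "(\<Sum>k=1..step G. restrict (component x) {1..step G} k) = (\<Sum>k=1..step G. component x k)"
      by (intro sum.cong) auto
    then show "x = (\<Sum>k=1..step G. restrict (component x) {1..step G} k)" using component_sum[OF xV] by simp
  qed
  have "restrict (component x) {1..step G} = restrict y {1..step G}"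
    using decomposition[OF xV] 1 2 by blast
  then show ?thesis using k by (metis restrict_apply')
qed

lemma component_add: "x \<in> V \<Longrightarrow> y \<in> V \<Longrightarrow> component (x + y) k = component x k + component y k"
proof (cases "k \<in> {1..step G}")
  case True
  assume xy: "x \<in> V" "y \<in> V"
  have "x + y = (\<Sum>k=1..step G. component x k + component y k)"
    using component_sum[OF xy(1)] component_sum[OF xy(2)] by (simp add: sum.distrib)
  moreover have "component x k + component y k \<in> layer G k" if "k \<in> {1..step G}" for k
    using component_lay[OF xy(1), of k] component_lay[OF xy(2), of k] that layer_subspace
    by (auto simp: lay_def intro!: subspace_add)
  ultimately show ?thesis by (intro component_unique True)
qed (simp add: component_def del: atLeastAtMost_iff)

lemma component_scale: "x \<in> V \<Longrightarrow> component (c *\<^sub>R x) k = c *\<^sub>R component x k"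
proof (cases "k \<in> {1..step G}")
  case True
  assume x: "x \<in> V"
  have "c *\<^sub>R x = (\<Sum>k=1..step G. c *\<^sub>R component x k)"
    using component_sum[OF x] by (simp add: scaleR_sum_right[symmetric])
  moreover have "c *\<^sub>R component x k \<in> layer G k" if "k \<in> {1..step G}" for k
    using component_lay[OF x, of k] that layer_subspace by (auto simp: lay_def intro!: subspace_scale)
  ultimately show ?thesis by (intro component_unique True)
qed (simp add: component_def del: atLeastAtMost_iff)

lemma component_of_layer:
  assumes "x \<in> layer G j" "j \<in> {1..step G}"
  shows "component x k = (if k = j then x else 0)"
proof (cases "k \<in> {1..step G}")
  case True
  show ?thesis
    by (rule component_unique[OF _ _ True])
       (use assms subspace_0[OF layer_subspace] in auto)
qed (use assms in \<open>auto simp: component_def\<close>)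

lemma bounded_linear_component: "bounded_linear (\<lambda>x. component (pr x) k)"
  by (intro bounded_linear_on_V component_add component_scale)

lemma component_D:
  assumes "x \<in> V" "y \<in> V" "k \<in> {1..step G}"
  shows "component (D x y) k = (\<Sum>i=1..step G. \<Sum>j=1..step G. if i + j = k then D (component x i) (component y j) else 0)"
proof (rule component_unique[OF _ _ assms(3)])
  fix k assume "k \<in> {1..step G}"
  moreover have "(\<Sum>i=1..step G. \<Sum>j=1..step G. if i + j = k then D (component x i) (component y j) else 0) \<in> lay k"
    using lay_D[OF component_lay component_lay, OF assms(1,2)] subspace_0[OF lay_subspace]
    by (intro subspace_sum[OF lay_subspace]) auto
  ultimately show "(\<Sum>i=1..step G. \<Sum>j=1..step G. if i + j = k then D (component x i) (component y j) else 0) \<in> layer G k"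
    by (simp add: lay_def)
next
  have "D x y = D (\<Sum>i=1..step G. component x i) (\<Sum>j=1..step G. component y j)"
    using component_sum[OF assms(1)] component_sum[OF assms(2)] by simp
  also have "\<dots> = (\<Sum>i=1..step G. \<Sum>j=1..step G. D (component x i) (component y j))"
    by (simp add: D.sum_left D.sum_right del: sum.swap) (rule sum.swap)
  also have "\<dots> = (\<Sum>i=1..step G. \<Sum>j=1..step G. \<Sum>k=1..step G. if i + j = k then D (component x i) (component y j) else 0)"
  proof (intro sum.cong refl)
    fix i j assume ij: "i \<in> {1..step G}" "j \<in> {1..step G}"
    show "D (component x i) (component y j) = (\<Sum>k=1..step G. if i + j = k then D (component x i) (component y j) else 0)"
    proof (cases "i + j \<le> step G")
      case False
      then have "D (component x i) (component y j) = 0"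
        using lay_D[OF component_lay component_lay, OF assms(1,2), of i j] by (simp add: lay_def)
      then show ?thesis by (simp del: sum.delta)
    qed (use ij in simp)
  qed
  also have "\<dots> = (\<Sum>i=1..step G. \<Sum>k=1..step G. \<Sum>j=1..step G. if i + j = k then D (component x i) (component y j) else 0)"
    by (intro sum.cong refl sum.swap)
  also have "\<dots> = (\<Sum>k=1..step G. \<Sum>i=1..step G. \<Sum>j=1..step G. if i + j = k then D (component x i) (component y j) else 0)"
    by (rule sum.swap)
  finally show "D x y = (\<Sum>k=1..step G. \<Sum>i=1..step G. \<Sum>j=1..step G. if i + j = k then D (component x i) (component y j) else 0)" .
qed

lemma lc_step: "lc (step G) = {0}"
proof -
  \<comment> \<open>The sum of the layers above the \<open>k\<close>-th one.\<close>
  define tail where "tail k = span (\<Union>i\<in>{k<..}. lay i)" for k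
  have V_tail: "V \<subseteq> tail 0"
  proof
    fix x assume x: "x \<in> V"
    have "(\<Sum>k=1..step G. component x k) \<in> tail 0"
      unfolding tail_def
    proof (intro span_sum span_base)
      fix k assume "k \<in> {1..step G}"
      then show "component x k \<in> (\<Union>i\<in>{0<..}. lay i)" using component_lay[OF x, of k] by auto
    qed
    then show "x \<in> tail 0" using component_sum[OF x] by simp
  qed
  have "lc k \<subseteq> tail k" for k
  proof (induction k)
    case (Suc k)
    have "D x y \<in> tail (Suc k)" if "x \<in> V" "y \<in> lc k" for x y
    proof (rule bilinear_span)
      show "x \<in> span (\<Union>i\<in>{0<..}. lay i)" using V_tail that by (auto simp: tail_def)
      show "y \<in> span (\<Union>i\<in>{k<..}. lay i)" using Suc that by (auto simp: tail_def)
      show "D a b \<in> tail (Suc k)" if ab: "a \<in> (\<Union>i\<in>{0<..}. lay i)" "b \<in> (\<Union>i\<in>{k<..}. lay i)" for a b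
      proof -
        obtain i j where "a \<in> lay i" "b \<in> lay j" "0 < i" "k < j" using ab by auto
        then have "D a b \<in> lay (i + j)" "Suc k < i + j" using lay_D by auto
        then show ?thesis unfolding tail_def by (intro span_base) auto
      qed
    qed (simp add: tail_def)
    then have "{bracket G x y | x y. x \<in> V \<and> y \<in> lc k} \<subseteq> tail (Suc k)"
      using lc_V[of k] bracket_eq_D by fastforce
    then show ?case by (simp add: bracket_space_def tail_def span_minimal)
  qed (use V_tail in simp)
  moreover have "tail (step G) \<subseteq> {0}"
    unfolding tail_def by (intro span_minimal) (auto simp: lay_def)
  ultimately show ?thesis using subspace_0[OF lc_subspace, of "step G"] by blast
qed

end

section \<open>The algebra of iterated integrals of a control\<close>

text \<open>Functions on the line as a vector space, to have dimensions of spaces of functions.\<close>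

interpretation FS: vector_space "\<lambda>(c::real) (f :: real \<Rightarrow> real) x. c * f x"
  by unfold_locales (auto simp: fun_eq_iff algebra_simps)

lemma FS_span_mult:
  fixes f h :: "real \<Rightarrow> real"
  assumes "f \<in> FS.span B" "\<And>b. b \<in> B \<Longrightarrow> (\<lambda>x. b x * h x) \<in> FS.span H"
  shows "(\<lambda>x. f x * h x) \<in> FS.span H"
  using assms(1)
proof (induction rule: FS.span_induct_alt)
  case base
  show ?case using FS.span_zero[of H] by (simp add: zero_fun_def)
next
  case (step c b y)
  have "(\<lambda>x. c * (b x * h x)) + (\<lambda>x. y x * h x) \<in> FS.span H"
    by (intro FS.span_add FS.span_scale assms(2) step)
  then show ?case by (simp add: plus_fun_def algebra_simps)
qed

lemma FS_sum_apply: "(\<Sum>b\<in>B. (\<lambda>x. c b * b x)) = (\<lambda>x. \<Sum>b\<in>B. c b * (b :: real \<Rightarrow> real) x)"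
  by (induction B rule: infinite_finite_induct) (auto simp: fun_eq_iff zero_fun_def)

lemma FS_span_finite_rep:
  assumes "finite B" "f \<in> FS.span B"
  shows "\<exists>c. f = (\<lambda>x. \<Sum>b\<in>B. c b * b x)"
  using assms FS.span_finite[OF assms(1)] FS_sum_apply by auto

lemma FS_sum_in_span:
  assumes "\<And>b. b \<in> B \<Longrightarrow> g b \<in> FS.span H"
  shows "(\<lambda>x. \<Sum>b\<in>B. c b * g b x) \<in> FS.span H"
proof -
  have "(\<Sum>b\<in>B. (\<lambda>x. c b * g b x)) \<in> FS.span H"
    by (intro FS.span_sum FS.span_scale assms)
  moreover have "(\<Sum>b\<in>B. (\<lambda>x. c b * g b x)) = (\<lambda>x. \<Sum>b\<in>B. c b * g b x)"
    by (induction B rule: infinite_finite_induct) (auto simp: fun_eq_iff zero_fun_def)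
  ultimately show ?thesis by simp
qed

lemma FS_independent_dual:
  fixes g :: "'a \<Rightarrow> real \<Rightarrow> real"
  assumes "finite J" and dual: "\<And>j k. j \<in> J \<Longrightarrow> k \<in> J \<Longrightarrow> g j (p k) = 0 \<longleftrightarrow> j \<noteq> k"
  shows "inj_on g J" "FS.independent (g ` J)"
proof -
  show inj: "inj_on g J" using dual by (intro inj_onI) metis
  show "FS.independent (g ` J)"
    unfolding FS.independent_explicit_finite_subsets
  proof (intro allI impI ballI)
    fix S c b assume S: "S \<subseteq> g ` J" "finite S" and 0: "(\<Sum>b\<in>S. (\<lambda>x. c b * b x)) = 0" and "b \<in> S"
    then obtain j where j: "j \<in> J" "b = g j" by auto
    have "(\<Sum>b\<in>S. c b * b (p j)) = 0"
      using 0 unfolding FS_sum_apply by (simp add: fun_eq_iff)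
    moreover have "(\<Sum>b\<in>S. c b * b (p j)) = (\<Sum>b'\<in>{b}. c b' * b' (p j))"
      using S \<open>b \<in> S\<close> j dual by (intro sum.mono_neutral_right) auto
    ultimately show "c b = 0" using dual[OF j(1) j(1)] j by simp
  qed
qed

lemma gronwall_zero:
  fixes g g' :: "real \<Rightarrow> real"
  assumes g': "\<And>s. s \<in> {a..b} \<Longrightarrow> (g has_real_derivative g' s) (at s)"
    and bound: "\<And>s. s \<in> {a..b} \<Longrightarrow> \<bar>g' s\<bar> \<le> K * g s"
    and nonneg: "\<And>s. s \<in> {a..b} \<Longrightarrow> 0 \<le> g s" and c: "c \<in> {a..b}" "g c = 0" and t: "t \<in> {a..b}"
  shows "g t = 0"
proof (cases "c \<le> t")
  case True
  define h where "h s = g s * exp (- K * s)" for s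
  have "h t \<le> h c"
  proof (rule DERIV_nonpos_imp_nonincreasing[OF True])
    fix s assume "c \<le> s" "s \<le> t"
    then have s: "s \<in> {a..b}" using c t by auto
    have "(h has_real_derivative (g' s - K * g s) * exp (- K * s)) (at s)"
      unfolding h_def[abs_def] by (rule derivative_eq_intros g'[OF s] refl | simp add: algebra_simps)+
    moreover have "(g' s - K * g s) * exp (- K * s) \<le> 0"
      using bound[OF s] by (intro mult_nonpos_nonneg) auto
    ultimately show "\<exists>y. (h has_real_derivative y) (at s) \<and> y \<le> 0" by blast
  qed
  then have "g t * exp (- K * t) \<le> 0" using c by (simp add: h_def)
  then have "g t \<le> 0" by (simp add: mult_le_0_iff not_le)
  then show ?thesis using nonneg[OF t] by simp
next
  case False
  then have le: "t \<le> c" by simp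
  define h where "h s = g s * exp (K * s)" for s
  have "h t \<le> h c"
  proof (rule DERIV_nonneg_imp_nondecreasing[OF le])
    fix s assume "t \<le> s" "s \<le> c"
    then have s: "s \<in> {a..b}" using c t by auto
    have "(h has_real_derivative (g' s + K * g s) * exp (K * s)) (at s)"
      unfolding h_def[abs_def] by (rule derivative_eq_intros g'[OF s] refl | simp add: algebra_simps)+
    moreover have "0 \<le> (g' s + K * g s) * exp (K * s)"
      using bound[OF s] by (intro mult_nonneg_nonneg) auto
    ultimately show "\<exists>y. (h has_real_derivative y) (at s) \<and> y \<ge> 0" by blast
  qed
  then have "g t * exp (K * t) \<le> 0" using c by (simp add: h_def)
  then have "g t \<le> 0" by (simp add: mult_le_0_iff not_le)
  then show ?thesis using nonneg[OF t] by simp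
qed

text \<open>The recursive bound \<open>a (N + 1) \<le> 1 + r a\<^sub>N - a\<^bsub>N-d\<^esub> / r\<close> improves the rate \<open>r\<close> to \<open>\<rho>\<close>, since \<open>a\<^bsub>N-d\<^esub>\<close> is at
least \<open>a\<^sub>N / (r + 1)\<^sup>d\<close>.\<close>

lemma growth_bound:
  fixes a :: "nat \<Rightarrow> nat" and r d :: nat
  assumes r: "2 \<le> r" and a0: "a 0 \<le> 1" and a1: "\<And>N. 1 \<le> a N"
    and step: "\<And>N. a (Suc N) \<le> 1 + r * a N"
    and gain: "\<And>N. d \<le> N \<Longrightarrow> r * a (Suc N) + a (N - d) \<le> r + r * (r * a N)"
  defines "\<rho> \<equiv> real r - 1 / (real r * real (r + 1) ^ d)"
  shows "real (a N) \<le> real (r + 1) ^ d * real (N + 1) * \<rho> ^ N"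
proof -
  have ratio: "a (N + k) \<le> (r + 1) ^ k * a N" for N k
  proof (induction k)
    case (Suc k)
    have "a (N + Suc k) \<le> 1 + r * a (N + k)" using step[of "N + k"] by simp
    also have "\<dots> \<le> (r + 1) * a (N + k)" using a1[of "N + k"] by simp
    also have "\<dots> \<le> (r + 1) * ((r + 1) ^ k * a N)" using Suc by (rule mult_left_mono) simp
    finally show ?case by (simp add: algebra_simps)
  qed simp
  define c where "c = real (r + 1) ^ d"
  have c1: "1 \<le> c" unfolding c_def by (intro one_le_power) simp
  have \<rho>: "\<rho> = real r - 1 / (real r * c)" by (simp add: \<rho>_def c_def)
  have "1 / (real r * c) \<le> 1"
    using r c1 by (intro divide_le_eq_1[THEN iffD2] disjI1) (auto intro!: mult_ge1_I)
  then have \<rho>1: "1 \<le> \<rho>" using r by (simp add: \<rho>)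
  show ?thesis
    unfolding c_def[symmetric]
  proof (induction N)
    case 0
    then show ?case using a0 c1 by simp
  next
    case (Suc N)
    show ?case
    proof (cases "d \<le> N")
      case True
      have "real (a N) \<le> c * real (a (N - d))"
        using ratio[of "N - d" d] True unfolding c_def
        by (metis le_add_diff_inverse2 of_nat_le_iff of_nat_mult of_nat_power)
      then have low: "real (a N) / c \<le> real (a (N - d))" using c1 by (simp add: field_simps)
      have "real r * real (a (Suc N)) + real (a (N - d)) \<le> real r + real r * (real r * real (a N))"
        using gain[OF True] by (metis of_nat_add of_nat_le_iff of_nat_mult)
      then have "real r * real (a (Suc N)) \<le> real r + real r * (real r * real (a N)) - real (a N) / c"
        using low by simp
      also have "\<dots> = real r * (1 + \<rho> * real (a N))"
        using r c1 by (simp add: \<rho> field_simps)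
      finally have "real (a (Suc N)) \<le> 1 + \<rho> * real (a N)" using r by simp
      also have "\<dots> \<le> c * \<rho> ^ Suc N + \<rho> * (c * real (N + 1) * \<rho> ^ N)"
      proof (rule add_mono)
        have "1 \<le> \<rho> ^ Suc N" using \<rho>1 by (rule one_le_power)
        then show "1 \<le> c * \<rho> ^ Suc N" using c1 mult_mono[of 1 c 1 "\<rho> ^ Suc N"] by simp
        show "\<rho> * real (a N) \<le> \<rho> * (c * real (N + 1) * \<rho> ^ N)"
          using Suc \<rho>1 by (intro mult_left_mono) auto
      qed
      also have "\<dots> = c * real (Suc N + 1) * \<rho> ^ Suc N" by (simp add: algebra_simps)
      finally show ?thesis .
    next
      case False
      have "a (Suc N) \<le> (r + 1) ^ Suc N * a 0" using ratio[of 0 "Suc N"] by simp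
      also have "\<dots> \<le> (r + 1) ^ d * 1"
        using False a0 by (intro mult_le_mono power_increasing) auto
      finally have "real (a (Suc N)) \<le> c" unfolding c_def by (metis mult.right_neutral of_nat_le_iff of_nat_power)
      also have "c * 1 \<le> c * (real (Suc N + 1) * \<rho> ^ Suc N)"
        using c1 \<rho>1 one_le_power[OF \<rho>1, of "Suc N"] mult_mono[of 1 "real (Suc N + 1)" 1 "\<rho> ^ Suc N"]
        by (intro mult_left_mono) auto
      finally show ?thesis by (simp add: mult_ac)
    qed
  qed
qed

locale control_algebra =
  fixes I :: "real set" and r :: nat and u :: "nat \<Rightarrow> real \<Rightarrow> real"
  assumes open_I: "open I" and interval_I: "is_interval I"
begin

text \<open>For continuous \<open>u\<close>, the functions in \<open>alg N\<close> are on \<open>I\<close> the linear combinations of the iterated integrals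
of \<open>u\<close> of length at most \<open>N\<close>. The description by derivatives avoids integrals and base points; values
outside \<open>I\<close> are arbitrary.\<close>

primrec alg :: "nat \<Rightarrow> (real \<Rightarrow> real) set" where
  "alg 0 = {f. \<exists>c. \<forall>t\<in>I. f t = c}"
| "alg (Suc N) = {f. \<exists>a. (\<forall>i<r. a i \<in> alg N) \<and>
     (\<forall>t\<in>I. (f has_real_derivative (\<Sum>i<r. a i t * u i t)) (at t))}"

lemma deriv_cong:
  assumes "\<And>t. t \<in> I \<Longrightarrow> f t = g t" "t \<in> I"
  shows "(f has_real_derivative d) (at t) \<longleftrightarrow> (g has_real_derivative d) (at t)"
  using assms DERIV_cong_ev[of t t f g d d] eventually_at_topological open_I
  by (metis (mono_tags, lifting) eventually_nhds)

lemma alg_cong: "f \<in> alg N \<Longrightarrow> (\<And>t. t \<in> I \<Longrightarrow> f t = g t) \<Longrightarrow> g \<in> alg N"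
  using deriv_cong[of f g] by (cases N) auto

lemma alg_const: "(\<lambda>_. c) \<in> alg N"
proof (induction N arbitrary: c)
  case (Suc N)
  then show ?case by (auto intro!: exI[of _ "\<lambda>_ _. 0"])
qed auto

lemma alg_Suc: "alg N \<subseteq> alg (Suc N)"
proof (induction N)
  case 0
  show ?case
  proof
    fix f assume "f \<in> alg 0"
    then obtain c where "\<And>t. t \<in> I \<Longrightarrow> f t = c" by auto
    then show "f \<in> alg (Suc 0)" using alg_cong[OF alg_const[of c]] by metis
  qed
next
  case (Suc N)
  show ?case
  proof
    fix f assume "f \<in> alg (Suc N)"
    then obtain a where "\<forall>i<r. a i \<in> alg N" "\<forall>t\<in>I. (f has_real_derivative (\<Sum>i<r. a i t * u i t)) (at t)"
      by auto
    then show "f \<in> alg (Suc (Suc N))" using Suc by (subst alg.simps) blast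
  qed
qed

lemma alg_mono: "M \<le> N \<Longrightarrow> alg M \<subseteq> alg N"
  by (rule lift_Suc_mono_le[of alg]) (use alg_Suc in auto)

lemma alg_scale: "f \<in> alg N \<Longrightarrow> (\<lambda>t. c * f t) \<in> alg N"
proof (induction N arbitrary: f)
  case (Suc N)
  then obtain a where a: "\<And>i. i < r \<Longrightarrow> a i \<in> alg N"
    "\<And>t. t \<in> I \<Longrightarrow> (f has_real_derivative (\<Sum>i<r. a i t * u i t)) (at t)"
    by auto
  have "((\<lambda>t. c * f t) has_real_derivative (\<Sum>i<r. (c * a i t) * u i t)) (at t)" if "t \<in> I" for t
    using DERIV_cmult[OF a(2)[OF that], of c] by (simp add: sum_distrib_left mult.assoc)
  then show ?case using Suc.IH a(1) by (auto intro!: exI[of _ "\<lambda>i t. c * a i t"])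
qed auto

lemma alg_add: "f \<in> alg N \<Longrightarrow> g \<in> alg N \<Longrightarrow> (\<lambda>t. f t + g t) \<in> alg N"
proof (induction N arbitrary: f g)
  case 0
  then show ?case by fastforce
next
  case (Suc N)
  obtain a where a: "\<And>i. i < r \<Longrightarrow> a i \<in> alg N"
    "\<And>t. t \<in> I \<Longrightarrow> (f has_real_derivative (\<Sum>i<r. a i t * u i t)) (at t)"
    using Suc.prems(1) by auto
  obtain b where b: "\<And>i. i < r \<Longrightarrow> b i \<in> alg N"
    "\<And>t. t \<in> I \<Longrightarrow> (g has_real_derivative (\<Sum>i<r. b i t * u i t)) (at t)"
    using Suc.prems(2) by auto
  have "((\<lambda>t. f t + g t) has_real_derivative (\<Sum>i<r. (a i t + b i t) * u i t)) (at t)" if "t \<in> I" for t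
    using DERIV_add[OF a(2)[OF that] b(2)[OF that]] by (simp add: sum.distrib distrib_right)
  then show ?case using Suc.IH a(1) b(1) by (auto intro!: exI[of _ "\<lambda>i t. a i t + b i t"])
qed

lemma alg_sum: "(\<And>j. j \<in> J \<Longrightarrow> f j \<in> alg N) \<Longrightarrow> (\<lambda>t. \<Sum>j\<in>J. f j t) \<in> alg N"
  by (induction J rule: infinite_finite_induct) (auto intro: alg_const alg_add)

lemma alg_mult: "f \<in> alg i \<Longrightarrow> g \<in> alg j \<Longrightarrow> (\<lambda>t. f t * g t) \<in> alg (i + j)"
proof (induction "i + j" arbitrary: i j f g rule: less_induct)
  case less
  show ?case
  proof (cases i)
    case 0
    then obtain c where c: "\<And>t. t \<in> I \<Longrightarrow> f t = c" using less.prems by auto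
    show ?thesis using alg_cong[OF alg_scale[OF less.prems(2), of c]] c 0 by simp
  next
    case (Suc i')
    show ?thesis
    proof (cases j)
      case 0
      then obtain c where c: "\<And>t. t \<in> I \<Longrightarrow> g t = c" using less.prems by auto
      show ?thesis using alg_cong[OF alg_scale[OF less.prems(1), of c]] c 0 by (simp add: mult.commute)
    next
      case (Suc j')
      obtain a where a: "\<And>i. i < r \<Longrightarrow> a i \<in> alg i'"
        "\<And>t. t \<in> I \<Longrightarrow> (f has_real_derivative (\<Sum>i<r. a i t * u i t)) (at t)"
        using less.prems(1) unfolding \<open>i = Suc i'\<close> by auto
      obtain b where b: "\<And>i. i < r \<Longrightarrow> b i \<in> alg j'"
        "\<And>t. t \<in> I \<Longrightarrow> (g has_real_derivative (\<Sum>i<r. b i t * u i t)) (at t)"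
        using less.prems(2) unfolding \<open>j = Suc j'\<close> by auto
      have "(\<lambda>t. a k t * g t + f t * b k t) \<in> alg (i' + j)" if "k < r" for k
      proof (rule alg_add)
        show "(\<lambda>t. a k t * g t) \<in> alg (i' + j)"
          using less.hyps[of i' j "a k" g] a(1)[OF that] less.prems \<open>i = Suc i'\<close> by simp
        show "(\<lambda>t. f t * b k t) \<in> alg (i' + j)"
          using less.hyps[of i j' f "b k"] b(1)[OF that] less.prems \<open>i = Suc i'\<close> \<open>j = Suc j'\<close> by simp
      qed
      moreover have "((\<lambda>t. f t * g t) has_real_derivative (\<Sum>k<r. (a k t * g t + f t * b k t) * u k t)) (at t)"
        if "t \<in> I" for t
        using DERIV_mult[OF a(2)[OF that] b(2)[OF that]]
        by (simp add: sum.distrib sum_distrib_left sum_distrib_right algebra_simps)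
      ultimately have "(\<lambda>t. f t * g t) \<in> alg (Suc (i' + j))"
        by (auto intro!: exI[of _ "\<lambda>k t. a k t * g t + f t * b k t"])
      then show ?thesis by (simp add: \<open>i = Suc i'\<close>)
    qed
  qed
qed

lemma alg_power: "f \<in> alg i \<Longrightarrow> (\<lambda>t. f t ^ k) \<in> alg (k * i)"
proof (induction k)
  case (Suc k)
  then show ?case using alg_mult[of f i "\<lambda>t. f t ^ k" "k * i"] by simp
qed (simp add: exI[of _ 1])

lemma alg_prod: "finite J \<Longrightarrow> (\<And>j. j \<in> J \<Longrightarrow> f j \<in> alg (w j)) \<Longrightarrow> (\<lambda>t. \<Prod>j\<in>J. f j t) \<in> alg (\<Sum>j\<in>J. w j)"
proof (induction J rule: finite_induct)
  case (insert j J)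
  then show ?case using alg_mult[of "f j" "w j" "\<lambda>t. \<Prod>j\<in>J. f j t" "\<Sum>j\<in>J. w j"] by simp
qed (simp add: exI[of _ 1])

lemma alg_continuous: "f \<in> alg N \<Longrightarrow> continuous_on I f"
proof (cases N)
  case 0
  assume "f \<in> alg N"
  then obtain c where "\<And>t. t \<in> I \<Longrightarrow> f t = c" using 0 by auto
  then show ?thesis using continuous_on_cong[of I I f "\<lambda>_. c"] by simp
next
  case (Suc M)
  assume "f \<in> alg N"
  then have "\<And>t. t \<in> I \<Longrightarrow> isCont f t" using Suc DERIV_isCont by fastforce
  then show ?thesis by (simp add: continuous_at_imp_continuous_on)
qed

text \<open>If \<open>u i \<in> alg d\<close> with \<open>d > 0\<close>, then \<open>u\<close> solves a homogeneous linear system with continuous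
coefficients, so it vanishes identically once it vanishes somewhere. This replaces analyticity of the
trajectories.\<close>

lemma controls_vanish:
  assumes u: "\<And>i. i < r \<Longrightarrow> u i \<in> alg d" and t0: "t0 \<in> I" "\<And>i. i < r \<Longrightarrow> u i t0 = 0"
    and t: "t \<in> I" and i: "i < r"
  shows "u i t = 0"
proof (cases d)
  case 0
  then show ?thesis using u[OF i] t0(1) t0(2)[OF i] t by auto
next
  case (Suc e)
  have "\<forall>i\<in>{..<r}. \<exists>a. (\<forall>j<r. a j \<in> alg e) \<and>
     (\<forall>t\<in>I. (u i has_real_derivative (\<Sum>j<r. a j t * u j t)) (at t))"
    using u Suc by auto
  from bchoice[OF this] obtain a where a: "\<And>i j. i < r \<Longrightarrow> j < r \<Longrightarrow> a i j \<in> alg e"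
    and u': "\<And>i t. i < r \<Longrightarrow> t \<in> I \<Longrightarrow> (u i has_real_derivative (\<Sum>j<r. a i j t * u j t)) (at t)"
    by auto
  define A where "A = min t0 t" define B where "B = max t0 t"
  have "A \<in> I" "B \<in> I" using t t0 by (auto simp: A_def B_def min_def max_def)
  then have sub: "{A..B} \<subseteq> I" using mem_is_interval_1_I[OF interval_I, of A B] by auto
  have "\<exists>K. \<forall>s\<in>{A..B}. \<bar>a i j s\<bar> \<le> K" if "i < r" "j < r" for i j
  proof -
    have "continuous_on {A..B} (a i j)" using alg_continuous[OF a[OF that]] sub continuous_on_subset by blast
    then have "bounded (a i j ` {A..B})" by (intro compact_imp_bounded compact_continuous_image) auto
    then show ?thesis unfolding bounded_iff by auto
  qed
  then obtain K where K: "\<And>i j s. i < r \<Longrightarrow> j < r \<Longrightarrow> s \<in> {A..B} \<Longrightarrow> \<bar>a i j s\<bar> \<le> K i j"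
    by metis
  \<comment> \<open>Gronwall's inequality is applied to the squared length of the control.\<close>
  define g where "g s = (\<Sum>i<r. (u i s)^2)" for s
  define g' where "g' s = (\<Sum>i<r. 2 * u i s * (\<Sum>j<r. a i j s * u j s))" for s
  define M where "M = (\<Sum>i<r. \<Sum>j<r. 2 * K i j)"
  have g_ge: "(u i s)^2 \<le> g s" if "i < r" for i s
    unfolding g_def using that member_le_sum[of i "{..<r}" "\<lambda>i. (u i s)^2"] by simp
  have prod_le: "\<bar>u i s * u j s\<bar> \<le> g s" if "i < r" "j < r" for i j s
  proof -
    have "0 \<le> (\<bar>u i s\<bar> - \<bar>u j s\<bar>)^2" by simp
    then have "2 * (\<bar>u i s\<bar> * \<bar>u j s\<bar>) \<le> (u i s)^2 + (u j s)^2" by (simp add: power2_diff)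
    then show ?thesis using g_ge[OF that(1), of s] g_ge[OF that(2), of s] by (simp add: abs_mult)
  qed
  have "g t = 0"
  proof (rule gronwall_zero[of A B g g' M t0])
    fix s assume s: "s \<in> {A..B}"
    then have sI: "s \<in> I" using sub by auto
    show "(g has_real_derivative g' s) (at s)"
      unfolding g_def[abs_def] g'_def
    proof (intro DERIV_sum)
      fix i assume "i \<in> {..<r}"
      then have "i < r" by simp
      from DERIV_power[OF u'[OF this sI], of 2]
      show "((\<lambda>s. (u i s)^2) has_real_derivative 2 * u i s * (\<Sum>j<r. a i j s * u j s)) (at s)"
        by (simp add: mult_ac)
    qed
    have "\<bar>g' s\<bar> \<le> (\<Sum>i<r. \<Sum>j<r. 2 * (\<bar>a i j s\<bar> * \<bar>u i s * u j s\<bar>))"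
    proof -
      have "g' s = (\<Sum>i<r. \<Sum>j<r. 2 * (a i j s * (u i s * u j s)))"
        by (simp add: g'_def sum_distrib_left mult_ac)
      also have "\<bar>\<dots>\<bar> \<le> (\<Sum>i<r. \<Sum>j<r. \<bar>2 * (a i j s * (u i s * u j s))\<bar>)"
        by (intro order.trans[OF sum_abs] sum_mono sum_abs)
      finally show ?thesis by (simp add: abs_mult)
    qed
    also have "\<dots> \<le> (\<Sum>i<r. \<Sum>j<r. 2 * (K i j * g s))"
      using K[OF _ _ s] prod_le
      by (intro sum_mono mult_left_mono mult_mono) (auto intro: order.trans[OF abs_ge_zero])
    also have "\<dots> = M * g s" unfolding M_def sum_distrib_right by (simp only: mult.assoc)
    finally show "\<bar>g' s\<bar> \<le> M * g s" .
    show "0 \<le> g s" by (simp add: g_def sum_nonneg)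
  qed (use t0 in \<open>auto simp: A_def B_def g_def\<close>)
  then show ?thesis using g_ge[OF i, of t] by simp
qed

text \<open>Representatives that vanish outside \<open>I\<close>; without this normalisation the space \<open>alg N\<close> would have
infinite dimension.\<close>

definition algI where "algI N = {f \<in> alg N. \<forall>t. t \<notin> I \<longrightarrow> f t = 0}"
definition one_I :: "real \<Rightarrow> real" where "one_I t = (if t \<in> I then 1 else 0)"

lemma algI_subspace: "FS.subspace (algI N)"
  unfolding algI_def FS.subspace_def zero_fun_def plus_fun_def
  using alg_const alg_add alg_scale by auto

lemma one_I_algI: "one_I \<in> algI N"
  using alg_cong[OF alg_const[of 1 N], of one_I] by (auto simp: algI_def one_I_def)

text \<open>The functions that may occur as derivatives of functions in \<open>algI (Suc N)\<close>, extended by \<open>0\<close>.\<close>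

definition dalgI where "dalgI N = {f. \<exists>a. (\<forall>i<r. a i \<in> algI N) \<and> f = (\<lambda>t. \<Sum>i<r. a i t * u i t)}"

text \<open>A function on an interval is determined by its derivative up to a constant.\<close>

lemma algI_Suc_spanned:
  assumes H: "finite H" "dalgI N \<subseteq> FS.span H"
  shows "\<exists>B. finite B \<and> algI (Suc N) \<subseteq> FS.span B \<and> card B \<le> 1 + card H"
proof -
  define DA where "DA = {g \<in> dalgI N. \<exists>f\<in>algI (Suc N). \<forall>t\<in>I. (f has_real_derivative g t) (at t)}"
  obtain E where E: "E \<subseteq> DA" "FS.independent E" "DA \<subseteq> FS.span E"
    by (rule FS.basis_exists[of DA])
  have finE: "finite E" "card E \<le> card H"
    using FS.independent_span_bound[OF H(1) E(2)] E(1) H(2) by (auto simp: DA_def)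
  have "\<forall>g\<in>E. \<exists>f. f \<in> algI (Suc N) \<and> (\<forall>t\<in>I. (f has_real_derivative g t) (at t))"
    using E(1) by (auto simp: DA_def)
  from bchoice[OF this] obtain P where P: "\<And>g. g \<in> E \<Longrightarrow> P g \<in> algI (Suc N)"
    "\<And>g t. g \<in> E \<Longrightarrow> t \<in> I \<Longrightarrow> (P g has_real_derivative g t) (at t)" by blast
  have "f \<in> FS.span (insert one_I (P ` E))" if f: "f \<in> algI (Suc N)" for f
  proof -
    obtain a where a: "\<And>i. i < r \<Longrightarrow> a i \<in> alg N"
      and f': "\<And>t. t \<in> I \<Longrightarrow> (f has_real_derivative (\<Sum>i<r. a i t * u i t)) (at t)"
      using f by (auto simp: algI_def)
    define b where "b i t = (if t \<in> I then a i t else 0)" for i t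
    have b: "b i \<in> algI N" if "i < r" for i
      using alg_cong[OF a[OF that], of "b i"] by (auto simp: algI_def b_def)
    define g where "g = (\<lambda>t. \<Sum>i<r. b i t * u i t)"
    have f'g: "(f has_real_derivative g t) (at t)" if "t \<in> I" for t
      using f'[OF that] that by (simp add: g_def b_def)
    have "g \<in> DA" using b f f'g by (auto simp: DA_def dalgI_def g_def)
    then obtain c where c: "g = (\<lambda>x. \<Sum>e\<in>E. c e * e x)"
      using FS_span_finite_rep[OF finE(1)] E(3) by blast
    define h where "h t = f t - (\<Sum>e\<in>E. c e * P e t)" for t
    have "(h has_real_derivative 0) (at t within I)" if "t \<in> I" for t
    proof -
      have "((\<lambda>t. \<Sum>e\<in>E. c e * P e t) has_real_derivative (\<Sum>e\<in>E. c e * e t)) (at t)"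
        by (intro DERIV_sum DERIV_cmult P that)
      from DERIV_diff[OF f'g[OF that] this] have "(h has_real_derivative 0) (at t)"
        unfolding h_def[abs_def] by (simp add: c)
      then show ?thesis by (rule has_field_derivative_at_within)
    qed
    then obtain k where k: "\<And>t. t \<in> I \<Longrightarrow> h t = k"
      using has_field_derivative_zero_constant[of I h] interval_I is_interval_convex by blast
    have "f = (\<lambda>t. k * one_I t) + (\<lambda>t. \<Sum>e\<in>E. c e * P e t)"
    proof
      fix t show "f t = ((\<lambda>t. k * one_I t) + (\<lambda>t. \<Sum>e\<in>E. c e * P e t)) t"
      proof (cases "t \<in> I")
        case True
        then show ?thesis using k[OF True] by (simp add: h_def one_I_def)
      next
        case False
        then have "f t = 0" "\<And>e. e \<in> E \<Longrightarrow> P e t = 0" using f P(1) by (auto simp: algI_def)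
        then show ?thesis using False by (simp add: one_I_def)
      qed
    qed
    also have "\<dots> \<in> FS.span (insert one_I (P ` E))"
      by (intro FS.span_add FS.span_scale FS_sum_in_span) (auto intro: FS.span_base)
    finally show ?thesis .
  qed
  moreover have "card (insert one_I (P ` E)) \<le> 1 + card H"
    using card_insert_le_m1[of "Suc (card H)" "P ` E" one_I] card_image_le[OF finE(1), of P] finE by simp
  ultimately show ?thesis using finE by (intro exI[of _ "insert one_I (P ` E)"]) auto
qed

lemma dalgI_spanned:
  assumes H: "\<And>l b. l < r \<Longrightarrow> b \<in> B \<Longrightarrow> (\<lambda>t. b t * u l t) \<in> FS.span H" and B: "algI N \<subseteq> FS.span B"
  shows "dalgI N \<subseteq> FS.span H"
proof
  fix f assume "f \<in> dalgI N"
  then obtain a where a: "\<And>i. i < r \<Longrightarrow> a i \<in> algI N" and f: "f = (\<lambda>t. \<Sum>i<r. a i t * u i t)"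
    by (auto simp: dalgI_def)
  have au: "(\<lambda>t. a i t * u i t) \<in> FS.span H" if "i < r" for i
    by (rule FS_span_mult[of "a i" B]) (use a[OF that] B H that in auto)
  have "(\<lambda>t. \<Sum>i<r. 1 * (a i t * u i t)) \<in> FS.span H"
    by (rule FS_sum_in_span[where g = "\<lambda>i t. a i t * u i t" and c = "\<lambda>_. 1"]) (use au in auto)
  then show "f \<in> FS.span H" by (simp add: f)
qed

lemma algI_0: "algI 0 \<subseteq> FS.span {one_I}"
proof
    fix f assume "f \<in> algI 0"
    then obtain c where "\<And>t. t \<in> I \<Longrightarrow> f t = c" "\<And>t. t \<notin> I \<Longrightarrow> f t = 0" by (auto simp: algI_def)
    then have "f = (\<lambda>t. c * one_I t)" by (auto simp: one_I_def)
    then show "f \<in> FS.span {one_I}" using FS.span_scale[OF FS.span_base] by simp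
qed

lemma algI_basis:
  shows "\<exists>B. finite B \<and> B \<subseteq> algI N \<and> FS.independent B \<and> algI N \<subseteq> FS.span B \<and> card B = FS.dim (algI N)"
    and "FS.dim (algI 0) \<le> 1" and "FS.dim (algI (Suc N)) \<le> 1 + r * FS.dim (algI N)"
proof -
  have fin: "\<exists>B. finite B \<and> B \<subseteq> algI N \<and> FS.independent B \<and> algI N \<subseteq> FS.span B \<and> card B = FS.dim (algI N)"
    if C: "finite C" "algI N \<subseteq> FS.span C" for N C
  proof -
    obtain E where E: "E \<subseteq> algI N" "FS.independent E" "algI N \<subseteq> FS.span E" "card E = FS.dim (algI N)"
      by (rule FS.basis_exists[of "algI N"])
    then have "finite E" using FS.independent_span_bound[OF C(1) E(2)] C by auto
    then show ?thesis using E by blast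
  qed
  show "FS.dim (algI 0) \<le> 1" using FS.dim_le_card[OF algI_0] by simp
  have step: "\<exists>C. finite C \<and> algI (Suc N) \<subseteq> FS.span C \<and> card C \<le> 1 + r * card B"
    if B: "finite B" "algI N \<subseteq> FS.span B" for N B
  proof -
    define H where "H = (\<lambda>(l, b) t. b t * u l t) ` ({..<r} \<times> B)"
    have "dalgI N \<subseteq> FS.span H"
      by (rule dalgI_spanned[OF _ B(2)]) (auto simp: H_def intro!: FS.span_base)
    moreover have "finite H" "card H \<le> r * card B"
      using B card_image_le[of "{..<r} \<times> B" "\<lambda>(l, b) t. b t * u l t"] by (auto simp: H_def)
    ultimately show ?thesis using algI_Suc_spanned[of H N] by fastforce
  qed
  have sp: "\<exists>C. finite C \<and> algI N \<subseteq> FS.span C" for N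
  proof (induction N)
    case (Suc N)
    then show ?case using step by blast
  qed (use algI_0 in blast)
  show basis: "\<exists>B. finite B \<and> B \<subseteq> algI N \<and> FS.independent B \<and> algI N \<subseteq> FS.span B \<and> card B = FS.dim (algI N)" for N
    using sp fin by blast
  obtain B where B: "finite B" "algI N \<subseteq> FS.span B" "card B = FS.dim (algI N)" using basis by blast
  obtain C where "finite C" "algI (Suc N) \<subseteq> FS.span C" "card C \<le> 1 + r * card B" using step[OF B(1,2)] by blast
  then show "FS.dim (algI (Suc N)) \<le> 1 + r * FS.dim (algI N)"
    using FS.dim_le_card[of "algI (Suc N)" C] B(3) by simp
qed

text \<open>A maximal set of points on which all values can be prescribed determines the functions in the space.\<close>

lemma algI_dual_points:
  "\<exists>T f. finite T \<and> T \<subseteq> I \<and> FS.dim (algI N) \<le> card T \<and> (\<forall>t\<in>T. f t \<in> algI N) \<and>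
     (\<forall>t\<in>T. \<forall>t'\<in>T. f t t' = (if t = t' then 1 else 0))"
proof -
  obtain B where B: "finite B" "B \<subseteq> algI N" "FS.independent B" "algI N \<subseteq> FS.span B"
    using algI_basis(1) by blast
  define good where "good n \<longleftrightarrow> (\<exists>T f. finite T \<and> T \<subseteq> I \<and> card T = n \<and> (\<forall>t\<in>T. f t \<in> algI N) \<and>
     (\<forall>t\<in>T. \<forall>t'\<in>T. f t t' = (if t = t' then 1 else 0)))" for n
  have "n \<le> card B" if "good n" for n
  proof -
    obtain T f where T: "finite T" "T \<subseteq> I" "card T = n" "\<And>t. t \<in> T \<Longrightarrow> f t \<in> algI N"
      and dual: "\<And>t t'. t \<in> T \<Longrightarrow> t' \<in> T \<Longrightarrow> f t t' = (if t = t' then 1 else 0 :: real)"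
      using \<open>good n\<close> unfolding good_def by blast
    have "inj_on f T" "FS.independent (f ` T)"
      using FS_independent_dual[OF T(1), of f "\<lambda>t. t"] dual by auto
    then show ?thesis
      using FS.independent_span_bound[OF B(1), of "f ` T"] T B(4) by (auto simp: card_image)
  qed
  moreover have "good 0" by (auto simp: good_def)
  ultimately obtain n where n: "good n" "\<And>m. good m \<Longrightarrow> m \<le> n"
    using Nat.ex_has_greatest_nat[of good 0 "card B"] by blast
  obtain T f where T: "finite T" "T \<subseteq> I" "card T = n" "\<And>t. t \<in> T \<Longrightarrow> f t \<in> algI N"
    and dual: "\<And>t t'. t \<in> T \<Longrightarrow> t' \<in> T \<Longrightarrow> f t t' = (if t = t' then 1 else 0 :: real)"
    using n(1) unfolding good_def by blast
  have "algI N \<subseteq> FS.span (f ` T)"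
  proof
    fix g assume g: "g \<in> algI N"
    define h where "h t = g t - (\<Sum>s\<in>T. g s * f s t)" for t
    have sum_algI: "(\<lambda>t. \<Sum>s\<in>T. c s * f s t) \<in> algI N" for c
      using FS_sum_in_span[of T f "algI N" c] FS.span_base T(4) FS.span_eq_iff[THEN iffD2, OF algI_subspace, of N]
      by blast
    have hN: "h \<in> algI N"
      using FS.subspace_diff[OF algI_subspace g sum_algI[of g]] by (simp add: h_def[abs_def] fun_diff_def)
    have hT: "h t = 0" if "t \<in> T" for t
      using that T(1) dual by (simp add: h_def if_distrib[of "\<lambda>x. _ * x"] cong: if_cong)
    have "h t = 0" for t
    proof (rule ccontr)
      assume ht: "h t \<noteq> 0"
      have tI: "t \<in> I" using ht hN by (auto simp: algI_def)
      have tT: "t \<notin> T" using ht hT by auto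
      \<comment> \<open>The point \<open>t\<close> can be added to \<open>T\<close>: \<open>h\<close> is dual to it up to a factor, and multiples of \<open>h\<close> correct the other functions.\<close>
      define f' where "f' s = (if s = t then (\<lambda>x. h x / h t) else (\<lambda>x. f s x - f s t * (h x / h t)))" for s
      have e: "(\<lambda>x. c * (h x / h t)) \<in> algI N" for c
        using FS.subspace_scale[OF algI_subspace hN, of "c / h t"] by simp
      have "good (Suc n)"
        unfolding good_def
      proof (intro exI[of _ "insert t T"] exI[of _ f'] conjI ballI)
        show "f' s \<in> algI N" if "s \<in> insert t T" for s
        proof (cases "s = t")
          case True
          then show ?thesis using e[of 1] by (simp add: f'_def)
        next
          case False
          then have "f s \<in> algI N" using that T(4) by auto
          from FS.subspace_diff[OF algI_subspace this e[of "f s t"]]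
          show ?thesis using False by (simp add: f'_def fun_diff_def)
        qed
        show "f' s s' = (if s = s' then 1 else 0)" if "s \<in> insert t T" "s' \<in> insert t T" for s s'
          using that tT ht hT dual by (auto simp: f'_def)
      qed (use T tI tT in auto)
      then show False using n(2) by fastforce
    qed
    then have "g t = (\<Sum>s\<in>T. g s * f s t)" for t
      unfolding h_def by (rule eq_iff_diff_eq_0[THEN iffD2])
    then have geq: "g = (\<lambda>t. \<Sum>s\<in>T. g s * f s t)" by (rule ext)
    have gin: "(\<lambda>t. \<Sum>s\<in>T. g s * f s t) \<in> FS.span (f ` T)"
      by (rule FS_sum_in_span) (auto intro: FS.span_base)
    show "g \<in> FS.span (f ` T)" by (subst geq) (rule gin)
  qed
  then have "FS.dim (algI N) \<le> card (f ` T)" using T(1) by (intro FS.dim_le_card) auto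
  also have "\<dots> \<le> card T" using T(1) by (rule card_image_le)
  finally show ?thesis using T dual by blast
qed

text \<open>Choose \<open>dim A\<^bsub>N-d\<^esub>\<close> points with dual functions \<open>f t \<in> A\<^bsub>N-d\<^esub>\<close>. At every point some control does not
vanish, so one index \<open>i\<close> serves at least the \<open>r\<close>-th part of the points. For these points the products
\<open>f t * u i\<close> are independent in \<open>A\<^sub>N\<close>, and their multiples by another control \<open>u j\<close> equal
\<open>(f t * u j) * u i\<close>. They can be dropped from the generators \<open>b * u l\<close>, where \<open>b\<close> runs through a basis of
\<open>A\<^sub>N\<close>.\<close>

lemma algI_gain:
  assumes r: "2 \<le> r" and u: "\<And>i. i < r \<Longrightarrow> u i \<in> alg d"
    and nz: "\<And>t. t \<in> I \<Longrightarrow> \<exists>i<r. u i t \<noteq> 0" and dN: "d \<le> N"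
  shows "r * FS.dim (algI (Suc N)) + FS.dim (algI (N - d)) \<le> r + r * (r * FS.dim (algI N))"
proof -
  obtain T f where T: "finite T" "T \<subseteq> I" "FS.dim (algI (N - d)) \<le> card T"
    and f0: "\<forall>t\<in>T. f t \<in> algI (N - d)"
    and dual0: "\<forall>t\<in>T. \<forall>t'\<in>T. f t t' = (if t = t' then 1 else 0 :: real)"
    using algI_dual_points[of "N - d"] by (elim exE conjE)
  have f: "f t \<in> algI (N - d)" if "t \<in> T" for t using f0 that by blast
  have dual: "f t t' = (if t = t' then 1 else 0 :: real)" if "t \<in> T" "t' \<in> T" for t t'
    using dual0 that by blast
  define S where "S i = {t \<in> T. u i t \<noteq> 0}" for i
  have "\<exists>i<r. card T \<le> r * card (S i)"
  proof (rule ccontr)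
    assume "\<not> (\<exists>i<r. card T \<le> r * card (S i))"
    then have less: "r * card (S i) < card T" if "i < r" for i using that by auto
    have "T = (\<Union>i<r. S i)" using nz T(2) by (auto simp: S_def subset_iff)
    then have "card T \<le> (\<Sum>i<r. card (S i))" using card_UN_le[of "{..<r}" S] by simp
    then have "r * card T \<le> (\<Sum>i<r. r * card (S i))" by (simp add: sum_distrib_left[symmetric])
    also have "\<dots> < (\<Sum>i<r. card T)" using less r by (intro sum_strict_mono) (auto simp: lessThan_empty_iff)
    finally show False by simp
  qed
  then obtain i where i: "i < r" "card T \<le> r * card (S i)" by blast
  \<comment> \<open>Any control other than \<open>u i\<close> would do.\<close>
  define j where "j = (if i = 0 then 1 else 0 :: nat)"
  have j: "j < r" "j \<noteq> i" using r by (auto simp: j_def)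
  define g where "g t = (\<lambda>x. f t x * u i x)" for t
  have fu: "(\<lambda>x. f t x * u l x) \<in> algI N" if "t \<in> T" "l < r" for t l
    using alg_mult[of "f t" "N - d" "u l" d] f[OF that(1)] u[OF that(2)] dN by (auto simp: algI_def)
  have finS: "finite (S i)" using T by (simp add: S_def)
  have gS: "inj_on g (S i)" "FS.independent (g ` S i)"
    using FS_independent_dual[OF finS, of g "\<lambda>t. t"] dual by (auto simp: S_def g_def)
  have "g ` S i \<subseteq> algI N" using fu i(1) by (auto simp: g_def S_def)
  from FS.maximal_independent_subset_extend[OF this gS(2)]
  obtain B where B: "g ` S i \<subseteq> B" "B \<subseteq> algI N" "FS.independent B" "algI N \<subseteq> FS.span B" by blast
  have cardB: "card B = FS.dim (algI N)" using B FS.dim_eq_card_independent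
    by (metis FS.dim_unique)
  obtain E where E: "finite E" "algI N \<subseteq> FS.span E" using algI_basis(1) by blast
  have finB: "finite B" using FS.independent_span_bound[OF E(1) B(3)] B(2) E(2) by auto
  define H where "H = (\<lambda>(l, b) t. b t * u l t) ` (({..<r} - {j}) \<times> B) \<union> (\<lambda>b t. b t * u j t) ` (B - g ` S i)"
  have H1: "(\<lambda>t. b t * u l t) \<in> FS.span H" if "l < r" "l \<noteq> j" "b \<in> B" for l b
    using that by (intro FS.span_base) (auto simp: H_def)
  have "dalgI N \<subseteq> FS.span H"
  proof (rule dalgI_spanned[OF _ B(4)])
    fix l b assume l: "l < r" and b: "b \<in> B"
    consider "l \<noteq> j" | "l = j" "b \<notin> g ` S i" | t where "l = j" "t \<in> S i" "b = g t" by blast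
    then show "(\<lambda>t. b t * u l t) \<in> FS.span H"
    proof cases
      case 1
      then show ?thesis using H1 l b by blast
    next
      case 2
      then show ?thesis using b by (intro FS.span_base) (auto simp: H_def)
    next
      case 3
      then have "(\<lambda>x. f t x * u j x) \<in> FS.span B" using fu j(1) B(4) by (auto simp: S_def)
      then have "(\<lambda>x. f t x * u j x * u i x) \<in> FS.span H"
        by (rule FS_span_mult) (use H1 i(1) j(2) in auto)
      then show ?thesis using 3 by (simp add: g_def mult_ac)
    qed
  qed
  moreover have "finite H" using finB by (simp add: H_def)
  ultimately obtain C where C: "finite C" "algI (Suc N) \<subseteq> FS.span C" "card C \<le> 1 + card H"
    using algI_Suc_spanned by blast
  have "card H \<le> card (({..<r} - {j}) \<times> B) + card (B - g ` S i)"
    unfolding H_def using finB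
    by (intro order.trans[OF card_Un_le] add_mono card_image_le) auto
  also have "\<dots> = (r - 1) * card B + (card B - card (S i))"
    using j finB B(1) finS gS(1) by (simp add: card_cartesian_product card_Diff_subset card_image)
  finally have cH: "card H \<le> (r - 1) * card B + (card B - card (S i))" .
  have "card (S i) \<le> card B" using B(1) finB gS(1) card_image card_mono by metis
  then have "card H + card (S i) \<le> r * card B"
    using cH r by (cases r) auto
  then have "FS.dim (algI (Suc N)) + card (S i) \<le> 1 + r * card B"
    using FS.dim_le_card[OF C(2,1)] C(3) by simp
  then have "r * (FS.dim (algI (Suc N)) + card (S i)) \<le> r * (1 + r * card B)" by (rule mult_left_mono) simp
  then show ?thesis using i(2) T(3) cardB by (simp add: algebra_simps)
qed

text \<open>The dimension of \<open>alg N\<close> is bounded in terms of \<open>r\<close>, \<open>d\<close> and \<open>N\<close>; the bound is stated for dual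
families of functions and points, the form in which it is applied.\<close>

theorem dual_family_bound:
  assumes r: "2 \<le> r" and u: "\<And>i. i < r \<Longrightarrow> u i \<in> alg d"
    and J: "finite J" "\<And>j. j \<in> J \<Longrightarrow> f j \<in> alg N" "\<And>j. j \<in> J \<Longrightarrow> p j \<in> I"
    and dual: "\<And>j k. j \<in> J \<Longrightarrow> k \<in> J \<Longrightarrow> f j (p k) = 0 \<longleftrightarrow> j \<noteq> k"
  shows "real (card J) \<le> real (r + 1) ^ d * real (N + 1) * (real r - 1 / (real r * real (r + 1) ^ d)) ^ N"
proof (cases "I = {}")
  case True
  then have "J = {}" using J(3) by auto
  moreover have "0 \<le> real r - 1 / (real r * real (r + 1) ^ d)"
  proof -
    have "1 \<le> real r * real (r + 1) ^ d" using r by (intro mult_ge1_I one_le_power) auto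
    then have "1 / (real r * real (r + 1) ^ d) \<le> 1" by (simp add: divide_le_eq_1)
    moreover have "2 \<le> real r" using r by simp
    ultimately show ?thesis by linarith
  qed
  ultimately show ?thesis by simp
next
  case False
  have a1: "1 \<le> FS.dim (algI N)" for N
  proof -
    obtain B where B: "finite B" "algI N \<subseteq> FS.span B" "card B = FS.dim (algI N)" using algI_basis(1) by blast
    have "one_I \<in> FS.span B" using one_I_algI B by blast
    moreover have "one_I \<noteq> 0" using False by (auto simp: one_I_def fun_eq_iff)
    ultimately have "B \<noteq> {}" by (auto simp: FS.span_empty)
    then show ?thesis using B by (metis One_nat_def Suc_leI card_gt_0_iff)
  qed
  have bound: "real (FS.dim (algI N)) \<le> real (r + 1) ^ d * real (N + 1) * (real r - 1 / (real r * real (r + 1) ^ d)) ^ N"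
  proof (cases "\<forall>t\<in>I. \<exists>i<r. u i t \<noteq> 0")
    case True
    show ?thesis
      by (rule growth_bound[where a = "\<lambda>N. FS.dim (algI N)"])
         (use r a1 algI_basis(2,3) algI_gain[OF r u] True in auto)
  next
    case False
    then have u0: "u i t = 0" if "i < r" "t \<in> I" for i t
      using controls_vanish[OF u] that by metis
    have "algI N \<subseteq> FS.span {one_I}" for N
    proof (cases N)
      case 0
      then show ?thesis using algI_0 by simp
    next
      case (Suc M)
      have "algI (Suc M) \<subseteq> algI 0"
      proof
        fix f assume f: "f \<in> algI (Suc M)"
        then obtain a where a: "\<And>t. t \<in> I \<Longrightarrow> (f has_real_derivative (\<Sum>i<r. a i t * u i t)) (at t)"
          by (auto simp: algI_def)
        have "(f has_real_derivative 0) (at t within I)" if t: "t \<in> I" for t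
        proof -
          have "(\<Sum>i<r. a i t * u i t) = 0" using u0 t by (intro sum.neutral) auto
          then show ?thesis using a[OF t] by (simp add: has_field_derivative_at_within)
        qed
        then obtain k where "\<And>t. t \<in> I \<Longrightarrow> f t = k"
          using has_field_derivative_zero_constant[of I f] interval_I is_interval_convex by blast
        then show "f \<in> algI 0" using f by (auto simp: algI_def)
      qed
      then show ?thesis using algI_0 Suc by blast
    qed
    then have "FS.dim (algI N) \<le> 1" for N using FS.dim_le_card[of "algI N" "{one_I}"] by simp
    then have eq: "FS.dim (algI N) = 1" for N using a1 le_antisym by blast
    have rr: "r * r \<ge> 2 * r" using r by simp
    show ?thesis
      by (rule growth_bound[where a = "\<lambda>N. FS.dim (algI N)"]) (use r rr eq in auto)
  qed
  define F where "F j t = (if t \<in> I then f j t else 0)" for j t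
  have F: "F j \<in> algI N" if "j \<in> J" for j
    using alg_cong[OF J(2)[OF that], of "F j"] by (auto simp: algI_def F_def)
  have "inj_on F J" "FS.independent (F ` J)"
    using FS_independent_dual[OF J(1), of F p] dual J(3) by (auto simp: F_def)
  moreover obtain B where B: "finite B" "algI N \<subseteq> FS.span B" "card B = FS.dim (algI N)"
    using algI_basis(1) by blast
  ultimately have "card J \<le> FS.dim (algI N)"
    using FS.independent_span_bound[of B "F ` J"] F by (force simp: card_image)
  then show ?thesis using bound by linarith
qed

end

section \<open>The growth of free nilpotent Lie algebras\<close>

text \<open>The test algebra for the universal property has to live in the ambient space. An element is viewed
as a formal combination of words, with the coefficient of a word stored at the code of the word.\<close>

definition cf :: "ambient \<Rightarrow> nat list \<Rightarrow> real" where "cf f w = apply_bcontfun f (list_encode w)"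

definition of_cf :: "(nat list \<Rightarrow> real) \<Rightarrow> ambient" where "of_cf c = Bcontfun (\<lambda>m. c (list_decode m))"

lemma cf_of_cf:
  assumes "finite {w. c w \<noteq> 0}" shows "cf (of_cf c) w = c w"
proof -
  have "range (\<lambda>m. c (list_decode m)) \<subseteq> insert 0 (c ` {w. c w \<noteq> 0})" by auto
  then have "bounded (range (\<lambda>m. c (list_decode m)))"
    using assms by (meson bounded_subset finite_imageI finite_imp_bounded finite_insert)
  then have "(\<lambda>m. c (list_decode m)) \<in> bcontfun" by (simp add: bcontfun_def)
  then show ?thesis by (simp add: cf_def of_cf_def Bcontfun_inverse)
qed

lemma cf_ext: "(\<And>w. cf f w = cf g w) \<Longrightarrow> f = g"
  unfolding cf_def by (metis apply_bcontfun_inject ext list_decode_inverse)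

lemma cf_linear [simp]:
  "cf (f + g) w = cf f w + cf g w" "cf (f - g) w = cf f w - cf g w"
  "cf (c *\<^sub>R f) w = c * cf f w" "cf 0 w = 0"
  by (simp_all add: cf_def plus_bcontfun.rep_eq minus_bcontfun.rep_eq scaleR_bcontfun.rep_eq zero_bcontfun.rep_eq)

lemma cf_sum: "cf (\<Sum>j\<in>J. f j) w = (\<Sum>j\<in>J. cf (f j) w)"
  by (induction J rule: infinite_finite_induct) auto

text \<open>The words that index a basis of the augmentation ideal of the free associative algebra on \<open>r\<close>
letters, truncated after degree \<open>s\<close>.\<close>

definition admissible :: "nat \<Rightarrow> nat \<Rightarrow> nat list \<Rightarrow> bool" where
  "admissible s r w \<longleftrightarrow> w \<noteq> [] \<and> length w \<le> s \<and> set w \<subseteq> {..<r}"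

lemma finite_admissible: "finite {w. admissible s r w}"
  by (rule finite_subset[OF _ finite_lists_length_le[of "{..<r}" s]]) (auto simp: admissible_def)

definition convolution :: "ambient \<Rightarrow> ambient \<Rightarrow> nat list \<Rightarrow> real" where
  "convolution f g w = (\<Sum>i\<le>length w. cf f (take i w) * cf g (drop i w))"

definition tprod :: "nat \<Rightarrow> nat \<Rightarrow> ambient \<Rightarrow> ambient \<Rightarrow> ambient" where
  "tprod s r f g = of_cf (\<lambda>w. if admissible s r w then convolution f g w else 0)"

definition tcomm :: "nat \<Rightarrow> nat \<Rightarrow> ambient \<Rightarrow> ambient \<Rightarrow> ambient" where
  "tcomm s r f g = tprod s r f g - tprod s r g f"

definition talg :: "nat \<Rightarrow> nat \<Rightarrow> ambient set" where
  "talg s r = {f. \<forall>w. cf f w \<noteq> 0 \<longrightarrow> admissible s r w}"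

lemma cf_tprod: "cf (tprod s r f g) w = (if admissible s r w then convolution f g w else 0)"
  unfolding tprod_def
  by (rule cf_of_cf) (rule finite_subset[OF _ finite_admissible[of s r]], auto)

lemma talg_subspace: "subspace (talg s r)"
  by (force simp: subspace_def talg_def)

lemma tprod_talg: "tprod s r f g \<in> talg s r" by (simp add: talg_def cf_tprod)

lemma tcomm_talg: "tcomm s r f g \<in> talg s r"
  unfolding tcomm_def by (intro subspace_diff[OF talg_subspace] tprod_talg)

lemma convolution_linear:
  "convolution (f + f') g w = convolution f g w + convolution f' g w" "convolution f (g + g') w = convolution f g w + convolution f g' w"
  "convolution (f - f') g w = convolution f g w - convolution f' g w" "convolution f (g - g') w = convolution f g w - convolution f g' w"
  "convolution (c *\<^sub>R f) g w = c * convolution f g w" "convolution f (c *\<^sub>R g) w = c * convolution f g w"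
  by (simp_all add: convolution_def algebra_simps sum.distrib sum_subtractf sum_distrib_left)

lemma tprod_linear:
  "tprod s r (f + f') g = tprod s r f g + tprod s r f' g" "tprod s r f (g + g') = tprod s r f g + tprod s r f g'"
  "tprod s r (f - f') g = tprod s r f g - tprod s r f' g" "tprod s r f (g - g') = tprod s r f g - tprod s r f g'"
  "tprod s r (c *\<^sub>R f) g = c *\<^sub>R tprod s r f g" "tprod s r f (c *\<^sub>R g) = c *\<^sub>R tprod s r f g"
  by (rule cf_ext; simp add: cf_tprod convolution_linear)+

lemma tprod_assoc:
  assumes "f \<in> talg s r" "h \<in> talg s r"
  shows "tprod s r (tprod s r f g) h = tprod s r f (tprod s r g h)"
proof (rule cf_ext)
  fix w
  have nil: "cf f [] = 0" "cf h [] = 0" using assms by (auto simp: talg_def admissible_def)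
  show "cf (tprod s r (tprod s r f g) h) w = cf (tprod s r f (tprod s r g h)) w"
  proof (cases "admissible s r w")
    case True
    define n where "n = length w"
    have sub: "admissible s r v \<or> v = []" if "set v \<subseteq> set w" "length v \<le> length w" for v
      using True that by (auto simp: admissible_def)
    have 1: "cf (tprod s r f g) (take i w) = convolution f g (take i w)" for i
      using sub[of "take i w"] nil set_take_subset[of i w] by (auto simp: cf_tprod convolution_def)
    have 2: "cf (tprod s r g h) (drop i w) = convolution g h (drop i w)" for i
      using sub[of "drop i w"] nil set_drop_subset[of i w] by (auto simp: cf_tprod convolution_def)
    have "convolution (tprod s r f g) h w
        = (\<Sum>i\<le>n. \<Sum>j\<le>i. cf f (take j w) * cf g (drop j (take i w)) * cf h (drop i w))"
      unfolding convolution_def[of "tprod s r f g"] 1 convolution_def n_def sum_distrib_right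
      by (intro sum.cong refl) (auto simp: min_def)
    also have "\<dots> = (\<Sum>(i, j)\<in>Sigma {..n} (\<lambda>i. {..i}). cf f (take j w) * cf g (drop j (take i w)) * cf h (drop i w))"
      by (rule sum.Sigma) auto
    also have "\<dots> = (\<Sum>(j, k)\<in>Sigma {..n} (\<lambda>j. {..n - j}). cf f (take j w) * cf g (take k (drop j w)) * cf h (drop (j + k) w))"
      by (rule sum.reindex_bij_witness[where i = "\<lambda>(j, k). (j + k, j)" and j = "\<lambda>(i, j). (j, i - j)"])
         (auto simp: drop_take add.commute)
    also have "\<dots> = (\<Sum>j\<le>n. \<Sum>k\<le>n - j. cf f (take j w) * cf g (take k (drop j w)) * cf h (drop (j + k) w))"
      by (rule sum.Sigma[symmetric]) auto
    also have "\<dots> = convolution f (tprod s r g h) w"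
      unfolding convolution_def[of f] 2 convolution_def n_def sum_distrib_left
      by (intro sum.cong refl) (auto simp: add.commute mult.assoc)
    finally show ?thesis using True by (simp add: cf_tprod)
  qed (simp add: cf_tprod)
qed

text \<open>A commutator satisfies the Jacobi identity because the truncated product is associative.\<close>

lemma lie_algebra_talg: "lie_algebra_on (talg s r) (tcomm s r)"
proof -
  have "tcomm s r x (tcomm s r y z) + tcomm s r y (tcomm s r z x) + tcomm s r z (tcomm s r x y) = 0"
    if "x \<in> talg s r" "y \<in> talg s r" "z \<in> talg s r" for x y z
    unfolding tcomm_def tprod_linear using that by (simp add: tprod_assoc)
  then show ?thesis
    unfolding lie_algebra_on_def
    by (auto simp: talg_subspace tcomm_talg) (simp_all add: tcomm_def tprod_linear algebra_simps)
qed

lemma nilpotent_talg: "nilpotent_of_step_le s (talg s r) (tcomm s r)"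
proof -
  define T where "T k = {f \<in> talg s r. \<forall>w. cf f w \<noteq> 0 \<longrightarrow> k < length w}" for k
  have T: "subspace (T k)" for k by (force simp: T_def subspace_def talg_def)
  have conv0: "convolution f g w = 0" if "f \<in> T 0" "g \<in> T k" "length w \<le> Suc k" for f g w k
    unfolding convolution_def
  proof (intro sum.neutral ballI)
    fix i assume "i \<in> {..length w}"
    then show "cf f (take i w) * cf g (drop i w) = 0"
      using that by (cases "i = 0") (force simp: T_def)+
  qed
  have conv0': "convolution g f w = 0" if "f \<in> T 0" "g \<in> T k" "length w \<le> Suc k" for f g w k
    unfolding convolution_def
  proof (intro sum.neutral ballI)
    fix i assume "i \<in> {..length w}"
    then show "cf g (take i w) * cf f (drop i w) = 0"
      using that by (cases "i = length w") (force simp: T_def)+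
  qed
  have T0: "talg s r = T 0" by (auto simp: T_def talg_def admissible_def)
  have "lower_central (talg s r) (tcomm s r) k \<subseteq> T k" for k
  proof (induction k)
    case (Suc k)
    have "tcomm s r x y \<in> T (Suc k)" if "x \<in> talg s r" "y \<in> T k" for x y
      using conv0[of x y k] conv0'[of x y k] that tcomm_talg[of s r x y]
      by (auto simp: T_def[of "Suc k"] T0[symmetric] tcomm_def cf_tprod) (metis not_less)
    then have "{tcomm s r x y | x y. x \<in> talg s r \<and> y \<in> lower_central (talg s r) (tcomm s r) k} \<subseteq> T (Suc k)"
      using Suc by blast
    then show ?case unfolding lower_central.simps bracket_space_def by (rule span_minimal[OF _ T])
  qed (simp add: T0)
  moreover have "T s \<subseteq> {0}"
  proof
    fix f assume "f \<in> T s"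
    then have "cf f w = 0" for w by (auto simp: T_def talg_def admissible_def) (metis not_less)
    then show "f \<in> {0}" using cf_ext[of f 0] by simp
  qed
  moreover have "0 \<in> lower_central (talg s r) (tcomm s r) s"
    by (cases s) (auto simp: bracket_space_def span_zero subspace_0[OF talg_subspace])
  ultimately show ?thesis unfolding nilpotent_of_step_le_def by blast
qed

text \<open>\<open>w\<close> is the lexicographically least word of the homogeneous element \<open>f\<close>, with coefficient 1.\<close>

definition leading :: "nat \<Rightarrow> nat \<Rightarrow> ambient \<Rightarrow> nat list \<Rightarrow> bool" where
  "leading s r f w \<longleftrightarrow> f \<in> talg s r \<and> cf f w = 1 \<and> (\<forall>w'. cf f w' \<noteq> 0 \<longrightarrow> length w' = length w \<and> w \<le> w')"

lemma leadingD: "leading s r f w \<Longrightarrow> cf f w' \<noteq> 0 \<Longrightarrow> length w' = length w \<and> w \<le> w'"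
  unfolding leading_def by blast

lemma leading_coeff: "leading s r f w \<Longrightarrow> cf f w = 1"
  unfolding leading_def by blast

lemma append_le_append:
  fixes u v :: "nat list"
  assumes "length u = length u'" shows "u @ v \<le> u' @ v' \<longleftrightarrow> u < u' \<or> (u = u' \<and> v \<le> v')"
  using assms by (induction u u' rule: list_induct2) auto

text \<open>In \<open>f g - g f\<close> the first product has least word \<open>u @ v\<close> and the second one \<open>v @ u\<close>, which is larger.\<close>

lemma leading_tcomm:
  assumes f: "leading s r f u" and g: "leading s r g v" and less: "u @ v < v @ u" and len: "length (u @ v) \<le> s"
  shows "leading s r (tcomm s r f g) (u @ v)"
proof -
  have gen: "length w = length u + length v \<and> u @ v \<le> w" if f: "leading s r f u" and g: "leading s r g v" and nz: "convolution f g w \<noteq> 0" for f g u v w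
  proof -
    obtain i where i: "i \<le> length w" "cf f (take i w) \<noteq> 0" "cf g (drop i w) \<noteq> 0"
      using nz unfolding convolution_def by (metis (mono_tags, lifting) atMost_iff mult_eq_0_iff sum.neutral)
    have t: "length (take i w) = length u" "u \<le> take i w" and d: "length (drop i w) = length v" "v \<le> drop i w"
      using leadingD[OF f i(2)] leadingD[OF g i(3)] by blast+
    have "u @ v \<le> take i w @ drop i w"
      using t d append_le_append[OF t(1)[symmetric], of v "drop i w"] by (simp only: le_less) blast
    moreover have "length w = length (take i w) + length (drop i w)" using i(1) by simp
    ultimately show ?thesis unfolding t(1) d(1) by simp
  qed
  have 1: "convolution f g (u @ v) = 1"
  proof -
    have "convolution f g (u @ v) = (\<Sum>i\<in>{length u}. cf f (take i (u @ v)) * cf g (drop i (u @ v)))"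
      unfolding convolution_def
    proof (rule sum.mono_neutral_right)
      show "\<forall>i\<in>{..length (u @ v)} - {length u}. cf f (take i (u @ v)) * cf g (drop i (u @ v)) = 0"
      proof
        fix i assume i: "i \<in> {..length (u @ v)} - {length u}"
        then have "length (take i (u @ v)) \<noteq> length u" by (simp only: length_take) auto
        then have "cf f (take i (u @ v)) = 0" using leadingD[OF f] by blast
        then show "cf f (take i (u @ v)) * cf g (drop i (u @ v)) = 0" by simp
      qed
    qed auto
    then show ?thesis using f g by (simp add: leading_def)
  qed
  have 2: "convolution g f (u @ v) = 0" using gen[OF g f, of "u @ v"] less leD by blast
  have "admissible s r u" "admissible s r v" using f g by (auto simp: leading_def talg_def)
  then have "admissible s r (u @ v)" using len by (auto simp: admissible_def)
  then have "cf (tcomm s r f g) (u @ v) = 1" using 1 2 by (simp add: tcomm_def cf_tprod)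
  moreover have "length w = length (u @ v) \<and> u @ v \<le> w" if "cf (tcomm s r f g) w \<noteq> 0" for w
  proof -
    have "convolution f g w \<noteq> 0 \<or> convolution g f w \<noteq> 0" using that by (auto simp: tcomm_def cf_tprod split: if_splits)
    then show ?thesis
    proof
      assume "convolution f g w \<noteq> 0"
      from gen[OF f g this] show ?thesis by simp
    next
      assume "convolution g f w \<noteq> 0"
      from gen[OF g f this] show ?thesis using less by (auto intro: less_imp_le less_le_trans)
    qed
  qed
  ultimately show ?thesis by (simp add: leading_def tcomm_talg)
qed

text \<open>Words that are leading words of iterated brackets of the letters by \<open>leading_tcomm\<close>. All Lyndon words
are of this kind.\<close>

inductive bracket_word :: "nat \<Rightarrow> nat list \<Rightarrow> bool" for r where
  letter: "i < r \<Longrightarrow> bracket_word r [i]"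
| join: "bracket_word r u \<Longrightarrow> bracket_word r v \<Longrightarrow> u @ v < v @ u \<Longrightarrow> bracket_word r (u @ v)"

lemma bracket_word_block: "0 < c \<Longrightarrow> c < r \<Longrightarrow> bracket_word r (replicate j 0 @ [c])"
proof (induction j)
  case 0
  then show ?case using letter by simp
next
  case (Suc j)
  have less: "0 # replicate j 0 @ [c] < replicate j 0 @ [c, 0]"
    using Suc.prems by (induction j) auto
  have "bracket_word r ([0] @ (replicate j 0 @ [c]))"
  proof (rule join[OF letter])
    show "bracket_word r (replicate j 0 @ [c])" using Suc by simp
  qed (use Suc less in auto)
  then show ?case by simp
qed

lemma zero_run_less:
  "j < k \<Longrightarrow> 0 < (c :: nat) \<Longrightarrow> (replicate k 0 @ u) @ v < (replicate j 0 @ [c]) @ w"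
proof (induction j arbitrary: k)
  case 0
  then show ?case by (cases k) auto
next
  case (Suc j)
  then show ?case by (cases k) auto
qed

text \<open>A run of \<open>k\<close> zeros at the beginning is a marker that makes the word smaller than every block
\<open>0\<^sup>j c\<close> with \<open>j < k\<close> and \<open>c > 0\<close>, so such blocks may be appended one after the other. A word of length
at most \<open>k\<close> that does not end in \<open>0\<close> is a product of such blocks.\<close>

lemma bracket_word_extend:
  assumes "length x \<le> k" "x \<noteq> []" "last x \<noteq> 0" "set x \<subseteq> {..<r}" "bracket_word r (replicate k 0 @ u)"
  shows "bracket_word r ((replicate k 0 @ u) @ x)"
  using assms
proof (induction "length x" arbitrary: x u rule: less_induct)
  case less
  define j where "j = length (takeWhile (\<lambda>a. a = 0) x)"
  have j: "takeWhile (\<lambda>a. a = 0) x = replicate j 0"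
    unfolding j_def by (rule replicate_eqI) (auto dest: set_takeWhileD)
  have "dropWhile (\<lambda>a. a = 0) x \<noteq> []"
  proof
    assume "dropWhile (\<lambda>a. a = 0) x = []"
    then have "\<forall>a\<in>set x. a = 0" by (simp only: dropWhile_eq_Nil_conv)
    from bspec[OF this last_in_set[OF less.prems(2)]] show False using less.prems(3) by simp
  qed
  then obtain c x' where c: "dropWhile (\<lambda>a. a = 0) x = c # x'" by (cases "dropWhile (\<lambda>a. a = 0) x") auto
  have x: "x = replicate j 0 @ c # x'" using takeWhile_dropWhile_id[of "\<lambda>a. a = 0" x] j c by simp
  have c0: "c \<noteq> 0" using c hd_dropWhile[of "\<lambda>a. a = 0" x] by auto
  have cr: "c < r" using less.prems x by auto
  have jk: "j < k" using less.prems(1) x by simp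
  have bw: "bracket_word r ((replicate k 0 @ u) @ (replicate j 0 @ [c]))"
    using c0 cr jk zero_run_less[of j k c u "replicate j 0 @ [c]" "replicate k 0 @ u"]
    by (intro join[OF less.prems(5) bracket_word_block]) auto
  show ?case
  proof (cases "x' = []")
    case True
    then show ?thesis using bw x by simp
  next
    case False
    have "bracket_word r ((replicate k 0 @ (u @ replicate j 0 @ [c])) @ x')"
      using False less.prems x bw by (intro less.hyps) auto
    then show ?thesis using x by simp
  qed
qed

definition tail_words :: "nat \<Rightarrow> nat \<Rightarrow> nat list set" where
  "tail_words r k = (\<lambda>(y, c). y @ [c]) ` ({y. set y \<subseteq> {..<r} \<and> length y = k - 1} \<times> {1..<r})"

lemma card_tail_words: "card (tail_words r k) = r ^ (k - 1) * (r - 1)"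
  unfolding tail_words_def
  by (subst card_image) (auto simp: inj_on_def card_cartesian_product card_lists_length_eq)

text \<open>All words of length \<open>k + 1 + k * q\<close> that start with the marker \<open>0\<^sup>k 1\<close> and continue with \<open>q\<close> words of
length \<open>k\<close> not ending in \<open>0\<close>. For large \<open>k\<close> their number has a growth rate close to \<open>r\<close>.\<close>

definition rich_words :: "nat \<Rightarrow> nat \<Rightarrow> nat \<Rightarrow> nat list set" where
  "rich_words r k q = (\<lambda>xs. replicate k 0 @ [1] @ concat xs) ` {xs. set xs \<subseteq> tail_words r k \<and> length xs = q}"

lemma concat_inj_length:
  assumes "length xs = length ys" "\<And>x. x \<in> set xs \<union> set ys \<Longrightarrow> length x = k" "concat xs = concat ys"
  shows "xs = ys"
  using assms by (induction xs ys rule: list_induct2) auto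

lemma finite_tail_words: "finite (tail_words r k)"
  unfolding tail_words_def by (intro finite_imageI finite_cartesian_product finite_lists_length_eq) auto

lemma tail_words_props:
  "1 \<le> k \<Longrightarrow> x \<in> tail_words r k \<Longrightarrow> length x = k \<and> x \<noteq> [] \<and> last x \<noteq> 0 \<and> set x \<subseteq> {..<r}"
  unfolding tail_words_def by auto

lemma rich_words:
  assumes k: "1 \<le> k" and r: "2 \<le> r"
  shows "finite (rich_words r k q)" "card (rich_words r k q) = (r ^ (k - 1) * (r - 1)) ^ q"
    "w \<in> rich_words r k q \<Longrightarrow> bracket_word r w \<and> length w = k + 1 + k * q"
proof -
  define X where "X = {xs. set xs \<subseteq> tail_words r k \<and> length xs = q}"
  have fin: "finite X" unfolding X_def by (rule finite_lists_length_eq[OF finite_tail_words])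
  then show "finite (rich_words r k q)" by (simp add: rich_words_def X_def)
  have "inj_on (\<lambda>xs. replicate k 0 @ [1] @ concat xs) X"
  proof (rule inj_onI)
    fix xs ys assume "xs \<in> X" "ys \<in> X" "replicate k 0 @ [1] @ concat xs = replicate k 0 @ [1] @ concat ys"
    then show "xs = ys"
      using tail_words_props[OF k] by (intro concat_inj_length[of xs ys k]) (auto simp: X_def)
  qed
  then show "card (rich_words r k q) = (r ^ (k - 1) * (r - 1)) ^ q"
    by (simp add: rich_words_def X_def[symmetric] card_image)
       (simp add: X_def card_lists_length_eq finite_tail_words card_tail_words)
  have "bracket_word r (replicate k 0 @ [1] @ concat xs) \<and> length (concat xs) = k * length xs"
    if "set xs \<subseteq> tail_words r k" for xs
    using that
  proof (induction xs rule: rev_induct)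
    case Nil
    then show ?case using bracket_word_block[of 1 r k] r by simp
  next
    case (snoc x xs)
    then show ?case
      using bracket_word_extend[of x k r "[1] @ concat xs"] tail_words_props[OF k, of x r] by simp
  qed
  then show "w \<in> rich_words r k q \<Longrightarrow> bracket_word r w \<and> length w = k + 1 + k * q"
    by (auto simp: rich_words_def)
qed

text \<open>In a vanishing linear combination, the least word whose coefficient is not zero cannot be cancelled.\<close>

lemma leading_independent:
  fixes x :: "nat list \<Rightarrow> ambient"
  assumes W: "finite W" and \<phi>: "linear \<phi>" and lead: "\<And>w. w \<in> W \<Longrightarrow> leading s r (\<phi> (x w)) w"
  shows "inj_on x W" "independent (x ` W)"
proof -
  show inj: "inj_on x W"
  proof (rule inj_onI)
    fix w w' assume "w \<in> W" "w' \<in> W" "x w = x w'"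
    then have "leading s r (\<phi> (x w)) w" "leading s r (\<phi> (x w)) w'"
      using lead[of w] lead[of w'] by simp_all
    note lw = this
    have "cf (\<phi> (x w)) w \<noteq> 0" "cf (\<phi> (x w)) w' \<noteq> 0"
      using leading_coeff[OF lw(1)] leading_coeff[OF lw(2)] by simp_all
    then have "w \<le> w'" "w' \<le> w" using leadingD[OF lw(1)] leadingD[OF lw(2)] by blast+
    then show "w = w'" by (rule antisym)
  qed
  show "independent (x ` W)"
  proof (rule independent_if_scalars_zero)
    show "finite (x ` W)" using W by simp
    fix f y assume 0: "(\<Sum>y\<in>x ` W. f y *\<^sub>R y) = 0" and "y \<in> x ` W"
    then obtain w where w: "w \<in> W" "y = x w" by auto
    show "f y = 0"
    proof (rule ccontr)
      assume "f y \<noteq> 0"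
      \<comment> \<open>The least word that occurs.\<close>
      define Z where "Z = {w \<in> W. f (x w) \<noteq> 0}"
      define m where "m = Min Z"
      have Z: "finite Z" "Z \<noteq> {}" using W w \<open>f y \<noteq> 0\<close> by (auto simp: Z_def)
      have m: "m \<in> W" "f (x m) \<noteq> 0" using Min_in[OF Z] by (auto simp: m_def Z_def)
      have "0 = cf (\<phi> (\<Sum>w\<in>W. f (x w) *\<^sub>R x w)) m"
        using 0 linear_0[OF \<phi>] by (simp add: sum.reindex[OF inj])
      also have "\<dots> = (\<Sum>w\<in>W. f (x w) * cf (\<phi> (x w)) m)"
        by (simp add: linear_sum[OF \<phi>] linear_scale[OF \<phi>] cf_sum)
      also have "\<dots> = (\<Sum>w\<in>{m}. f (x w) * cf (\<phi> (x w)) m)"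
      proof (rule sum.mono_neutral_right[OF W])
        show "\<forall>w\<in>W - {m}. f (x w) * cf (\<phi> (x w)) m = 0"
        proof
          fix w assume w: "w \<in> W - {m}"
          show "f (x w) * cf (\<phi> (x w)) m = 0"
          proof (rule ccontr)
            assume nz: "f (x w) * cf (\<phi> (x w)) m \<noteq> 0"
            then have "w \<in> Z" using w by (auto simp: Z_def)
            then have "m \<le> w" using Z by (simp add: m_def)
            moreover have "w \<le> m" using nz w leadingD[OF lead[of w], of m] by simp
            ultimately show False using w by simp
          qed
        qed
      qed (use m in auto)
      also have "\<dots> = f (x m)" using leading_coeff[OF lead[OF m(1)]] by simp
      finally show False using m by simp
    qed
  qed
qed

text \<open>The universal property maps the algebra to the truncated free associative algebra, where the
brackets of the generators that belong to the rich words have distinct leading words.\<close>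

theorem free_nilpotent_large_dimension:
  fixes V :: "ambient set"
  assumes free: "free_nilpotent_on s B V br" and B: "finite B" "card B = r"
    and k: "1 \<le> k" and r: "2 \<le> r" and s: "s = k + 1 + k * q"
  shows "\<exists>E\<subseteq>V. finite E \<and> independent E \<and> card E = (r ^ (k - 1) * (r - 1)) ^ q"
proof -
  have V: "lie_algebra_on V br" "B \<subseteq> V" using free by (auto simp: free_nilpotent_on_def)
  define e where "e i = of_cf (\<lambda>w. if w = [i] then 1 else 0)" for i :: nat
  have cf_e: "cf (e i) w = (if w = [i] then 1 else 0)" for i w
    unfolding e_def by (rule cf_of_cf) simp
  have lead_e: "leading s r (e i) [i]" if "i < r" for i
    using that s by (auto simp: leading_def talg_def cf_e admissible_def)
  obtain b where b: "bij_betw b {0..<r} B" using ex_bij_betw_nat_finite[OF B(1)] B(2) by auto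
  define f where "f y = e (inv_into {0..<r} b y)" for y
  have fb: "f (b i) = e i" if "i < r" for i
    using b that by (simp add: f_def bij_betw_def inv_into_f_f)
  have bB: "b i \<in> B" if "i < r" for i using b that by (auto simp: bij_betw_def)
  have "f ` B \<subseteq> talg s r"
  proof
    fix y assume "y \<in> f ` B"
    then obtain i where "i < r" "y = f (b i)" using b by (auto simp: bij_betw_def)
    then show "y \<in> talg s r" using fb lead_e by (simp add: leading_def)
  qed
  then obtain \<phi> where \<phi>: "lie_hom_on V br (talg s r) (tcomm s r) \<phi>" "\<And>y. y \<in> B \<Longrightarrow> \<phi> y = f y"
    using free lie_algebra_talg nilpotent_talg unfolding free_nilpotent_on_def by metis
  have hom: "\<phi> (br x y) = tcomm s r (\<phi> x) (\<phi> y)" if "x \<in> V" "y \<in> V" for x y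
    using \<phi>(1) that by (simp add: lie_hom_on_def)
  have brV: "br x y \<in> V" if "x \<in> V" "y \<in> V" for x y
    using V(1) that by (simp add: lie_algebra_on_def)
  have real: "\<exists>x\<in>V. leading s r (\<phi> x) w" if "bracket_word r w" "length w \<le> s" for w
    using that
  proof (induction rule: bracket_word.induct)
    case (letter i)
    then show ?case using lead_e fb bB \<phi>(2) V(2) by (intro bexI[of _ "b i"]) auto
  next
    case (join u v)
    then obtain x y where "x \<in> V" "y \<in> V" "leading s r (\<phi> x) u" "leading s r (\<phi> y) v" by auto
    then show ?case using join leading_tcomm hom brV by (intro bexI[of _ "br x y"]) auto
  qed
  define W where "W = rich_words r k q"
  have W: "finite W" "card W = (r ^ (k - 1) * (r - 1)) ^ q"
    "\<And>w. w \<in> W \<Longrightarrow> bracket_word r w \<and> length w = s"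
    using rich_words(1,2)[OF k r, of q] rich_words(3)[OF k r, of _ q] s by (auto simp: W_def)
  have "\<forall>w\<in>W. \<exists>x. x \<in> V \<and> leading s r (\<phi> x) w" using real W(3) by fastforce
  from bchoice[OF this] obtain x where x: "\<And>w. w \<in> W \<Longrightarrow> x w \<in> V" "\<And>w. w \<in> W \<Longrightarrow> leading s r (\<phi> (x w)) w"
    by blast
  have "linear \<phi>" using \<phi>(1) by (simp add: lie_hom_on_def)
  from leading_independent[OF W(1) this x(2)]
  show ?thesis using x(1) W by (intro exI[of _ "x ` W"]) (auto simp: card_image)
qed

section \<open>The choice of the step, and integration of Lie algebra homomorphisms\<close>

lemma exponential_beats_polynomial:
  fixes K :: real assumes "0 \<le> K" shows "\<exists>q::nat. K * (1 + real q) < 2 ^ q"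
proof -
  obtain m where m: "2 * K < 2 ^ m" using real_arch_pow[of 2 "2 * K"] by auto
  have "K * (1 + real (2 * m)) \<le> 2 * K * (1 + real m)" using assms by (simp add: algebra_simps)
  also have "\<dots> \<le> 2 * K * 2 ^ m"
  proof -
    have "1 + real m \<le> 2 ^ m" by (induction m) auto
    then show ?thesis using assms by (intro mult_left_mono) auto
  qed
  also have "\<dots> < 2 ^ m * 2 ^ m" using m by simp
  also have "\<dots> = 2 ^ (2 * m)" by (simp only: mult_2 power_add)
  finally show ?thesis by blast
qed

text \<open>With \<open>\<rho>\<close> the rate of \<open>growth_bound\<close>, \<open>k\<close> is chosen such that \<open>4 \<rho>\<^sup>k < r\<^sup>k\<close>. A block of length \<open>k\<close> then
contributes a factor of at least \<open>2 \<rho>\<^sup>k\<close> to the right-hand side, and the powers of 2 outgrow the linear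
factor \<open>s + 1\<close>.\<close>

lemma large_step_exists:
  fixes r d :: nat assumes r: "2 \<le> r"
  defines "\<rho> \<equiv> real r - 1 / (real r * real (r + 1) ^ d)"
  shows "\<exists>k q. 1 \<le> k \<and> (\<forall>s. s = k + 1 + k * q \<longrightarrow>
    real r * (real (r + 1) ^ d * real (s + 1) * \<rho> ^ s) < real ((r ^ (k - 1) * (r - 1)) ^ q))"
proof -
  define c where "c = real r * real (r + 1) ^ d"
  have c1: "1 \<le> c" unfolding c_def using r by (intro mult_ge1_I one_le_power) auto
  have \<rho>: "\<rho> = real r - 1 / c" by (simp add: \<rho>_def c_def)
  have "1 / c \<le> 1" "0 < 1 / c" using c1 by (simp_all add: divide_le_eq_1)
  moreover have "2 \<le> real r" using r by simp
  ultimately have \<rho>r: "\<rho> < real r" and \<rho>1: "1 \<le> \<rho>" unfolding \<rho> by linarith+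
  have "1 < real r / \<rho>" using \<rho>r \<rho>1 by (simp add: less_divide_eq_1)
  then obtain k where k: "4 < (real r / \<rho>) ^ k" using real_arch_pow by blast
  then have k1: "1 \<le> k" by (cases k) auto
  have k4: "4 * \<rho> ^ k < real r ^ k" using k \<rho>1 by (simp add: power_divide field_simps)
  have low: "2 * \<rho> ^ k \<le> real (r ^ (k - 1) * (r - 1))"
  proof -
    have "real r ^ k = real r * real r ^ (k - 1)" using k1 by (metis One_nat_def Suc_le_eq power_eq_if not_less_zero)
    also have "\<dots> \<le> (2 * real (r - 1)) * real r ^ (k - 1)" using r by (intro mult_right_mono) auto
    finally show ?thesis using k4 by (simp add: mult_ac)
  qed
  obtain q where q: "c * \<rho> ^ (k + 1) * real (k + 2) * (1 + real q) < 2 ^ q"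
    using exponential_beats_polynomial[of "c * \<rho> ^ (k + 1) * real (k + 2)"] c1 \<rho>1 by auto
  have "c * (real (s + 1) * \<rho> ^ s) < real ((r ^ (k - 1) * (r - 1)) ^ q)" if s: "s = k + 1 + k * q" for s
  proof -
    have "real (s + 1) \<le> real (k + 2) * (1 + real q)" unfolding s by (simp add: algebra_simps)
    then have "c * (real (s + 1) * \<rho> ^ s) \<le> c * ((real (k + 2) * (1 + real q)) * \<rho> ^ s)"
      using c1 \<rho>1 by (intro mult_left_mono mult_right_mono) auto
    also have "\<dots> = (c * \<rho> ^ (k + 1) * real (k + 2) * (1 + real q)) * (\<rho> ^ k) ^ q"
      unfolding s by (simp add: power_add power_mult mult_ac)
    also have "\<dots> < 2 ^ q * (\<rho> ^ k) ^ q" using q \<rho>1 by (intro mult_strict_right_mono) auto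
    also have "\<dots> = (2 * \<rho> ^ k) ^ q" by (simp add: power_mult_distrib)
    also have "\<dots> \<le> real (r ^ (k - 1) * (r - 1)) ^ q" using low \<rho>1 by (intro power_mono) auto
    finally show ?thesis by simp
  qed
  then show ?thesis using k1 unfolding c_def by (intro exI[of _ k] exI[of _ q]) (simp add: mult.assoc)
qed

lemma C1_absolutely_continuous:
  fixes \<gamma> :: "real \<Rightarrow> 'a::real_normed_vector"
  assumes d: "\<And>t. t \<in> {a..b} \<Longrightarrow> (\<gamma> has_vector_derivative \<gamma>' t) (at t)" and c: "continuous_on {a..b} \<gamma>'"
  shows "absolutely_continuous_on_interval a b \<gamma>"
proof -
  have "bounded (\<gamma>' ` {a..b})" using c by (intro compact_imp_bounded compact_continuous_image) auto
  then obtain M where M: "0 < M" "\<And>t. t \<in> {a..b} \<Longrightarrow> norm (\<gamma>' t) \<le> M" unfolding bounded_pos by auto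
  have lip: "norm (\<gamma> y - \<gamma> x) \<le> M * (y - x)" if "a \<le> x" "x \<le> y" "y \<le> b" for x y
  proof -
    have "norm (\<gamma> y - \<gamma> x) \<le> M * norm (y - x)"
    proof (rule differentiable_bound[of "{a..b}" \<gamma> "\<lambda>t h. h *\<^sub>R \<gamma>' t"])
      show "(\<gamma> has_derivative (\<lambda>h. h *\<^sub>R \<gamma>' t)) (at t within {a..b})" if "t \<in> {a..b}" for t
        using d[OF that] unfolding has_vector_derivative_def by (rule has_derivative_at_withinI)
      show "onorm (\<lambda>h. h *\<^sub>R \<gamma>' t) \<le> M" if "t \<in> {a..b}" for t
      proof (rule onorm_le)
        fix h :: real
        show "norm (h *\<^sub>R \<gamma>' t) \<le> M * norm h"
          using mult_left_mono[OF M(2)[OF that], of "\<bar>h\<bar>"] by (simp add: mult_ac)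
      qed
    qed (use that in auto)
    then show ?thesis using that by simp
  qed
  show ?thesis
    unfolding absolutely_continuous_on_interval_def
  proof (intro allI impI)
    fix \<epsilon> :: real assume \<epsilon>: "\<epsilon> > 0"
    show "\<exists>\<delta>>0. \<forall>(n::nat) l u.
        (\<forall>i<n. a \<le> l i \<and> l i \<le> u i \<and> u i \<le> b) \<and>
        (\<forall>i<n. \<forall>j<n. i \<noteq> j \<longrightarrow> {l i<..<u i} \<inter> {l j<..<u j} = {}) \<and>
        (\<Sum>i<n. u i - l i) < \<delta> \<longrightarrow> (\<Sum>i<n. norm (\<gamma> (u i) - \<gamma> (l i))) < \<epsilon>"
    proof (intro exI[of _ "\<epsilon> / M"] conjI allI impI)
      fix n :: nat and l u :: "nat \<Rightarrow> real"
      assume A: "(\<forall>i<n. a \<le> l i \<and> l i \<le> u i \<and> u i \<le> b) \<and>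
        (\<forall>i<n. \<forall>j<n. i \<noteq> j \<longrightarrow> {l i<..<u i} \<inter> {l j<..<u j} = {}) \<and>
        (\<Sum>i<n. u i - l i) < \<epsilon> / M"
      have "(\<Sum>i<n. norm (\<gamma> (u i) - \<gamma> (l i))) \<le> (\<Sum>i<n. M * (u i - l i))"
        using A lip by (intro sum_mono) auto
      also have "\<dots> = M * (\<Sum>i<n. u i - l i)" by (simp add: sum_distrib_left)
      also have "\<dots> < \<epsilon>" using A M(1) by (simp add: field_simps)
      finally show "(\<Sum>i<n. norm (\<gamma> (u i) - \<gamma> (l i))) < \<epsilon>" .
    qed (use \<epsilon> M in auto)
  qed
qed

text \<open>A horizontal curve has a horizontal velocity almost everywhere only; continuity gives it everywhere.\<close>

lemma continuous_AE_zero: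
  fixes f :: "real \<Rightarrow> real"
  assumes I: "open I" and f: "continuous_on I f" and ae: "AE t in lebesgue. t \<in> I \<longrightarrow> f t = 0" and t: "t \<in> I"
  shows "f t = 0"
proof (rule ccontr)
  assume "f t \<noteq> 0"
  define S where "S = {t \<in> I. f t \<noteq> 0}"
  have "S = I \<inter> f -` (- {0})" by (auto simp: S_def)
  moreover have "open (- {0 :: real})" by (rule open_Compl) simp
  ultimately have "open S" using continuous_open_preimage[OF f I, of "- {0}"] by simp
  moreover have "S \<noteq> {}" using t \<open>f t \<noteq> 0\<close> by (auto simp: S_def)
  moreover have "negligible S"
  proof -
    obtain N where N: "{t \<in> space lebesgue. \<not> (t \<in> I \<longrightarrow> f t = 0)} \<subseteq> N" "N \<in> null_sets lebesgue"
      using ae by (auto elim: AE_E simp: null_sets_def)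
    have "negligible N" using N(2) by (simp add: negligible_iff_null_sets)
    then show ?thesis by (rule negligible_subset) (use N(1) in \<open>auto simp: S_def\<close>)
  qed
  ultimately show False using open_not_negligible by blast
qed

lemma Ck_on_const: "Ck_on k V (\<lambda>_. c)"
  by (induction k arbitrary: c) (auto intro!: exI[of _ "\<lambda>_. 0"])

lemma smooth_on_linear:
  assumes "linear \<phi>" "continuous_on V \<phi>" shows "smooth_on V \<phi>"
  unfolding smooth_on_def
proof
  fix k show "Ck_on k V \<phi>"
  proof (cases k)
    case (Suc j)
    have d: "((\<lambda>t. \<phi> (x + t *\<^sub>R v)) has_vector_derivative \<phi> v) (at 0)" for x v
      by (auto intro!: derivative_eq_intros simp: linear_add[OF assms(1)] linear_scale[OF assms(1)])
    show ?thesis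
      unfolding Suc Ck_on.simps
    proof (intro conjI ballI)
      fix v
      show "\<exists>f'. (\<forall>x\<in>V. ((\<lambda>t. \<phi> (x + t *\<^sub>R v)) has_vector_derivative f' x) (at 0)) \<and> Ck_on j V f'"
        using d Ck_on_const by (intro exI[of _ "\<lambda>_. \<phi> v"]) simp
    qed (rule assms(2))
  qed (use assms in simp)
qed

text \<open>A Lie algebra homomorphism intertwines the series for \<open>\<Theta>\<close>, hence the differentials of left
translations.\<close>

lemma lie_hom_curve:
  fixes F G :: "ambient carnot"
  assumes F: "carnot F" and G: "carnot G"
    and hom: "lie_hom_on (carrier F) (bracket F) (carrier G) (bracket G) \<phi>"
    and c: "(c has_vector_derivative carnot.L F (c t) u) (at t)" "c t \<in> carrier F" "u \<in> carrier F"
    and I: "open I" "t \<in> I" "\<And>s. s \<in> I \<Longrightarrow> c s \<in> carrier F"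
  shows "((\<lambda>t. \<phi> (c t)) has_vector_derivative carnot.L G (\<phi> (c t)) (\<phi> u)) (at t)"
proof -
  interpret F: carnot F by (rule F)
  interpret G: carnot G by (rule G)
  have lin: "linear \<phi>" and im: "\<And>x. x \<in> F.V \<Longrightarrow> \<phi> x \<in> G.V"
    and br: "\<And>x y. x \<in> F.V \<Longrightarrow> y \<in> F.V \<Longrightarrow> \<phi> (F.D x y) = G.D (\<phi> x) (\<phi> y)"
    using hom F.bracket_eq_D G.bracket_eq_D unfolding lie_hom_on_def by (auto simp: image_subset_iff)
  have pow: "\<phi> ((F.D x ^^ k) v) = (G.D (\<phi> x) ^^ k) (\<phi> v)" if "x \<in> F.V" "v \<in> F.V" for x v k
    by (induction k) (use that br F.Dpow_V in auto)
  have \<Theta>: "\<phi> (F.\<Theta> x v) = G.\<Theta> (\<phi> x) (\<phi> v)" if x: "x \<in> F.V" and v: "v \<in> F.V" for x v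
  proof -
    \<comment> \<open>A common length for both series.\<close>
    define K where "K = step F + step G"
    have 1: "(F.D x ^^ K) v = 0" by (rule F.Dpow_eq_0[OF F.lc_step x v]) (simp add: K_def)
    have 2: "(G.D (\<phi> x) ^^ K) (\<phi> v) = 0"
      by (rule G.Dpow_eq_0[OF G.lc_step im[OF x] im[OF v]]) (simp add: K_def)
    show ?thesis
      unfolding F.\<Theta>_formula[OF x v 1] G.\<Theta>_formula[OF im[OF x] im[OF v] 2]
      using pow[OF x v] by (simp add: linear_sum[OF lin] linear_scale[OF lin] del: fact_Suc)
  qed
  have L: "\<phi> (F.L (c t) u) = G.L (\<phi> (c t)) (\<phi> u)"
  proof -
    have "G.\<Theta> (\<phi> (c t)) (\<phi> (F.L (c t) u)) = \<phi> u" using c \<Theta>[of "c t" "F.L (c t) u"] by simp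
    then have "G.L (\<phi> (c t)) (\<phi> u) = G.L (\<phi> (c t)) (G.\<Theta> (\<phi> (c t)) (\<phi> (F.L (c t) u)))" by simp
    then show ?thesis using im[of "F.L (c t) u"] by simp
  qed
  have "bounded_linear (\<lambda>x. \<phi> (F.pr x))"
    by (rule F.bounded_linear_on_V) (simp_all add: linear_add[OF lin] linear_scale[OF lin])
  from bounded_linear.has_vector_derivative[OF this c(1)]
  have "((\<lambda>t. \<phi> (F.pr (c t))) has_vector_derivative G.L (\<phi> (c t)) (\<phi> u)) (at t)" using L by simp
  then show ?thesis
    by (rule has_vector_derivative_transform_within_open[OF _ I(1,2)]) (use I(3) in simp)
qed

text \<open>Both sides, with \<open>t y\<close> in place of \<open>y\<close>, solve the same left-invariant equation.\<close>

lemma lie_hom_group_hom: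
  fixes F G :: "ambient carnot"
  assumes F: "carnot F" and G: "carnot G"
    and hom: "lie_hom_on (carrier F) (bracket F) (carrier G) (bracket G) \<phi>"
    and x: "x \<in> carrier F" and y: "y \<in> carrier F"
  shows "\<phi> (x \<otimes>\<^bsub>F\<^esub> y) = \<phi> x \<otimes>\<^bsub>G\<^esub> \<phi> y"
proof -
  interpret F: carnot F by (rule F)
  interpret G: carnot G by (rule G)
  have lin: "linear \<phi>" and im: "\<And>x. x \<in> F.V \<Longrightarrow> \<phi> x \<in> G.V"
    using hom unfolding lie_hom_on_def by auto
  have "\<phi> (F.mu x (1 *\<^sub>R y)) = G.mu (\<phi> x) (1 *\<^sub>R \<phi> y)"
  proof (rule G.left_invariant_ode_unique[of UNIV 0 1 _ "\<lambda>_. \<phi> y"])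
    have c: "((\<lambda>t. F.mu x (t *\<^sub>R y)) has_vector_derivative F.L (F.mu x (t *\<^sub>R y)) y) (at t)" for t
    proof -
      have "((\<lambda>h. F.mu (F.mu x (t *\<^sub>R y)) (h *\<^sub>R y)) has_vector_derivative F.L (F.mu x (t *\<^sub>R y)) y) (at 0)"
        by (rule F.L_vector_derivative[OF F.scale_vector_derivative]) simp
      then have "((\<lambda>h. F.mu x ((t + h) *\<^sub>R y)) has_vector_derivative F.L (F.mu x (t *\<^sub>R y)) y) (at 0)"
        using y by (simp add: F.mu_assoc F.mu_scale)
      then show ?thesis using has_vector_derivative_shift_0[of "\<lambda>t. F.mu x (t *\<^sub>R y)" t] by blast
    qed
    show "((\<lambda>t. \<phi> (F.mu x (t *\<^sub>R y))) has_vector_derivative G.L (\<phi> (F.mu x (t *\<^sub>R y))) (\<phi> y)) (at t)" for t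
      by (rule lie_hom_curve[OF F G hom c, of t UNIV]) (use y in auto)
    show "((\<lambda>t. G.mu (\<phi> x) (t *\<^sub>R \<phi> y)) has_vector_derivative G.L (G.mu (\<phi> x) (t *\<^sub>R \<phi> y)) (\<phi> y)) (at t)" for t
    proof -
      have "((\<lambda>h. G.mu (G.mu (\<phi> x) (t *\<^sub>R \<phi> y)) (h *\<^sub>R \<phi> y)) has_vector_derivative G.L (G.mu (\<phi> x) (t *\<^sub>R \<phi> y)) (\<phi> y)) (at 0)"
        by (rule G.L_vector_derivative[OF G.scale_vector_derivative]) simp
      then have "((\<lambda>h. G.mu (\<phi> x) ((t + h) *\<^sub>R \<phi> y)) has_vector_derivative G.L (G.mu (\<phi> x) (t *\<^sub>R \<phi> y)) (\<phi> y)) (at 0)"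
        using im[OF y] by (simp add: G.mu_assoc G.mu_scale)
      then show ?thesis using has_vector_derivative_shift_0[of "\<lambda>t. G.mu (\<phi> x) (t *\<^sub>R \<phi> y)" t] by blast
    qed
  qed (use x im in auto)
  then show ?thesis using x y im by (simp add: F.mu_eq G.mu_eq)
qed

lemma lie_hom_surj:
  fixes F G :: "ambient carnot"
  assumes F: "carnot F" and G: "carnot G"
    and hom: "lie_hom_on (carrier F) (bracket F) (carrier G) (bracket G) \<phi>"
    and gen: "layer G 1 \<subseteq> \<phi> ` carrier F"
  shows "carrier G \<subseteq> \<phi> ` carrier F"
proof -
  interpret F: carnot F by (rule F)
  interpret G: carnot G by (rule G)
  have lin: "linear \<phi>" using hom unfolding lie_hom_on_def by auto
  have S: "subspace (\<phi> ` F.V)" by (rule linear_subspace_image[OF lin F.subspace_V])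
  have lay: "G.lay k \<subseteq> \<phi> ` F.V" for k
  proof (induction k)
    case 0
    then show ?case using subspace_0[OF S] by (simp add: G.lay_def)
  next
    case (Suc k)
    show ?case
    proof (cases "k = 0 \<or> Suc k > step G")
      case True
      then show ?thesis using gen G.lay_1 subspace_0[OF S] by (auto simp: G.lay_def)
    next
      case False
      then have k: "k \<in> {1..step G}" by auto
      have "{bracket G x y | x y. x \<in> layer G 1 \<and> y \<in> layer G k} \<subseteq> \<phi> ` F.V"
      proof safe
        fix x y assume xy: "x \<in> layer G 1" "y \<in> layer G k"
        obtain x' where x': "x = \<phi> x'" "x' \<in> F.V" using gen xy(1) by blast
        have "y \<in> G.lay k" using xy(2) k by (simp add: G.lay_def)
        then obtain y' where y': "y = \<phi> y'" "y' \<in> F.V" using Suc by blast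
        have "bracket G x y = \<phi> (bracket F x' y')" using hom x' y' by (simp add: lie_hom_on_def)
        moreover have "bracket F x' y' \<in> F.V" using x' y' by (simp add: F.bracket_eq_D)
        ultimately show "bracket G x y \<in> \<phi> ` F.V" by blast
      qed
      then have "bracket_space (bracket G) (layer G 1) (layer G k) \<subseteq> \<phi> ` F.V"
        unfolding bracket_space_def by (rule span_minimal[OF _ S])
      then have "layer G (Suc k) \<subseteq> \<phi> ` F.V" unfolding G.layer_generated[OF k] .
      then show ?thesis using False by (simp add: G.lay_def)
    qed
  qed
  show ?thesis
  proof
    fix x assume x: "x \<in> G.V"
    have "(\<Sum>k=1..step G. G.component x k) \<in> \<phi> ` F.V"
      by (rule subspace_sum[OF S]) (rule subsetD[OF lay G.component_lay[OF x]])
    then show "x \<in> \<phi> ` F.V" using G.component_sum[OF x] by simp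
  qed
qed

section \<open>Iterated integrals along a horizontal curve\<close>

context control_algebra
begin

text \<open>The functions that may occur on \<open>I\<close> as derivatives of functions in \<open>alg (Suc N)\<close>.\<close>

definition dalg :: "nat \<Rightarrow> (real \<Rightarrow> real) set" where
  "dalg N = {g. \<exists>a. (\<forall>i<r. a i \<in> alg N) \<and> (\<forall>t\<in>I. g t = (\<Sum>i<r. a i t * u i t))}"

lemma dalg_add: "f \<in> dalg N \<Longrightarrow> g \<in> dalg N \<Longrightarrow> (\<lambda>t. f t + g t) \<in> dalg N"
proof -
  assume f: "f \<in> dalg N" and g: "g \<in> dalg N"
  obtain a where a: "\<And>i. i < r \<Longrightarrow> a i \<in> alg N" "\<And>t. t \<in> I \<Longrightarrow> f t = (\<Sum>i<r. a i t * u i t)"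
    using f unfolding dalg_def by auto
  obtain b where b: "\<And>i. i < r \<Longrightarrow> b i \<in> alg N" "\<And>t. t \<in> I \<Longrightarrow> g t = (\<Sum>i<r. b i t * u i t)"
    using g unfolding dalg_def by auto
  show ?thesis
    unfolding dalg_def
    using alg_add[OF a(1) b(1)] a(2) b(2)
    by (intro CollectI exI[of _ "\<lambda>i t. a i t + b i t"]) (simp add: sum.distrib distrib_right)
qed

lemma alg_mult_dalg: "f \<in> alg i \<Longrightarrow> g \<in> dalg j \<Longrightarrow> (\<lambda>t. f t * g t) \<in> dalg (i + j)"
proof -
  assume f: "f \<in> alg i" and g: "g \<in> dalg j"
  obtain b where b: "\<And>i. i < r \<Longrightarrow> b i \<in> alg j" "\<And>t. t \<in> I \<Longrightarrow> g t = (\<Sum>i<r. b i t * u i t)"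
    using g unfolding dalg_def by auto
  show ?thesis
    unfolding dalg_def
    using alg_mult[OF f b(1)] b(2)
    by (intro CollectI exI[of _ "\<lambda>k t. f t * b k t"]) (simp add: sum_distrib_left mult.assoc)
qed

lemma dalg_scale: "g \<in> dalg N \<Longrightarrow> (\<lambda>t. c * g t) \<in> dalg N"
  using alg_mult_dalg[OF alg_const[of c 0]] by simp

lemma dalg_0: "(\<lambda>_. 0) \<in> dalg N"
  unfolding dalg_def using alg_const[of 0 N] by (intro CollectI exI[of _ "\<lambda>_ _. 0"]) simp

lemma dalg_sum: "(\<And>j. j \<in> J \<Longrightarrow> f j \<in> dalg N) \<Longrightarrow> (\<lambda>t. \<Sum>j\<in>J. f j t) \<in> dalg N"
  by (induction J rule: infinite_finite_induct) (auto intro: dalg_0 dalg_add)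

lemma dalg_cong: "f \<in> dalg N \<Longrightarrow> (\<And>t. t \<in> I \<Longrightarrow> f t = g t) \<Longrightarrow> g \<in> dalg N"
  unfolding dalg_def by auto

lemma u_dalg: "i < r \<Longrightarrow> u i \<in> dalg 0"
proof -
  assume i: "i < r"
  have "(\<Sum>j<r. (if j = i then 1 else 0) * u j t) = u i t" for t
    using i by (simp add: if_distrib[of "\<lambda>x. x * _"] cong: if_cong)
  then show ?thesis
    unfolding dalg_def using alg_const by (intro CollectI exI[of _ "\<lambda>j _. if j = i then 1 else 0"]) simp
qed

lemma alg_Suc_intro: "g \<in> dalg N \<Longrightarrow> (\<And>t. t \<in> I \<Longrightarrow> (f has_real_derivative g t) (at t)) \<Longrightarrow> f \<in> alg (Suc N)"
  unfolding dalg_def by fastforce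

end

text \<open>A curve with control \<open>w t = (\<Sum>i<r. u i t *\<^sub>R X i)\<close>. It is instantiated with the given trajectory in
\<open>G\<close> and with its lift to the free group, with the same real functions \<open>u\<close>, so that both share the spaces
\<open>alg N\<close>.\<close>

locale carnot_curve = carnot G + control_algebra I r u
  for G :: "ambient carnot" (structure) and I :: "real set" and r :: nat and u :: "nat \<Rightarrow> real \<Rightarrow> real" +
  fixes X :: "nat \<Rightarrow> ambient" and \<gamma> :: "real \<Rightarrow> ambient"
  assumes X_layer: "i < r \<Longrightarrow> X i \<in> layer G 1"
    and curve_V: "t \<in> I \<Longrightarrow> \<gamma> t \<in> V"
    and curve_ode: "t \<in> I \<Longrightarrow> (\<gamma> has_vector_derivative L (\<gamma> t) (\<Sum>i<r. u i t *\<^sub>R X i)) (at t)"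
begin

definition w where "w t = (\<Sum>i<r. u i t *\<^sub>R X i)"

lemma layer_1_V: "layer G 1 \<subseteq> V" using layer_V[of 1] step_ge_1 by simp

lemma X_V: "i < r \<Longrightarrow> X i \<in> V" using X_layer layer_1_V by blast

lemma w_layer: "w t \<in> layer G 1"
  unfolding w_def using layer_subspace[of 1] step_ge_1 X_layer
  by (intro subspace_sum subspace_scale) auto

lemma w_V: "w t \<in> V" using w_layer layer_1_V by blast

text \<open>Curves all of whose coordinates lie in \<open>alg N\<close>; below, \<open>vdalg N\<close> is the same for \<open>dalg N\<close>.\<close>

definition valg :: "nat \<Rightarrow> (real \<Rightarrow> ambient) set" where
  "valg N = {c. \<forall>l. bounded_linear l \<longrightarrow> (\<lambda>t. l (c t)) \<in> alg N}"
definition vdalg :: "nat \<Rightarrow> (real \<Rightarrow> ambient) set" where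
  "vdalg N = {c. \<forall>l. bounded_linear l \<longrightarrow> (\<lambda>t. l (c t)) \<in> dalg N}"

lemma vdalg_D:
  assumes x: "x \<in> valg i" and y: "y \<in> vdalg j"
  shows "(\<lambda>t. D (x t) (y t)) \<in> vdalg (i + j)"
  unfolding vdalg_def
proof (intro CollectI allI impI)
  fix l :: "ambient \<Rightarrow> real" assume l: "bounded_linear l"
  have eq: "l (D a b) = (\<Sum>c\<in>frame. \<Sum>c'\<in>frame. l (D c c') * (coord c a * coord c' b))" for a b
  proof -
    have "D a b = D (\<Sum>c\<in>frame. coord c a *\<^sub>R c) (\<Sum>c\<in>frame. coord c b *\<^sub>R c)"
      unfolding pr_def[symmetric] by simp
    also have "\<dots> = (\<Sum>c\<in>frame. \<Sum>c'\<in>frame. (coord c a * coord c' b) *\<^sub>R D c c')"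
      by (subst D.sum_left, subst D.sum_right) (simp add: D_scale_left D_scale_right mult.commute)
    finally show ?thesis
      by (simp add: linear_sum[OF bounded_linear.linear[OF l]] linear_scale[OF bounded_linear.linear[OF l]] mult.commute)
  qed
  have p: "(\<lambda>t. coord c (x t) * coord c' (y t)) \<in> dalg (i + j)" if "c \<in> frame" "c' \<in> frame" for c c'
    using x y bounded_linear_coord that by (intro alg_mult_dalg) (auto simp: valg_def vdalg_def)
  have "(\<lambda>t. l (D (x t) (y t))) =
     (\<lambda>t. \<Sum>c\<in>frame. \<Sum>c'\<in>frame. l (D c c') * (coord c (x t) * coord c' (y t)))"
    by (rule ext) (rule eq)
  then show "(\<lambda>t. l (D (x t) (y t))) \<in> dalg (i + j)"
    by (simp only:) (rule dalg_sum, rule dalg_sum, rule dalg_scale, rule p)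
qed

lemma vdalg_add: "x \<in> vdalg N \<Longrightarrow> y \<in> vdalg N \<Longrightarrow> (\<lambda>t. x t + y t) \<in> vdalg N"
  unfolding vdalg_def by (auto simp: linear_add[OF bounded_linear.linear] intro: dalg_add)

lemma vdalg_scale: "x \<in> vdalg N \<Longrightarrow> (\<lambda>t. c *\<^sub>R x t) \<in> vdalg N"
  unfolding vdalg_def by (auto simp: linear_scale[OF bounded_linear.linear] intro: dalg_scale)

lemma vdalg_0: "(\<lambda>_. 0) \<in> vdalg N"
  unfolding vdalg_def by (auto simp: linear_0[OF bounded_linear.linear] dalg_0)

lemma vdalg_sum: "(\<And>j. j \<in> J \<Longrightarrow> x j \<in> vdalg N) \<Longrightarrow> (\<lambda>t. \<Sum>j\<in>J. x j t) \<in> vdalg N"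
  by (induction J rule: infinite_finite_induct) (auto intro: vdalg_0 vdalg_add)

lemma vdalg_cong: "x \<in> vdalg N \<Longrightarrow> (\<And>t. t \<in> I \<Longrightarrow> x t = y t) \<Longrightarrow> y \<in> vdalg N"
  unfolding vdalg_def by (auto elim!: dalg_cong)

lemma w_vdalg: "w \<in> vdalg 0"
  unfolding vdalg_def w_def
proof (intro CollectI allI impI)
  fix l :: "ambient \<Rightarrow> real" assume l: "bounded_linear l"
  have "(\<lambda>t. \<Sum>i<r. l (X i) * u i t) \<in> dalg 0" by (intro dalg_sum dalg_scale u_dalg) simp
  then show "(\<lambda>t. l (\<Sum>i<r. u i t *\<^sub>R X i)) \<in> dalg 0"
    by (simp add: linear_sum[OF bounded_linear.linear[OF l]] linear_scale[OF bounded_linear.linear[OF l]] mult.commute)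
qed

text \<open>Since \<open>\<Theta> (\<gamma> t) (\<gamma>' t) = w t\<close> is horizontal, the series for \<open>\<Theta>\<close> expresses \<open>\<gamma>'\<close> by \<open>w\<close> and iterated
brackets of \<open>\<gamma>\<close> with \<open>\<gamma>'\<close>. In layer \<open>k\<close> these brackets involve lower layers only, and brackets add
up the indices of the spaces \<open>alg\<close>. So induction on \<open>k\<close> applies.\<close>

lemma curve_component_alg: "(\<lambda>t. component (\<gamma> t) k) \<in> valg k"
proof -
  define \<gamma>' where "\<gamma>' t = L (\<gamma> t) (w t)" for t
  have \<gamma>'V: "\<gamma>' t \<in> V" for t by (simp add: \<gamma>'_def)
  have DV: "(D (\<gamma> t) ^^ m) (\<gamma>' t) \<in> V" for m t by (rule Dpow_V[OF \<gamma>'V])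
  have ode: "(\<gamma> has_vector_derivative \<gamma>' t) (at t)" if "t \<in> I" for t
    using curve_ode[OF that] by (simp add: \<gamma>'_def w_def)
  \<comment> \<open>The coefficients of the series for \<open>\<Theta>\<close>.\<close>
  define c where "c m = ((-1)^m / fact (Suc m) :: real)" for m
  have \<gamma>'_eq: "\<gamma>' t = w t + (\<Sum>m<step G. (- c (Suc m)) *\<^sub>R (D (\<gamma> t) ^^ Suc m) (\<gamma>' t))" if t: "t \<in> I" for t
  proof -
    have "w t = \<Theta> (\<gamma> t) (\<gamma>' t)" using curve_V[OF t] w_V by (simp add: \<gamma>'_def)
    also have "\<dots> = (\<Sum>m<Suc (step G). c m *\<^sub>R (D (\<gamma> t) ^^ m) (\<gamma>' t))"
      unfolding c_def
      by (intro \<Theta>_formula curve_V[OF t] \<gamma>'V Dpow_eq_0[OF lc_step]) auto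
    also have "\<dots> = \<gamma>' t + (\<Sum>m<step G. c (Suc m) *\<^sub>R (D (\<gamma> t) ^^ Suc m) (\<gamma>' t))"
      by (subst sum.lessThan_Suc_shift) (simp add: c_def)
    finally show ?thesis by (simp add: sum_negf)
  qed
  have comp_w: "(\<lambda>t. component (w t) k) \<in> vdalg (k - 1)" for k
  proof (cases "k = 1")
    case True
    have "component (w t) k = w t" for t using component_of_layer[OF w_layer[of t], of k] step_ge_1 True by simp
    then show ?thesis using w_vdalg True by simp
  next
    case False
    have "component (w t) k = 0" for t using component_of_layer[OF w_layer[of t], of k] step_ge_1 False by simp
    then show ?thesis using vdalg_0 by simp
  qed
  have "(\<lambda>t. component (\<gamma> t) k) \<in> valg k \<and> (\<lambda>t. component (\<gamma>' t) k) \<in> vdalg (k - 1)" for k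
  proof (induction k rule: less_induct)
    case (less k)
    show ?case
    proof (cases "k \<in> {1..step G}")
      case False
      then have "component x k = 0" for x by (simp only: component_def if_False)
      then show ?thesis using vdalg_0 alg_const[of 0 k] by (auto simp: valg_def linear_0[OF bounded_linear.linear])
    next
      case k: True
      have step: "(\<lambda>t. component ((D (\<gamma> t) ^^ Suc m) (\<gamma>' t)) j) \<in> vdalg (j - 1)"
        if IH: "\<And>j. j < k \<Longrightarrow> (\<lambda>t. component ((D (\<gamma> t) ^^ m) (\<gamma>' t)) j) \<in> vdalg (j - 1)" and j: "j \<in> {1..step G}" "j \<le> k" for m j
      proof -
        have "(\<lambda>t. \<Sum>a=1..step G. \<Sum>b=1..step G. if a + b = j
            then D (component (\<gamma> t) a) (component ((D (\<gamma> t) ^^ m) (\<gamma>' t)) b) else 0) \<in> vdalg (j - 1)"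
        proof (intro vdalg_sum)
          fix a b assume ab: "a \<in> {1..step G}" "b \<in> {1..step G}"
          show "(\<lambda>t. if a + b = j then D (component (\<gamma> t) a) (component ((D (\<gamma> t) ^^ m) (\<gamma>' t)) b) else 0) \<in> vdalg (j - 1)"
          proof (cases "a + b = j")
            case True
            then have "a < k" "b < k" and e: "j - 1 = a + (b - 1)" using ab j by auto
            then have "(\<lambda>t. D (component (\<gamma> t) a) (component ((D (\<gamma> t) ^^ m) (\<gamma>' t)) b)) \<in> vdalg (a + (b - 1))"
              using less IH by (intro vdalg_D) auto
            then show ?thesis using True unfolding e by simp
          qed (simp add: vdalg_0)
        qed
        then show ?thesis
          by (rule vdalg_cong) (use component_D[OF curve_V DV j(1)] in simp)
      qed
      have low: "(\<lambda>t. component ((D (\<gamma> t) ^^ m) (\<gamma>' t)) j) \<in> vdalg (j - 1)" if "j < k" for m j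
        using that
      proof (induction m arbitrary: j)
        case 0
        then show ?case using less by simp
      next
        case (Suc m)
        show ?case
        proof (cases "j \<in> {1..step G}")
          case True
          show ?thesis by (rule step[OF Suc.IH True]) (use Suc.prems in auto)
        next
          case False
          then have "component x j = 0" for x by (simp only: component_def if_False)
          then show ?thesis using vdalg_0 by simp
        qed
      qed
      have d: "(\<lambda>t. component (\<gamma>' t) k) \<in> vdalg (k - 1)"
      proof -
        have 1: "(\<lambda>t. component (w t) k + (\<Sum>m<step G. (- c (Suc m)) *\<^sub>R component ((D (\<gamma> t) ^^ Suc m) (\<gamma>' t)) k)) \<in> vdalg (k - 1)"
          by (intro vdalg_add comp_w vdalg_sum vdalg_scale step[OF low k]) auto
        have 2: "component (\<gamma>' t) k = component (w t) k + (\<Sum>m<step G. (- c (Suc m)) *\<^sub>R component ((D (\<gamma> t) ^^ Suc m) (\<gamma>' t)) k)"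
          if t: "t \<in> I" for t
        proof -
          interpret q: bounded_linear "\<lambda>x. component (pr x) k" by (rule bounded_linear_component)
          have "component (pr (\<gamma>' t)) k = component (pr (w t)) k + (\<Sum>m<step G. (- c (Suc m)) *\<^sub>R component (pr ((D (\<gamma> t) ^^ Suc m) (\<gamma>' t))) k)"
            by (subst \<gamma>'_eq[OF t]) (simp only: q.add q.sum q.scale)
          then show ?thesis by (simp only: pr_id[OF \<gamma>'V] pr_id[OF w_V] pr_id[OF DV])
        qed
        show ?thesis by (rule vdalg_cong[OF 1]) (rule 2[symmetric])
      qed
      have "(\<lambda>t. component (\<gamma> t) k) \<in> valg k"
        unfolding valg_def
      proof (intro CollectI allI impI)
        fix l :: "ambient \<Rightarrow> real" assume l: "bounded_linear l"
        have bl: "bounded_linear (\<lambda>x. l (component (pr x) k))"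
          by (rule bounded_linear_compose[OF l bounded_linear_component])
        have "(\<lambda>t. l (component (pr (\<gamma> t)) k)) \<in> alg (Suc (k - 1))"
        proof (rule alg_Suc_intro)
          show "(\<lambda>t. l (component (\<gamma>' t) k)) \<in> dalg (k - 1)" using d l by (simp add: vdalg_def)
          show "((\<lambda>t. l (component (pr (\<gamma> t)) k)) has_real_derivative l (component (\<gamma>' t) k)) (at t)" if "t \<in> I" for t
            using bounded_linear.has_vector_derivative[OF bl ode[OF that]] \<gamma>'V
            by (simp add: has_real_derivative_iff_has_vector_derivative)
        qed
        moreover have "Suc (k - 1) = k" using k by simp
        ultimately have "(\<lambda>t. l (component (pr (\<gamma> t)) k)) \<in> alg k" by (simp only:)
        then show "(\<lambda>t. l (component (\<gamma> t) k)) \<in> alg k"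
          by (rule alg_cong) (use curve_V in simp)
      qed
      then show ?thesis using d by blast
    qed
  qed
  then show ?thesis by blast
qed

text \<open>Each differentiation brackets with a horizontal vector, which moves \<open>y\<close> one term down the lower
central series; after at most \<open>s\<close> differentiations nothing is left.\<close>

lemma Ad_alg:
  assumes nil: "lc s = {0}" and l: "bounded_linear l" and y: "y \<in> lc (s - m)" and m: "m \<le> s"
  shows "(\<lambda>t. l (Cj (\<gamma> t) y)) \<in> alg m"
  using y m
proof (induction m arbitrary: y)
  case 0
  then have "y = 0" using nil by simp
  then show ?case using alg_const[of "l 0" 0] by (simp del: alg.simps)
next
  case (Suc m)
  have "D (X i) y \<in> lc (s - m)" if "i < r" for i
    using lc_D[OF X_V[OF that] Suc.prems(1)] Suc.prems(2) by (metis Suc_diff_Suc Suc_le_lessD)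
  then have IH: "(\<lambda>t. l (Cj (\<gamma> t) (D (X i) y))) \<in> alg m" if "i < r" for i
    using Suc.IH Suc.prems(2) that by simp
  have "((\<lambda>t. l (Cj (\<gamma> t) y)) has_real_derivative (\<Sum>i<r. l (Cj (\<gamma> t) (D (X i) y)) * u i t)) (at t)" if t: "t \<in> I" for t
  proof -
    have "((\<lambda>t. Cj (\<gamma> t) y) has_vector_derivative Cj (\<gamma> t) (D (w t) y)) (at t)"
      using Cj_curve_derivative curve_ode[OF t] curve_V[OF t] by (simp add: w_def)
    then have "((\<lambda>t. l (Cj (\<gamma> t) y)) has_vector_derivative l (Cj (\<gamma> t) (D (w t) y))) (at t)"
      by (rule bounded_linear.has_vector_derivative[OF l])
    moreover have "l (Cj (\<gamma> t) (D (w t) y)) = (\<Sum>i<r. l (Cj (\<gamma> t) (D (X i) y)) * u i t)"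
      by (simp add: w_def D.sum_left D_scale_left Cj.sum Cj.scale mult.commute
          linear_sum[OF bounded_linear.linear[OF l]] linear_scale[OF bounded_linear.linear[OF l]])
    ultimately show ?thesis by (simp add: has_real_derivative_iff_has_vector_derivative)
  qed
  then show ?case using IH unfolding alg.simps
    by (intro CollectI exI[of _ "\<lambda>i t. l (Cj (\<gamma> t) (D (X i) y))"]) simp
qed

text \<open>If the vectors \<open>Ad\<^bsub>\<gamma>(t)\<^esub> (X i)\<close> spanned the Lie algebra, a basis consisting of them would have at least
\<open>card E\<close> elements. But the elements with a fixed index \<open>i\<close> together with their dual functionals form a
dual family in \<open>alg s\<close>, and the bound for such families, multiplied by the number \<open>r\<close> of indices, is
smaller than \<open>card E\<close>.\<close>

lemma annihilating_covector:
  assumes r: "2 \<le> r" and nil: "lc s = {0}" and u: "\<And>i. i < r \<Longrightarrow> u i \<in> alg d"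
    and gen: "layer G 1 = span (X ` {..<r})"
    and E: "E \<subseteq> V" "finite E" "independent E"
    and big: "real r * (real (r + 1) ^ d * real (s + 1) * (real r - 1 / (real r * real (r + 1) ^ d)) ^ s) < real (card E)"
  shows "\<exists>l :: ambient \<Rightarrow> real. linear l \<and> (\<exists>x\<in>V. l x \<noteq> 0) \<and> (\<forall>t\<in>I. \<forall>x\<in>layer G 1. l (Ad G (\<gamma> t) x) = 0)"
proof -
  define bound where "bound = real (r + 1) ^ d * real (s + 1) * (real r - 1 / (real r * real (r + 1) ^ d)) ^ s"
  define S where "S = {Cj (\<gamma> t) (X i) | t i. t \<in> I \<and> i < r}"
  have SV: "S \<subseteq> V" by (auto simp: S_def)
  obtain B where B: "B \<subseteq> S" "independent B" "S \<subseteq> span B" by (rule basis_exists[of S])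
  obtain F where F: "finite F" "V = span F" using V_fin by blast
  have finB: "finite B" using independent_span_bound[OF F(1) B(2)] B(1) SV F(2) by auto
  have dual: "\<exists>l :: ambient \<Rightarrow> real. bounded_linear l \<and> (\<forall>x\<in>B. l x = (if x = b then 1 else 0))" for b
  proof -
    obtain g :: "ambient \<Rightarrow> real" where g: "linear g" "\<forall>x\<in>B. g x = (if x = b then 1 else 0)"
      using linear_independent_extend[OF B(2), of "\<lambda>x. if x = b then 1 else 0"] by blast
    have "bounded_linear (\<lambda>x. g (pr x))"
      by (rule bounded_linear_on_V) (simp_all add: linear_add[OF g(1)] linear_scale[OF g(1)])
    moreover have "g (pr x) = (if x = b then 1 else 0)" if "x \<in> B" for x
      using that g(2) B(1) SV by auto
    ultimately show ?thesis by (intro exI[of _ "\<lambda>x. g (pr x)"]) simp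
  qed
  have "\<forall>b\<in>B. \<exists>ti. b = Cj (\<gamma> (fst ti)) (X (snd ti)) \<and> fst ti \<in> I \<and> snd ti < r"
    using B(1) unfolding S_def by fastforce
  from bchoice[OF this] obtain ti where
    ti: "\<And>b. b \<in> B \<Longrightarrow> b = Cj (\<gamma> (fst (ti b))) (X (snd (ti b)))" "\<And>b. b \<in> B \<Longrightarrow> fst (ti b) \<in> I"
      "\<And>b. b \<in> B \<Longrightarrow> snd (ti b) < r" by blast
  from dual obtain dl where dl: "\<And>b. bounded_linear (dl b :: ambient \<Rightarrow> real)"
    "\<And>b x. x \<in> B \<Longrightarrow> dl b x = (if x = b then 1 else 0)" by metis
  define J where "J i = {b \<in> B. snd (ti b) = i}" for i
  have J: "real (card (J i)) \<le> bound" if i: "i < r" for i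
    unfolding bound_def
  proof (rule dual_family_bound[OF r u, where f = "\<lambda>b t. dl b (Cj (\<gamma> t) (X i))" and p = "\<lambda>b. fst (ti b)"])
    show "finite (J i)" using finB by (simp add: J_def)
    show "(\<lambda>t. dl b (Cj (\<gamma> t) (X i))) \<in> alg s" for b
      using Ad_alg[OF nil dl(1), of "X i" s b] X_V[OF i] by simp
    show "fst (ti b) \<in> I" if "b \<in> J i" for b using that ti by (simp add: J_def)
    show "dl b (Cj (\<gamma> (fst (ti b'))) (X i)) = 0 \<longleftrightarrow> b \<noteq> b'" if "b \<in> J i" "b' \<in> J i" for b b'
    proof -
      have "Cj (\<gamma> (fst (ti b'))) (X i) = b'" using ti(1)[of b'] that by (simp add: J_def)
      then show ?thesis using that dl(2)[of b' b] by (auto simp: J_def)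
    qed
  qed
  have "B = (\<Union>i<r. J i)" using ti(3) by (auto simp: J_def)
  then have "card B \<le> (\<Sum>i<r. card (J i))" using card_UN_le[of "{..<r}" J] by simp
  then have "real (card B) \<le> (\<Sum>i<r. real (card (J i)))" by (metis of_nat_le_iff of_nat_sum)
  also have "\<dots> \<le> (\<Sum>i<r. bound)" using J by (intro sum_mono) auto
  finally have "real (card B) < real (card E)" using big by (simp add: bound_def)
  have "\<not> V \<subseteq> span B"
  proof
    assume "V \<subseteq> span B"
    then have "card E \<le> card B" using independent_span_bound[OF finB E(3)] E(1) by blast
    then show False using \<open>real (card B) < real (card E)\<close> by simp
  qed
  then obtain x where x: "x \<in> V" "x \<notin> span B" by blast
  then have "independent (insert x B)" using B(2) by (simp add: independent_insert)
  from linear_independent_extend[OF this, of "\<lambda>y. if y = x then 1 else 0 :: real"]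
  obtain l :: "ambient \<Rightarrow> real" where l: "linear l" "\<forall>y\<in>insert x B. l y = (if y = x then 1 else 0)" by blast
  have lB: "l y = 0" if "y \<in> B" for y using that l(2) x(2) span_base by auto
  have lspan: "l y = 0" if "y \<in> span B" for y
    using linear_eq_0_on_span[OF l(1) lB that] .
  have "l (Ad G (\<gamma> t) y) = 0" if t: "t \<in> I" and y: "y \<in> layer G 1" for t y
  proof -
    have yV: "y \<in> V" using y layer_1_V by blast
    have "linear (\<lambda>y. l (Cj (\<gamma> t) y))"
      using linear_compose[OF bounded_linear.linear[OF bounded_linear_Cj] l(1)] by (simp add: o_def)
    moreover have "l (Cj (\<gamma> t) z) = 0" if "z \<in> X ` {..<r}" for z
    proof -
      have "Cj (\<gamma> t) z \<in> S" using that t by (auto simp: S_def)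
      then show ?thesis using B(3) lspan by blast
    qed
    ultimately have "l (Cj (\<gamma> t) y) = 0" using linear_eq_0_on_span[of "\<lambda>y. l (Cj (\<gamma> t) y)" "X ` {..<r}"] y gen by blast
    then show ?thesis using Ad_eq_Cj[OF curve_V[OF t] yV] by simp
  qed
  moreover have "l x \<noteq> 0" using l(2) by simp
  ultimately show ?thesis using l(1) x(1) by blast
qed

end

section \<open>Horizontal trajectories of polynomial vector fields\<close>

context carnot
begin

lemma adapted_weight:
  assumes ab: "adapted_basis G n X" and i: "i < n"
  shows "weight G (X i) \<in> {1..step G}" "X i \<in> layer G (weight G (X i))"
proof -
  obtain k where k: "k \<in> {1..step G}" "X i \<in> layer G k" using ab i by (auto simp: adapted_basis_def)
  have "X i \<noteq> 0" using ab i dependent_zero[of "X ` {..<n}"] by (auto simp: adapted_basis_def)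
  then have "k' = k" if "k' \<in> {1..step G} \<and> X i \<in> layer G k'" for k'
    using component_of_layer[of "X i" k k] component_of_layer[of "X i" k' k] k that by (auto split: if_splits)
  then have "weight G (X i) = k" unfolding weight_def using k by blast
  then show "weight G (X i) \<in> {1..step G}" "X i \<in> layer G (weight G (X i))" using k by auto
qed

text \<open>The coordinate functions of an adapted basis, as linear forms on the whole space. A basis vector is
only seen by its own layer.\<close>

lemma adapted_coordinates:
  assumes ab: "adapted_basis G n X"
  obtains g :: "nat \<Rightarrow> ambient \<Rightarrow> real" where "\<And>i. linear (g i)"
    "\<And>i j. i < n \<Longrightarrow> j < n \<Longrightarrow> g i (X j) = (if j = i then 1 else 0)"
    "\<And>x. x \<in> V \<Longrightarrow> x = (\<Sum>i<n. g i x *\<^sub>R X i)"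
    "\<And>x i. x \<in> V \<Longrightarrow> i < n \<Longrightarrow> representation (X ` {..<n}) x (X i) = g i x"
    "\<And>y i k. i < n \<Longrightarrow> k \<in> {1..step G} \<Longrightarrow> y \<in> layer G k \<Longrightarrow> k \<noteq> weight G (X i) \<Longrightarrow> g i y = 0"
proof -
  have ind: "independent (X ` {..<n})" and inj: "inj_on X {..<n}" and sp: "span (X ` {..<n}) = V"
    using ab by (auto simp: adapted_basis_def)
  have "\<forall>i. \<exists>g :: ambient \<Rightarrow> real. linear g \<and> (\<forall>x\<in>X ` {..<n}. g x = (if x = X i then 1 else 0))"
    by (rule allI) (rule linear_independent_extend[OF ind])
  from choice[OF this] obtain g :: "nat \<Rightarrow> ambient \<Rightarrow> real" where
    g: "\<forall>i. linear (g i) \<and> (\<forall>x\<in>X ` {..<n}. g i x = (if x = X i then 1 else 0))" ..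
  then have lin: "\<And>i. linear (g i)"
    and g0: "\<And>i x. x \<in> X ` {..<n} \<Longrightarrow> g i x = (if x = X i then 1 else 0)" by blast+
  have gX: "g i (X j) = (if j = i then 1 else 0)" if "i < n" "j < n" for i j
    using g0[of "X j" i] that inj by (auto simp: inj_on_def)
  have rep: "x = (\<Sum>i<n. g i x *\<^sub>R X i)" if x: "x \<in> V" for x
  proof (rule linear_eq_on_span[of "\<lambda>x. x" "\<lambda>x. \<Sum>i<n. g i x *\<^sub>R X i" "X ` {..<n}" x])
    show "linear (\<lambda>x::ambient. x)" by (rule linear_ident)
    show "linear (\<lambda>x. \<Sum>i<n. g i x *\<^sub>R X i)"
      by (intro linear_compose_sum ballI linearI)
         (simp_all add: linear_add[OF lin] linear_scale[OF lin] scaleR_add_left)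
    fix y assume "y \<in> X ` {..<n}"
    then obtain j where j: "j < n" "y = X j" by auto
    have "(\<Sum>i<n. g i y *\<^sub>R X i) = (\<Sum>i<n. if i = j then X i else 0)"
      using gX j by (intro sum.cong) auto
    then show "y = (\<Sum>i<n. g i y *\<^sub>R X i)" using j by simp
  qed (use x sp in simp)
  have repr: "representation (X ` {..<n}) x (X i) = g i x" if x: "x \<in> V" and i: "i < n" for x i
  proof -
    have "x = (\<Sum>b\<in>X ` {..<n}. representation (X ` {..<n}) x b *\<^sub>R b)"
      using sum_representation_eq[OF ind, of x "X ` {..<n}"] x sp by simp
    also have "\<dots> = (\<Sum>j<n. representation (X ` {..<n}) x (X j) *\<^sub>R X j)"
      by (simp add: sum.reindex[OF inj])
    finally have "g i x = g i (\<Sum>j<n. representation (X ` {..<n}) x (X j) *\<^sub>R X j)" by simp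
    also have "\<dots> = (\<Sum>j<n. representation (X ` {..<n}) x (X j) * g i (X j))"
      by (simp add: linear_sum[OF lin] linear_scale[OF lin])
    also have "\<dots> = (\<Sum>j<n. if j = i then representation (X ` {..<n}) x (X j) else 0)"
      using gX i by (intro sum.cong) auto
    finally show ?thesis using i by simp
  qed
  have layer0: "g i y = 0" if i: "i < n" and k: "k \<in> {1..step G}" "y \<in> layer G k" "k \<noteq> weight G (X i)" for y i k
  proof -
    define m where "m = weight G (X i)"
    have yV: "y \<in> V" using k layer_V by blast
    interpret q: bounded_linear "\<lambda>x. component (pr x) m" by (rule bounded_linear_component)
    have XV: "X j \<in> V" if "j < n" for j using sp that by (metis imageI lessThan_iff span_base)
    have "component (pr y) m = component (pr (\<Sum>j<n. g j y *\<^sub>R X j)) m"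
      using rep[OF yV] by simp
    also have "\<dots> = (\<Sum>j<n. g j y *\<^sub>R component (pr (X j)) m)"
      by (simp only: q.sum q.scale)
    also have "\<dots> = (\<Sum>j<n. g j y *\<^sub>R component (X j) m)"
      using XV by (intro sum.cong) auto
    finally have "component y m = (\<Sum>j<n. g j y *\<^sub>R component (X j) m)" using yV by simp
    moreover have "component y m = 0" using component_of_layer[OF k(2,1), of m] k(3) by (simp add: m_def)
    ultimately have "g i (\<Sum>j<n. g j y *\<^sub>R component (X j) m) = 0" using linear_0[OF lin, of i] by simp
    then have sum0: "(\<Sum>j<n. g j y * g i (component (X j) m)) = 0"
      by (simp add: linear_sum[OF lin] linear_scale[OF lin])
    have e: "g i (component (X j) m) = (if j = i then 1 else 0)" if j: "j < n" for j
      using component_of_layer[OF adapted_weight(2,1)[OF ab j], of m] gX[OF i j] linear_0[OF lin, of i]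
      by (auto simp: m_def)
    have "(\<Sum>j<n. if j = i then g j y else 0) = 0"
    proof -
      have "(\<Sum>j<n. if j = i then g j y else 0) = (\<Sum>j<n. g j y * g i (component (X j) m))"
        using e by (intro sum.cong) auto
      then show ?thesis using sum0 by simp
    qed
    then show ?thesis using i by simp
  qed
  show ?thesis by (rule that[OF lin gX rep repr layer0])
qed

lemma polynomial_along_curve_continuous:
  assumes ab: "adapted_basis G n X" and p: "polynomial_on G n X p"
    and \<gamma>: "continuous_on I \<gamma>" "\<And>t. t \<in> I \<Longrightarrow> \<gamma> t \<in> V"
  shows "continuous_on I (\<lambda>t. p (\<gamma> t))"
proof -
  obtain g :: "nat \<Rightarrow> ambient \<Rightarrow> real" where lin: "\<And>i. linear (g i)"
    and repr: "\<And>x i. x \<in> V \<Longrightarrow> i < n \<Longrightarrow> representation (X ` {..<n}) x (X i) = g i x"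
    by (rule adapted_coordinates[OF ab]) (rule that)
  obtain A c where A: "finite A"
    "\<And>x. x \<in> V \<Longrightarrow> p x = (\<Sum>\<alpha>\<in>A. c \<alpha> * (\<Prod>i<n. representation (X ` {..<n}) x (X i) ^ \<alpha> i))"
    using p unfolding polynomial_on_def polynomial_of_degree_le_def by auto
  have bl: "bounded_linear (\<lambda>x. g i (pr x))" for i
    by (rule bounded_linear_on_V) (simp_all add: linear_add[OF lin] linear_scale[OF lin])
  have c1: "continuous_on I (\<lambda>t. \<Sum>\<alpha>\<in>A. c \<alpha> * (\<Prod>i<n. g i (pr (\<gamma> t)) ^ \<alpha> i))"
    by (intro continuous_intros bounded_linear.continuous_on[OF bl] \<gamma>)
  have c2: "(\<Sum>\<alpha>\<in>A. c \<alpha> * (\<Prod>i<n. g i (pr (\<gamma> t)) ^ \<alpha> i)) = p (\<gamma> t)" if "t \<in> I" for t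
    using A(2)[OF \<gamma>(2)[OF that]] repr[OF \<gamma>(2)[OF that]] \<gamma>(2)[OF that] by simp
  show ?thesis by (rule continuous_on_eq[OF c1 c2])
qed

lemma rank_le:
  assumes ab: "adapted_basis G n X"
  shows "carnot_rank G \<le> n" "layer G 1 = span (X ` {..<carnot_rank G})"
proof -
  define r where "r = carnot_rank G"
  obtain g :: "nat \<Rightarrow> ambient \<Rightarrow> real" where
    rep: "\<And>x. x \<in> V \<Longrightarrow> x = (\<Sum>i<n. g i x *\<^sub>R X i)"
    and layer0: "\<And>y i k. i < n \<Longrightarrow> k \<in> {1..step G} \<Longrightarrow> y \<in> layer G k \<Longrightarrow> k \<noteq> weight G (X i) \<Longrightarrow> g i y = 0"
    by (rule adapted_coordinates[OF ab]) (rule that)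
  have hor: "X i \<in> layer G 1 \<longleftrightarrow> i < r" if "i < n" for i using ab that by (simp add: adapted_basis_def r_def)
  have sub: "layer G 1 \<subseteq> span (X ` {..<min n r})"
  proof
    fix y assume y: "y \<in> layer G 1"
    have yV: "y \<in> V" using y layer_V[of 1] step_ge_1 by auto
    have "g i y *\<^sub>R X i \<in> span (X ` {..<min n r})" if "i < n" for i
    proof (cases "i < r")
      case True
      then show ?thesis using that by (intro span_scale span_base) auto
    next
      case False
      then have "weight G (X i) \<noteq> 1" using adapted_weight[OF ab that] hor[OF that] by metis
      then have "g i y = 0" using layer0[OF that, of 1 y] y step_ge_1 by simp
      then show ?thesis by (simp add: span_zero)
    qed
    then have "(\<Sum>i<n. g i y *\<^sub>R X i) \<in> span (X ` {..<min n r})" by (intro span_sum) auto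
    then show "y \<in> span (X ` {..<min n r})" using rep[OF yV] by simp
  qed
  have "r \<le> card (X ` {..<min n r})"
    unfolding r_def carnot_rank_def using dim_le_card[OF sub] by (simp add: r_def carnot_rank_def)
  also have "\<dots> \<le> min n r" using card_image_le[of "{..<min n r}" X] by simp
  finally show rn: "carnot_rank G \<le> n" by (simp add: r_def)
  have "span (X ` {..<r}) \<subseteq> layer G 1"
    using hor rn layer_subspace[of 1] step_ge_1 by (intro span_minimal) (auto simp: r_def)
  then show "layer G 1 = span (X ` {..<carnot_rank G})" using sub rn by (simp add: r_def min_def split: if_splits)
qed

text \<open>Left translations have injective differentials, so the coefficients of the vertical fields vanish
along a horizontal trajectory at almost every time, and by continuity at every time.\<close>

lemma trajectory_horizontal:
  assumes ab: "adapted_basis G n X" and p: "\<And>i. i < n \<Longrightarrow> polynomial_on G n X (p i)"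
    and P: "\<And>x. x \<in> V \<Longrightarrow> P x = (\<Sum>i<n. p i x *\<^sub>R dL G x (X i))"
    and I: "open I" and traj: "horizontal_trajectory G P I \<gamma>" and t: "t \<in> I"
  shows "(\<gamma> has_vector_derivative L (\<gamma> t) (\<Sum>i<carnot_rank G. p i (\<gamma> t) *\<^sub>R X i)) (at t)"
proof -
  obtain g :: "nat \<Rightarrow> ambient \<Rightarrow> real" where lin: "\<And>i. linear (g i)"
    and gX: "\<And>i j. i < n \<Longrightarrow> j < n \<Longrightarrow> g i (X j) = (if j = i then 1 else 0)"
    and layer0: "\<And>y i k. i < n \<Longrightarrow> k \<in> {1..step G} \<Longrightarrow> y \<in> layer G k \<Longrightarrow> k \<noteq> weight G (X i) \<Longrightarrow> g i y = 0"
    by (rule adapted_coordinates[OF ab]) (rule that)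
  have XV: "X j \<in> V" if "j < n" for j
    using ab that unfolding adapted_basis_def by (metis imageI lessThan_iff span_base)
  obtain v where v: "has_control G I \<gamma> v" using traj by (auto simp: horizontal_trajectory_def horizontal_curve_def)
  have \<gamma>V: "\<gamma> t \<in> V" if "t \<in> I" for t using v that by (auto simp: has_control_def)
  define q where "q t = (\<Sum>i<n. p i (\<gamma> t) *\<^sub>R X i)" for t
  have qV: "q t \<in> V" for t unfolding q_def using XV by (intro subspace_sum[OF subspace_V] scaleR_V) auto
  have ode: "(\<gamma> has_vector_derivative L (\<gamma> t) (q t)) (at t)" if "t \<in> I" for t
  proof -
    have eq: "P (\<gamma> t) = L (\<gamma> t) (q t)"
      using P[OF \<gamma>V[OF that]] XV dL_eq_L[OF \<gamma>V[OF that]] by (simp add: q_def L.sum L.scale)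
    have "(\<gamma> has_vector_derivative P (\<gamma> t)) (at t)"
      using traj that by (simp add: horizontal_trajectory_def)
    then show ?thesis by (simp only: eq)
  qed
  have cont: "continuous_on I \<gamma>"
    using ode by (meson continuous_at_imp_continuous_on has_vector_derivative_continuous)
  have "AE t in lebesgue. t \<in> I \<longrightarrow> q t \<in> layer G 1"
  proof -
    have "AE t in lebesgue. t \<in> I \<longrightarrow> (\<gamma> has_vector_derivative dL G (\<gamma> t) (v t)) (at t)"
      using v by (simp add: has_control_def)
    then show ?thesis
    proof (rule AE_mp, intro AE_I2 impI)
      fix t assume d: "t \<in> I \<longrightarrow> (\<gamma> has_vector_derivative dL G (\<gamma> t) (v t)) (at t)" and t: "t \<in> I"
      have vl: "v t \<in> layer G 1" using v t by (auto simp: has_control_def)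
      then have vV: "v t \<in> V" using layer_V[of 1] step_ge_1 by auto
      have "(\<gamma> has_vector_derivative L (\<gamma> t) (v t)) (at t)" using d t dL_eq_L[OF \<gamma>V[OF t] vV] by simp
      from vector_derivative_unique_at[OF this ode[OF t]]
      have "\<Theta> (\<gamma> t) (L (\<gamma> t) (v t)) = \<Theta> (\<gamma> t) (L (\<gamma> t) (q t))" by simp
      then have "v t = q t" using \<gamma>V[OF t] vV qV by simp
      then show "q t \<in> layer G 1" using vl by simp
    qed
  qed
  then have ae: "AE t in lebesgue. t \<in> I \<longrightarrow> p i (\<gamma> t) = 0" if i: "i < n" "carnot_rank G \<le> i" for i
  proof (rule AE_mp, intro AE_I2 impI)
    fix t assume "t \<in> I \<longrightarrow> q t \<in> layer G 1" "t \<in> I"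
    then have ql: "q t \<in> layer G 1" by simp
    have "X i \<notin> layer G 1" using ab i by (simp add: adapted_basis_def)
    then have "weight G (X i) \<noteq> 1" using adapted_weight[OF ab i(1)] by metis
    then have "g i (q t) = 0" using layer0[OF i(1) _ ql] step_ge_1 by simp
    moreover have "g i (q t) = (\<Sum>j<n. if j = i then p j (\<gamma> t) else 0)"
      unfolding q_def linear_sum[OF lin] linear_scale[OF lin] using gX i by (intro sum.cong) auto
    ultimately show "p i (\<gamma> t) = 0" using i by simp
  qed
  have "p i (\<gamma> t) = 0" if i: "i < n" "carnot_rank G \<le> i" for i
    using continuous_AE_zero[OF I polynomial_along_curve_continuous[OF ab p[OF i(1)] cont \<gamma>V] ae[OF i] t] .
  then have "q t = (\<Sum>i<carnot_rank G. p i (\<gamma> t) *\<^sub>R X i)"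
    unfolding q_def using rank_le(1)[OF ab] by (intro sum.mono_neutral_right) auto
  then show ?thesis using ode[OF t] by simp
qed

end

context carnot_curve
begin

text \<open>The weighted degree of a monomial is exactly the index that \<open>curve_component_alg\<close> and \<open>alg_mult\<close> give
for it.\<close>

lemma polynomial_alg:
  assumes ab: "adapted_basis G n X" and p: "polynomial_of_degree_le G n X d p"
  shows "(\<lambda>t. p (\<gamma> t)) \<in> alg d"
proof -
  obtain g :: "nat \<Rightarrow> ambient \<Rightarrow> real" where lin: "\<And>i. linear (g i)"
    and repr: "\<And>x i. x \<in> V \<Longrightarrow> i < n \<Longrightarrow> representation (X ` {..<n}) x (X i) = g i x"
    and layer0: "\<And>y i k. i < n \<Longrightarrow> k \<in> {1..step G} \<Longrightarrow> y \<in> layer G k \<Longrightarrow> k \<noteq> weight G (X i) \<Longrightarrow> g i y = 0"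
    by (rule adapted_coordinates[OF ab]) (rule that)
  obtain A c where A: "finite A" "\<And>\<alpha>. \<alpha> \<in> A \<Longrightarrow> (\<Sum>i<n. \<alpha> i * weight G (X i)) \<le> d"
    "\<And>x. x \<in> V \<Longrightarrow> p x = (\<Sum>\<alpha>\<in>A. c \<alpha> * (\<Prod>i<n. representation (X ` {..<n}) x (X i) ^ \<alpha> i))"
    using p unfolding polynomial_of_degree_le_def by auto
  have coord_alg: "(\<lambda>t. g i (\<gamma> t)) \<in> alg (weight G (X i))" if i: "i < n" for i
  proof -
    define m where "m = weight G (X i)"
    have m: "m \<in> {1..step G}" using adapted_weight(1)[OF ab i] by (simp add: m_def)
    have eq: "g i (component x m) = g i x" if x: "x \<in> V" for x
    proof -
      have "g i x = g i (\<Sum>k=1..step G. component x k)" using component_sum[OF x] by simp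
      also have "\<dots> = (\<Sum>k=1..step G. g i (component x k))" by (rule linear_sum[OF lin])
      also have "\<dots> = (\<Sum>k\<in>{m}. g i (component x k))"
      proof (rule sum.mono_neutral_right)
        show "\<forall>k\<in>{1..step G} - {m}. g i (component x k) = 0"
        proof
          fix k assume k: "k \<in> {1..step G} - {m}"
          then have "component x k \<in> layer G k" using component_lay[OF x, of k] by (simp add: lay_def)
          then show "g i (component x k) = 0" using layer0[OF i, of k] k by (auto simp: m_def)
        qed
      qed (use m in auto)
      finally show ?thesis by simp
    qed
    have bl: "bounded_linear (\<lambda>x. g i (pr x))"
      by (rule bounded_linear_on_V) (simp_all add: linear_add[OF lin] linear_scale[OF lin])
    have "(\<lambda>t. g i (pr (component (\<gamma> t) m))) \<in> alg m"
      by (rule curve_component_alg[of m, unfolded valg_def mem_Collect_eq, rule_format, OF bl])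
    moreover have "g i (pr (component (\<gamma> t) m)) = g i (\<gamma> t)" if "t \<in> I" for t
      using eq[OF curve_V[OF that]] component_lay[OF curve_V[OF that], of m] lay_V[of m] by auto
    ultimately have "(\<lambda>t. g i (\<gamma> t)) \<in> alg m" by (rule alg_cong)
    then show ?thesis by (simp add: m_def)
  qed
  have "(\<lambda>t. \<Sum>\<alpha>\<in>A. c \<alpha> * (\<Prod>i<n. g i (\<gamma> t) ^ \<alpha> i)) \<in> alg d"
  proof (intro alg_sum alg_scale)
    fix \<alpha> assume \<alpha>: "\<alpha> \<in> A"
    have "(\<lambda>t. \<Prod>i<n. g i (\<gamma> t) ^ \<alpha> i) \<in> alg (\<Sum>i<n. \<alpha> i * weight G (X i))"
      using coord_alg by (intro alg_prod alg_power) auto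
    then show "(\<lambda>t. \<Prod>i<n. g i (\<gamma> t) ^ \<alpha> i) \<in> alg d" using alg_mono[OF A(2)[OF \<alpha>]] by blast
  qed
  then show ?thesis
    by (rule alg_cong) (use A(3) curve_V repr in simp)
qed

lemma control_curve:
  assumes u: "\<And>i. i < r \<Longrightarrow> u i \<in> alg d"
  shows "has_control G I \<gamma> w"
proof -
  have cu: "continuous_on I (u i)" if "i < r" for i using alg_continuous[OF u[OF that]] .
  have ode: "(\<gamma> has_vector_derivative L (\<gamma> t) (w t)) (at t)" if "t \<in> I" for t
    using curve_ode[OF that] by (simp add: w_def)
  have c\<gamma>: "continuous_on I \<gamma>"
    using ode by (meson continuous_at_imp_continuous_on has_vector_derivative_continuous)
  have cw: "continuous_on I w" unfolding w_def[abs_def] using cu by (intro continuous_intros) auto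
  have "absolutely_continuous_on_interval a b \<gamma>" if "{a..b} \<subseteq> I" for a b
    by (rule C1_absolutely_continuous[where \<gamma>' = "\<lambda>t. L (\<gamma> t) (w t)"])
       (use ode that in auto, rule continuous_on_subset[OF continuous_L[OF c\<gamma> cw] that])
  moreover have "AE t in lebesgue. t \<in> I \<longrightarrow> (\<gamma> has_vector_derivative dL G (\<gamma> t) (w t)) (at t)"
    using ode dL_eq_L[OF curve_V w_V] by (intro AE_I2) simp
  ultimately show ?thesis
    unfolding has_control_def using curve_V w_layer by blast
qed

end

text \<open>The two hypotheses on homomorphisms are only available when the step of \<open>G\<close> is at most \<open>s\<close>. Without
them \<open>\<eta>\<close> may start anywhere, and the two curves just share their control.\<close>

lemma trajectory_lift:
  fixes F G :: "ambient carnot" and u :: "nat \<Rightarrow> real \<Rightarrow> real"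
  assumes F: "carnot F" and G: "carnot_curve G I r u X \<gamma>" and r: "2 \<le> r"
    and u: "\<And>i. i < r \<Longrightarrow> u i \<in> control_algebra.alg I r u d"
    and b: "\<And>i. i < r \<Longrightarrow> b i \<in> layer F 1" "layer F 1 = span (b ` {..<r})"
    and \<phi>: "linear \<phi>" "\<And>i. i < r \<Longrightarrow> \<phi> (b i) = X i"
    and nil: "lower_central (carrier F) (bracket F) s = {0}"
    and E: "E \<subseteq> carrier F" "finite E" "independent E"
    and big: "real r * (real (r + 1) ^ d * real (s + 1) * (real r - 1 / (real r * real (r + 1) ^ d)) ^ s) < real (card E)"
    and hom: "step G \<le> s \<Longrightarrow> lie_hom_on (carrier F) (bracket F) (carrier G) (bracket G) \<phi>"
      "step G \<le> s \<Longrightarrow> carrier G \<subseteq> \<phi> ` carrier F"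
  shows "\<exists>\<eta> v. abnormal_curve F I \<eta> \<and> has_control F I \<eta> v \<and> has_control G I \<gamma> (\<lambda>t. \<phi> (v t)) \<and>
    (step G \<le> s \<longrightarrow> is_lift F \<phi> I \<gamma> \<eta>)"
proof -
  interpret F: carnot F by (rule F)
  interpret G: carnot_curve G I r u X \<gamma> by (rule G)
  define v where "v t = (\<Sum>i<r. u i t *\<^sub>R b i)" for t
  have bV: "b i \<in> F.V" if "i < r" for i using b(1)[OF that] F.layer_V[of 1] F.step_ge_1 by auto
  have vV: "v t \<in> F.V" for t unfolding v_def using bV by (intro subspace_sum[OF F.subspace_V] F.scaleR_V) auto
  have cv: "continuous_on I v"
    unfolding v_def[abs_def] using G.alg_continuous[OF u] by (intro continuous_intros) auto
  have \<phi>v: "\<phi> (v t) = G.w t" for t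
    using \<phi>(2) by (simp add: v_def G.w_def linear_sum[OF \<phi>(1)] linear_scale[OF \<phi>(1)])
  have "\<exists>\<eta>. (\<forall>t\<in>I. \<eta> t \<in> F.V \<and> (\<eta> has_vector_derivative F.L (\<eta> t) (v t)) (at t)) \<and>
     (step G \<le> s \<longrightarrow> (\<exists>t\<in>I. \<phi> (\<eta> t) = \<gamma> t) \<or> I = {})"
  proof (cases "I = {}")
    case False
    then obtain t0 where t0: "t0 \<in> I" by blast
    have "\<exists>x0\<in>F.V. step G \<le> s \<longrightarrow> \<phi> x0 = \<gamma> t0"
    proof (cases "step G \<le> s")
      case True
      have "\<gamma> t0 \<in> \<phi> ` F.V" by (rule subsetD[OF hom(2)[OF True] G.curve_V[OF t0]])
      then show ?thesis by (auto simp: image_iff)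
    next
      case False
      then show ?thesis using F.zero_V by blast
    qed
    then obtain x0 where x0: "x0 \<in> F.V" "step G \<le> s \<Longrightarrow> \<phi> x0 = \<gamma> t0" by blast
    obtain \<eta> where "\<eta> t0 = x0" "\<forall>t\<in>I. \<eta> t \<in> F.V \<and> (\<eta> has_vector_derivative F.L (\<eta> t) (v t)) (at t)"
      using F.left_invariant_ode_exists[OF nil G.open_I G.interval_I t0 cv vV x0(1)] by blast
    then show ?thesis using x0(2) t0 by blast
  qed simp
  then obtain \<eta> where \<eta>: "\<And>t. t \<in> I \<Longrightarrow> \<eta> t \<in> F.V"
      "\<And>t. t \<in> I \<Longrightarrow> (\<eta> has_vector_derivative F.L (\<eta> t) (v t)) (at t)"
    and start: "step G \<le> s \<Longrightarrow> (\<exists>t\<in>I. \<phi> (\<eta> t) = \<gamma> t) \<or> I = {}" by blast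
  interpret C: carnot_curve F I r u b \<eta>
    by unfold_locales (use b(1) \<eta> in \<open>auto simp: v_def\<close>)
  have Cw: "C.w = v" by (simp add: C.w_def v_def fun_eq_iff)
  have hcF: "has_control F I \<eta> v" using C.control_curve[OF u] by (simp add: Cw)
  have hcG: "has_control G I \<gamma> (\<lambda>t. \<phi> (v t))" using G.control_curve[OF u] by (simp add: \<phi>v)
  obtain l :: "ambient \<Rightarrow> real" where "linear l" "\<exists>x\<in>F.V. l x \<noteq> 0" "\<forall>t\<in>I. \<forall>x\<in>layer F 1. l (Ad F (\<eta> t) x) = 0"
    using C.annihilating_covector[OF r nil u b(2) E big] by blast
  then have ab: "abnormal_curve F I \<eta>"
    using hcF unfolding abnormal_curve_def horizontal_curve_def by blast
  have "is_lift F \<phi> I \<gamma> \<eta>" if s: "step G \<le> s"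
    unfolding is_lift_def
  proof (intro conjI ballI)
    show "horizontal_curve F I \<eta>" using hcF unfolding horizontal_curve_def by blast
    fix t assume t: "t \<in> I"
    then obtain t0 where t0: "t0 \<in> I" "\<phi> (\<eta> t0) = \<gamma> t0" using start[OF s] by blast
    have im: "\<phi> x \<in> G.V" if "x \<in> F.V" for x using hom(1)[OF s] that by (auto simp: lie_hom_on_def)
    show "\<phi> (\<eta> t) = \<gamma> t"
    proof (rule G.left_invariant_ode_unique[OF G.open_I G.interval_I t0(1) t, where u = G.w])
      show "((\<lambda>t. \<phi> (\<eta> t)) has_vector_derivative G.L (\<phi> (\<eta> t)) (G.w t)) (at t)" if "t \<in> I" for t
        using lie_hom_curve[OF F G.carnot_axioms hom(1)[OF s] \<eta>(2)[OF that] \<eta>(1)[OF that] vV G.open_I that \<eta>(1)]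
        by (simp add: \<phi>v)
      show "(\<gamma> has_vector_derivative G.L (\<gamma> t) (G.w t)) (at t)" if "t \<in> I" for t
        using G.curve_ode[OF that] by (simp add: G.w_def)
    qed (use im \<eta>(1) G.curve_V t0 in auto)
  qed
  then show ?thesis using ab hcF hcG by blast
qed

section \<open>Abnormal lifts\<close>

text \<open>The linear map \<open>\<phi>\<close> sends free generators to the horizontal basis vectors. If the step of \<open>G\<close> is at most
\<open>s\<close>, it can be taken to be the Lie algebra homomorphism of the universal property; in exponential
coordinates it is then itself the group homomorphism \<open>\<pi>\<close>.\<close>

theorem theorem4p1:
  fixes r d :: nat
  assumes "2 \<le> r"
  shows "\<exists>s\<ge>1. \<forall>(F :: ambient carnot) (G :: ambient carnot) n X p P.
    free_carnot_group r s F \<longrightarrow>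
    carnot_group G \<longrightarrow> carnot_rank G = r \<longrightarrow> adapted_basis G n X \<longrightarrow>
    (\<forall>i<n. polynomial_on G n X (p i)) \<longrightarrow>
    (\<forall>x\<in>carrier G. P x = (\<Sum>i<n. p i x *\<^sub>R dL G x (X i))) \<longrightarrow>
    (\<forall>i<r. polynomial_of_degree_le G n X d (p i)) \<longrightarrow>
    (\<exists>\<phi> \<pi>. linear \<phi> \<and> bij_betw \<phi> (layer F 1) (layer G 1) \<and>
      (step G \<le> s \<longrightarrow>
        carnot_hom F G \<pi> \<and> (\<forall>Y\<in>layer F 1. differential_at_one \<pi> Y = \<phi> Y)) \<and>
      (\<forall>I \<gamma>. open I \<longrightarrow> is_interval I \<longrightarrow> horizontal_trajectory G P I \<gamma> \<longrightarrow>
        (\<exists>\<eta> u. abnormal_curve F I \<eta> \<and>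
          has_control F I \<eta> u \<and> has_control G I \<gamma> (\<lambda>t. \<phi> (u t)) \<and>
          (step G \<le> s \<longrightarrow> is_lift F \<pi> I \<gamma> \<eta>))))"
proof -
  obtain k q where k: "1 \<le> k" and "\<forall>s. s = k + 1 + k * q \<longrightarrow>
    real r * (real (r + 1) ^ d * real (s + 1) * (real r - 1 / (real r * real (r + 1) ^ d)) ^ s)
      < real ((r ^ (k - 1) * (r - 1)) ^ q)"
    using large_step_exists[OF assms, of d] by blast
  moreover define s where "s = k + 1 + k * q"
  ultimately have big: "real r * (real (r + 1) ^ d * real (s + 1) * (real r - 1 / (real r * real (r + 1) ^ d)) ^ s)
      < real ((r ^ (k - 1) * (r - 1)) ^ q)" by blast
  show ?thesis
  proof (intro exI[of _ s] conjI allI impI)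
    show "1 \<le> s" by (simp add: s_def)
    fix F G :: "ambient carnot" and n X p P
    assume free: "free_carnot_group r s F" and cG: "carnot_group G" and rank: "carnot_rank G = r"
      and ab: "adapted_basis G n X" and poly: "\<forall>i<n. polynomial_on G n X (p i)"
      and P: "\<forall>x\<in>carrier G. P x = (\<Sum>i<n. p i x *\<^sub>R dL G x (X i))"
      and deg: "\<forall>i<r. polynomial_of_degree_le G n X d (p i)"
    obtain B where cF: "carnot_group F" and B: "independent B" "card B = r" "span B = layer F 1"
      and fr: "free_nilpotent_on s B (carrier F) (bracket F)"
      using free unfolding free_carnot_group_def by blast
    interpret F: carnot F by unfold_locales (rule cF)
    interpret G: carnot G by unfold_locales (rule cG)
    have finB: "finite B" using B(2) assms card_ge_0_finite[of B] by simp
    obtain E where E: "E \<subseteq> F.V" "finite E" "independent E" "card E = (r ^ (k - 1) * (r - 1)) ^ q"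
      using free_nilpotent_large_dimension[OF fr finB B(2) k assms s_def] by blast
    have nil: "F.lc s = {0}" using fr unfolding free_nilpotent_on_def nilpotent_of_step_le_def by blast
    obtain b where b: "bij_betw b {0..<r} B" using ex_bij_betw_nat_finite[OF finB] B(2) by auto
    have bB: "b ` {..<r} = B" and b_inj: "inj_on b {..<r}"
      using b by (auto simp: bij_betw_def lessThan_atLeast0)
    have rn: "r \<le> n" and layer1: "layer G 1 = span (X ` {..<r})"
      using G.rank_le[OF ab] rank by auto
    have X_layer: "X i \<in> layer G 1" if "i < r" for i
      unfolding layer1 using that by (intro span_base) auto
    have layer1V: "layer G 1 \<subseteq> G.V" using G.layer_V[of 1] G.step_ge_1 by auto
    define f where "f y = X (inv_into {..<r} b y)" for y
    have f: "f (b i) = X i" if "i < r" for i using that b_inj by (simp add: f_def inv_into_f_f)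
    have "\<exists>\<phi>. linear \<phi> \<and> (\<forall>y\<in>B. \<phi> y = f y) \<and>
      (step G \<le> s \<longrightarrow> lie_hom_on F.V (bracket F) G.V (bracket G) \<phi>)"
    proof (cases "step G \<le> s")
      case True
      have nG: "nilpotent_of_step_le s G.V (bracket G)"
        unfolding nilpotent_of_step_le_def
        using G.lc_antimono[OF True] G.lc_step subspace_0[OF G.lc_subspace, of s] by blast
      have fB: "f ` B \<subseteq> G.V" using f X_layer layer1V unfolding bB[symmetric] by auto
      have universal: "\<forall>(W :: ambient set) br' f. lie_algebra_on W br' \<and> nilpotent_of_step_le s W br' \<and> f ` B \<subseteq> W \<longrightarrow>
        (\<exists>\<phi>. lie_hom_on F.V (bracket F) W br' \<phi> \<and> (\<forall>b\<in>B. \<phi> b = f b) \<and>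
          (\<forall>\<psi>. lie_hom_on F.V (bracket F) W br' \<psi> \<and> (\<forall>b\<in>B. \<psi> b = f b) \<longrightarrow> (\<forall>x\<in>F.V. \<psi> x = \<phi> x)))"
        using fr unfolding free_nilpotent_on_def by (elim conjE)
      obtain \<phi> where h: "lie_hom_on F.V (bracket F) G.V (bracket G) \<phi>" "\<forall>y\<in>B. \<phi> y = f y"
        using universal[THEN spec, of G.V, THEN spec, of "bracket G", THEN spec, of f, THEN mp,
            OF conjI[OF G.lie_algebra_V conjI[OF nG fB]]]
        by (elim exE conjE) (rule that)
      have "linear \<phi>" by (rule h(1)[unfolded lie_hom_on_def, THEN conjunct1])
      then show ?thesis using h by (intro exI[of _ \<phi>] conjI impI)
    next
      case False
      then show ?thesis using linear_independent_extend[OF B(1), of f] by simp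
    qed
    then obtain \<phi> where \<phi>: "linear \<phi>" "\<And>y. y \<in> B \<Longrightarrow> \<phi> y = f y"
      and hom: "step G \<le> s \<Longrightarrow> lie_hom_on F.V (bracket F) G.V (bracket G) \<phi>" by blast
    have \<phi>b: "\<phi> (b i) = X i" if "i < r" for i using \<phi>(2)[of "b i"] f[OF that] bB that by auto
    have \<phi>B: "\<phi> ` B = X ` {..<r}" unfolding bB[symmetric] using \<phi>b by (auto simp: image_image)
    have bij: "bij_betw \<phi> (layer F 1) (layer G 1)"
    proof -
      have Xr: "X ` {..<r} \<subseteq> X ` {..<n}" using rn by auto
      have "independent (\<phi> ` B)"
        unfolding \<phi>B using ab independent_mono[OF _ Xr] by (simp add: adapted_basis_def)
      moreover have "inj_on \<phi> B"
      proof (rule eq_card_imp_inj_on[OF finB])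
        have "inj_on X {..<r}" using ab rn by (auto simp: adapted_basis_def intro: inj_on_subset)
        then show "card (\<phi> ` B) = card B" by (simp add: \<phi>B card_image B(2))
      qed
      ultimately have "inj_on \<phi> (span B)" by (rule linear_inj_on_span_independent_image[OF \<phi>(1)])
      moreover have "\<phi> ` span B = span (\<phi> ` B)" by (rule linear_span_image[OF \<phi>(1), symmetric])
      ultimately show ?thesis unfolding bij_betw_def B(3)[symmetric] layer1 \<phi>B by blast
    qed
    have surj: "G.V \<subseteq> \<phi> ` F.V" if "step G \<le> s"
    proof (rule lie_hom_surj[OF F.carnot_axioms G.carnot_axioms hom[OF that]])
      have "layer F 1 \<subseteq> F.V" using F.layer_V[of 1] F.step_ge_1 by simp
      then show "layer G 1 \<subseteq> \<phi> ` F.V"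
        using bij_betw_imp_surj_on[OF bij] image_mono by metis
    qed
    have d1: "differential_at_one \<phi> Y = \<phi> Y" for Y
      unfolding differential_at_one_def
      by (rule vector_derivative_at)
         (auto intro!: derivative_eq_intros simp: linear_scale[OF \<phi>(1)])
    have chom: "carnot_hom F G \<phi>" if "step G \<le> s"
      unfolding carnot_hom_def
    proof (intro conjI)
      show "\<phi> \<in> Group.hom F G"
        using hom[OF that] lie_hom_group_hom[OF F.carnot_axioms G.carnot_axioms hom[OF that]]
        by (auto simp: hom_def lie_hom_on_def)
      have "bounded_linear (\<lambda>x. \<phi> (F.pr x))"
        by (rule F.bounded_linear_on_V) (simp_all add: linear_add[OF \<phi>(1)] linear_scale[OF \<phi>(1)])
      then have "continuous_on F.V (\<lambda>x. \<phi> (F.pr x))"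
        by (rule bounded_linear.continuous_on) (rule continuous_on_id)
      then have "continuous_on F.V \<phi>" using continuous_on_cong[of F.V F.V "\<lambda>x. \<phi> (F.pr x)" \<phi>] by simp
      then show "smooth_on F.V \<phi>" by (rule smooth_on_linear[OF \<phi>(1)])
      show "differential_at_one \<phi> ` layer F 1 \<subseteq> layer G 1"
        using bij_betw_imp_surj_on[OF bij] d1 by (metis image_cong order_refl)
    qed
    have lift: "\<exists>\<eta> v. abnormal_curve F I \<eta> \<and> has_control F I \<eta> v \<and> has_control G I \<gamma> (\<lambda>t. \<phi> (v t)) \<and>
        (step G \<le> s \<longrightarrow> is_lift F \<phi> I \<gamma> \<eta>)"
      if I: "open I" "is_interval I" and traj: "horizontal_trajectory G P I \<gamma>" for I \<gamma>
    proof -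
      define u where "u i t = p i (\<gamma> t)" for i t
      have \<gamma>V: "\<gamma> t \<in> G.V" if "t \<in> I" for t
        using traj that by (auto simp: horizontal_trajectory_def horizontal_curve_def has_control_def)
      have ode: "(\<gamma> has_vector_derivative G.L (\<gamma> t) (\<Sum>i<r. u i t *\<^sub>R X i)) (at t)" if "t \<in> I" for t
        using G.trajectory_horizontal[OF ab _ _ I(1) traj that, of p] poly P rank by (simp add: u_def)
      interpret C: carnot_curve G I r u X \<gamma>
        by unfold_locales (use I X_layer \<gamma>V ode in auto)
      have u: "u i \<in> C.alg d" if "i < r" for i
        using C.polynomial_alg[OF ab, of d "p i"] deg that by (simp add: u_def[abs_def])
      show ?thesis
      proof (rule trajectory_lift[OF F.carnot_axioms C.carnot_curve_axioms assms u _ _ \<phi>(1) \<phi>b nil E(1-3) _ hom surj])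
        show "b i \<in> layer F 1" if "i < r" for i unfolding B(3)[symmetric] using that bB by (intro span_base) auto
        show "layer F 1 = span (b ` {..<r})" using bB B(3) by simp
        show "real r * (real (r + 1) ^ d * real (s + 1) * (real r - 1 / (real r * real (r + 1) ^ d)) ^ s)
            < real (card E)" using big E(4) by simp
      qed
    qed
    show "\<exists>\<phi> \<pi>. linear \<phi> \<and> bij_betw \<phi> (layer F 1) (layer G 1) \<and>
      (step G \<le> s \<longrightarrow>
        carnot_hom F G \<pi> \<and> (\<forall>Y\<in>layer F 1. differential_at_one \<pi> Y = \<phi> Y)) \<and>
      (\<forall>I \<gamma>. open I \<longrightarrow> is_interval I \<longrightarrow> horizontal_trajectory G P I \<gamma> \<longrightarrow>
        (\<exists>\<eta> u. abnormal_curve F I \<eta> \<and>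
          has_control F I \<eta> u \<and> has_control G I \<gamma> (\<lambda>t. \<phi> (u t)) \<and>
          (step G \<le> s \<longrightarrow> is_lift F \<pi> I \<gamma> \<eta>)))"
      using \<phi>(1) bij chom d1 lift by (intro exI[of _ \<phi>]) blast
  qed
qed

end
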